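(* Let $\mu_1,\dots,\mu_r$ be an Angelesco system: each $\mu_i$ is a finite positive Borel measure on $\mathbb{R}$ whose support has convex hull a compact interval $\Delta_i$, the intervals $\Delta_1,\dots,\Delta_r$ are pairwise disjoint, and $\mu_i'(x)>0$ for Lebesgue-a.e. $x\in\Delta_i$, $i=1,\dots,r$, where $\mu_i'$ is the density of the absolutely continuous part of $\mu_i$. Let $\mu=\mu_1+\dots+\mu_r$. Let $(\vec n_\ell)_{\ell\ge0}$ be a path as in the context with $\lim_{\ell\to\infty}\vec n_\ell/|\vec n_\ell|=(s_1,\dots,s_r)$ where $s_i>0$ and $\sum_is_i=1$. Then \[ \tfrac1nK_n(x,x)\,d\mu(x)\ \longrightarrow\ \nu_\infty\quad\text{weakly as }n\to\infty, \] where $\nu_\infty=\omega_1+\dots+\omega_r$ and $(\omega_1,\dots,\omega_r)$ is the unique minimizer of $E(\eta_1,\dots,\eta_r)=\sum_{j=1}^rI(\eta_j,\eta_j)+\sum_{j=1}^{r-1}\sum_{k=j+1}^rI(\eta_j,\eta_k)$ over positive measures $\eta_i$ with $\operatorname{supp}(\eta_i)\subset\Delta_i$ and $\eta_i(\Delta_i)=s_i$.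
   Context: Angelesco systems (with infinite supports) are perfect: for every $\vec n\in\mathbb{N}_0^r$ there is a monic polynomial $P_{\vec n}$ of degree $|\vec n|=n_1+\dots+n_r$ with $\int x^kP_{\vec n}\,d\mu_j=0$ for $0\le k\le n_j-1$, $1\le j\le r$. Type I polynomials $A_{\vec n}=(A_{\vec n,1},\dots,A_{\vec n,r})$: $\deg A_{\vec n,j}\le n_j-1$, $\sum_j\int x^kA_{\vec n,j}\,d\mu_j=0$ for $0\le k\le|\vec n|-2$, and $=1$ for $k=|\vec n|-1$. With $w_j=d\mu_j/d\mu$, $Q_{\vec n}=\sum_jA_{\vec n,j}w_j$. A path is a sequence $(\vec n_\ell)_{\ell\ge0}$ with $|\vec n_\ell|=\ell$ and $\vec n_{\ell+1}=\vec n_\ell+\vec e_{i_\ell}$ ($\vec e_j$ the $j$-th unit vector); set $p_\ell=P_{\vec n_\ell}$, $q_\ell=Q_{\vec n_{\ell+1}}$ and $K_n(x,y)=\sum_{j=0}^{n-1}p_j(x)q_j(y)$. For compactly supported positive measures, $I(\eta,\nu)=\int\int\log\frac1{|z-w|}\,d\eta(z)\,d\nu(w)$. It is known that under these hypotheses the minimizer exists and is unique. Weak convergence means convergence of integrals of every bounded continuous function on $\mathbb{R}$. *)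

theory Defs
  imports "HOL-Probability.Probability" "HOL-Computational_Algebra.Polynomial"
begin

definition msupp :: "real measure \<Rightarrow> real set" where
  "msupp M = {x. \<forall>e>0. emeasure M (ball x e) > 0}"

definition multi_idx :: "nat \<Rightarrow> (nat \<Rightarrow> nat) set" where
  "multi_idx r = {n. \<forall>i\<ge>r. n i = 0}"

definition mlen :: "nat \<Rightarrow> (nat \<Rightarrow> nat) \<Rightarrow> nat" where
  "mlen r n = (\<Sum>i<r. n i)"

definition msum :: "nat \<Rightarrow> (nat \<Rightarrow> real measure) \<Rightarrow> real measure" where
  "msum r \<mu>s = measure_of UNIV (sets borel) (\<lambda>A. \<Sum>i<r. emeasure (\<mu>s i) A)"

definition angelesco :: "nat \<Rightarrow> (nat \<Rightarrow> real measure) \<Rightarrow> (nat \<Rightarrow> real) \<Rightarrow> (nat \<Rightarrow> real) \<Rightarrow> bool" where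
  "angelesco r \<mu>s a b \<longleftrightarrow>
     (\<forall>i<r. sets (\<mu>s i) = sets borel \<and> finite_measure (\<mu>s i) \<and> a i < b i
        \<and> convex hull (msupp (\<mu>s i)) = {a i..b i}
        \<comment> \<open>Lebesgue decomposition mu_i = f lborel + singular part, with f > 0 a.e. on Delta_i\<close>
        \<and> (\<exists>f :: real \<Rightarrow> ennreal. \<exists>\<sigma>. f \<in> borel_measurable borel \<and> sets \<sigma> = sets borel
             \<and> (\<exists>N\<in>sets borel. emeasure lborel N = 0 \<and> emeasure \<sigma> (UNIV - N) = 0)
             \<and> (\<forall>A\<in>sets borel. emeasure (\<mu>s i) A = (\<integral>\<^sup>+x\<in>A. f x \<partial>lborel) + emeasure \<sigma> A)
             \<and> (AE x in lborel. x \<in> {a i..b i} \<longrightarrow> f x > 0)))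
   \<and> (\<forall>i<r. \<forall>j<r. i \<noteq> j \<longrightarrow> {a i..b i} \<inter> {a j..b j} = {})"

definition typeII :: "nat \<Rightarrow> (nat \<Rightarrow> real measure) \<Rightarrow> (nat \<Rightarrow> nat) \<Rightarrow> real poly \<Rightarrow> bool" where
  "typeII r \<mu>s n P \<longleftrightarrow> lead_coeff P = 1 \<and> degree P = mlen r n
     \<and> (\<forall>j<r. \<forall>k<n j. (\<integral>x. x ^ k * poly P x \<partial>(\<mu>s j)) = 0)"

(* type I multiple orthogonal polynomials A_n = (A_{n,0},...,A_{n,r-1}); deg A_{n,j} <= n_j - 1
   means A_{n,j} = 0 when n_j = 0 *)
definition typeI :: "nat \<Rightarrow> (nat \<Rightarrow> real measure) \<Rightarrow> (nat \<Rightarrow> nat) \<Rightarrow> (nat \<Rightarrow> real poly) \<Rightarrow> bool" where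
  "typeI r \<mu>s n A \<longleftrightarrow> (\<forall>j<r. A j = 0 \<or> degree (A j) < n j)
     \<and> (\<forall>k. k + 2 \<le> mlen r n \<longrightarrow> (\<Sum>j<r. \<integral>x. x ^ k * poly (A j) x \<partial>(\<mu>s j)) = 0)
     \<and> (\<Sum>j<r. \<integral>x. x ^ (mlen r n - 1) * poly (A j) x \<partial>(\<mu>s j)) = 1"

definition is_path :: "nat \<Rightarrow> (nat \<Rightarrow> nat \<Rightarrow> nat) \<Rightarrow> bool" where
  "is_path r p \<longleftrightarrow> p 0 = (\<lambda>_. 0)
     \<and> (\<forall>l. \<exists>i<r. p (Suc l) = (p l)(i := p l i + 1))"

(* logarithmic energy I(eta,nu) = double integral of log(1/|z-w|), as positive part minus
   negative part (kernel is +infinity on the diagonal) *)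
definition log_energy :: "real measure \<Rightarrow> real measure \<Rightarrow> ereal" where
  "log_energy \<eta> \<nu> =
     enn2ereal (\<integral>\<^sup>+z. \<integral>\<^sup>+w. (if z = w then \<infinity> else ennreal (- ln \<bar>z - w\<bar>)) \<partial>\<nu> \<partial>\<eta>)
   - enn2ereal (\<integral>\<^sup>+z. \<integral>\<^sup>+w. (if z = w then 0 else ennreal (ln \<bar>z - w\<bar>)) \<partial>\<nu> \<partial>\<eta>)"

definition angelesco_energy :: "nat \<Rightarrow> (nat \<Rightarrow> real measure) \<Rightarrow> ereal" where
  "angelesco_energy r \<eta> =
     (\<Sum>j<r. log_energy (\<eta> j) (\<eta> j)) + (\<Sum>j<r. \<Sum>k\<in>{j<..<r}. log_energy (\<eta> j) (\<eta> k))"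

definition admissible :: "nat \<Rightarrow> (nat \<Rightarrow> real) \<Rightarrow> (nat \<Rightarrow> real) \<Rightarrow> (nat \<Rightarrow> real) \<Rightarrow> (nat \<Rightarrow> real measure) \<Rightarrow> bool" where
  "admissible r a b s \<eta> \<longleftrightarrow> (\<forall>i<r. sets (\<eta> i) = sets borel \<and> finite_measure (\<eta> i)
      \<and> msupp (\<eta> i) \<subseteq> {a i..b i} \<and> emeasure (\<eta> i) {a i..b i} = ennreal (s i))"

definition energy_minimizer :: "nat \<Rightarrow> (nat \<Rightarrow> real) \<Rightarrow> (nat \<Rightarrow> real) \<Rightarrow> (nat \<Rightarrow> real) \<Rightarrow> (nat \<Rightarrow> real measure) \<Rightarrow> bool" where
  "energy_minimizer r a b s \<omega> \<longleftrightarrow> admissible r a b s \<omega>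
     \<and> (\<forall>\<eta>. admissible r a b s \<eta> \<longrightarrow> angelesco_energy r \<omega> \<le> angelesco_energy r \<eta>)"

(* Christoffel-Darboux kernel K_n(x,y) = sum_{j<n} p_j(x) q_j(y), with
   p_j = P_{n_j}, q_j = Q_{n_{j+1}} = sum_i A_{n_{j+1},i} w_i, w_i = d mu_i / d mu *)
definition cd_kernel :: "nat \<Rightarrow> (nat \<Rightarrow> real measure) \<Rightarrow> (nat \<Rightarrow> nat \<Rightarrow> nat)
    \<Rightarrow> ((nat \<Rightarrow> nat) \<Rightarrow> real poly) \<Rightarrow> ((nat \<Rightarrow> nat) \<Rightarrow> nat \<Rightarrow> real poly)
    \<Rightarrow> nat \<Rightarrow> real \<Rightarrow> real \<Rightarrow> real" where
  "cd_kernel r \<mu>s p P A n x y =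
     (\<Sum>j<n. poly (P (p j)) x *
        (\<Sum>i<r. poly (A (p (Suc j)) i) y * enn2real (RN_deriv (msum r \<mu>s) (\<mu>s i) y)))"

end

theory Submission
  imports Defs "Jordan_Normal_Form.Determinant"
begin

text \<open>
  The measure \<open>K_n(x,x) d\<mu>(x)\<close> is the one-point function of a log-gas with \<open>n_j\<close> particles in \<open>\<Delta>_j\<close> whose
  joint weight is \<open>\<Prod> |x - x'|^2\<close> over pairs in the same interval times \<open>\<Prod> |x - x'|\<close> over pairs in different
  intervals, that is, \<open>exp (- n^2 E)\<close> evaluated at the empirical measures. So no zero asymptotics of the
  polynomials are needed: the partition function is bounded below by Jensen's inequality at absolutely continuous
  approximations of the minimizer, and exponential moments are bounded above by replacing \<open>- ln |x|\<close> by its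
  tangent-line truncation at \<open>|x| = d\<close>. The truncated kernel is a mixture of the triangle functions
  \<open>max 0 (1 - |x| / s)\<close>, hence conditionally positive definite. This makes the truncated energy convex and gives,
  quantitatively, both its lower bound by the minimal energy (averaging over translations decreases it) and
  the control of \<open>\<integral> f d(\<nu> - \<omega>)\<close> for smooth \<open>f\<close>, so no compactness argument is involved.
\<close>

text \<open>The positive weight comes from two determinants. Coordinate \<open>m\<close> carries the
  label \<open>g m\<close> of step \<open>m\<close> of the path and lives on that interval. The type
  II polynomials give a full Vandermonde determinant, the type I functions one product of
  differences within each label. Disjointness of the intervals fixes the sign of the remaining
  factors, so the product is, up to a constant sign, the weight of the log-gas. All comparisons take
  place at the scale exp(n^2). Self-interactions, total masses and density bounds enter only as
  factors exp(O(n)), which is why positivity of the densities almost everywhere suffices. A linear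
  statistic is tested by adding \<open>\<tau>\<close> times n times the sum of f to the exponent.
  The gain is linear in \<open>\<tau>\<close>, the loss is quadratic by convexity, and f and -f
  together give the limit. The parameters \<open>\<tau>\<close>, \<open>\<epsilon>\<close> and
  \<open>d\<close> are fixed before n grows. Label frequencies only converge to s, so a
  configuration is not an admissible competitor as it stands; its points are reweighted
  first.\<close>

definition fin_borel :: "real measure \<Rightarrow> bool" where
  "fin_borel M \<longleftrightarrow> sets M = sets borel \<and> finite_measure M"

text \<open>The triangle and truncated kernels are of this kind, so against finite measures all
  their double integrals converge absolutely.\<close>

definition bdd_borel :: "(real \<Rightarrow> real) \<Rightarrow> bool" where
  "bdd_borel f \<longleftrightarrow> f \<in> borel_measurable borel \<and> bounded (range f)"

lemma fin_borelD:
  assumes "fin_borel M"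
  shows "sets M = sets borel" "space M = UNIV" "finite_measure M" "sigma_finite_measure M"
    "emeasure M A \<noteq> \<infinity>"
proof -
  show s: "sets M = sets borel" and f: "finite_measure M" using assms by (auto simp: fin_borel_def)
  show "space M = UNIV" using sets_eq_imp_space_eq[OF s] by simp
  interpret finite_measure M by fact
  show "sigma_finite_measure M" by unfold_locales
  show "emeasure M A \<noteq> \<infinity>" by simp
qed

lemma bdd_borelI:
  assumes "f \<in> borel_measurable borel" "\<And>x. \<bar>f x\<bar> \<le> B"
  shows "bdd_borel f"
  using assms unfolding bdd_borel_def bounded_iff by auto

lemma bdd_borelE:
  assumes "bdd_borel f"
  obtains B where "B > 0" "\<And>x. \<bar>f x\<bar> \<le> B"
proof -
  obtain B where "\<And>x. \<bar>f x\<bar> \<le> B" using assms unfolding bdd_borel_def bounded_iff by auto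
  then have "\<And>x. \<bar>f x\<bar> \<le> max B 1" by (meson max.coboundedI1)
  then show ?thesis using that[of "max B 1"] by auto
qed

lemma bdd_borel_meas: "bdd_borel f \<Longrightarrow> f \<in> borel_measurable borel"
  by (simp add: bdd_borel_def)

lemma integrable_fin_borel:
  fixes f :: "real \<Rightarrow> real"
  assumes "fin_borel M" "f \<in> borel_measurable borel" "\<And>x. \<bar>f x\<bar> \<le> B"
  shows "integrable M f"
proof -
  interpret finite_measure M using assms(1) by (simp add: fin_borel_def)
  have "f \<in> borel_measurable M"
    using assms(2) measurable_cong_sets[OF fin_borelD(1)[OF assms(1)], of borel borel] by auto
  then show ?thesis
    using assms(3) by (intro integrable_const_bound[where B=B]) auto
qed

lemma integrable_bdd_borel: "fin_borel M \<Longrightarrow> bdd_borel f \<Longrightarrow> integrable M f"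
  by (metis bdd_borelE bdd_borel_meas integrable_fin_borel)

subsection \<open>Finite sums and mixtures of measures\<close>

lemma sets_msum [simp]: "sets (msum r M) = sets borel"
  unfolding msum_def using sets.sigma_sets_eq[of "borel :: real measure"] by (simp add: sets_measure_of)

lemma space_msum [simp]: "space (msum r M) = UNIV"
  unfolding msum_def by (simp add: space_measure_of)

lemma measurable_msum [simp]: "measurable (msum r M) N = measurable borel N"
  by (rule measurable_cong_sets) simp_all

lemma emeasure_msum:
  assumes "\<And>i. i < r \<Longrightarrow> sets (M i) = sets borel" and A: "A \<in> sets borel"
  shows "emeasure (msum r M) A = (\<Sum>i<r. emeasure (M i) A)"
proof (rule emeasure_measure_of[OF msum_def])
  show "positive (sets (msum r M)) (\<lambda>A. \<Sum>i<r. emeasure (M i) A)" by (simp add: positive_def)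
  show "A \<in> sets (msum r M)" using A by simp
  show "countably_additive (sets (msum r M)) (\<lambda>A. \<Sum>i<r. emeasure (M i) A)"
  proof (rule countably_additiveI)
    fix F :: "nat \<Rightarrow> real set"
    assume F: "range F \<subseteq> sets (msum r M)" "disjoint_family F"
    have "(\<Sum>n. \<Sum>i<r. emeasure (M i) (F n)) = (\<Sum>i<r. \<Sum>n. emeasure (M i) (F n))"
      by (rule suminf_sum) simp
    also have "\<dots> = (\<Sum>i<r. emeasure (M i) (\<Union> (range F)))"
      using F assms by (intro sum.cong refl suminf_emeasure) auto
    finally show "(\<Sum>n. \<Sum>i<r. emeasure (M i) (F n)) = (\<Sum>i<r. emeasure (M i) (\<Union> (range F)))" .
  qed
qed auto

lemma nn_integral_msum:
  assumes M: "\<And>i. i < r \<Longrightarrow> sets (M i) = sets borel" and f: "f \<in> borel_measurable borel"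
  shows "(\<integral>\<^sup>+x. f x \<partial>msum r M) = (\<Sum>i<r. \<integral>\<^sup>+x. f x \<partial>M i)"
  using f
proof (induction rule: borel_measurable_induct)
  case (cong f g)
  then show ?case by (simp add: fun_eq_iff)
next
  case (set A)
  then show ?case using M by (simp add: emeasure_msum)
next
  case (mult u c)
  have "\<And>i. i < r \<Longrightarrow> u \<in> borel_measurable (M i)"
    using mult(2) M by (metis measurable_cong_sets)
  then show ?case using mult by (simp add: nn_integral_cmult sum_distrib_left)
next
  case (add u v)
  have "\<And>i. i < r \<Longrightarrow> u \<in> borel_measurable (M i) \<and> v \<in> borel_measurable (M i)"
    using add M by (metis measurable_cong_sets)
  then show ?case using add by (simp add: nn_integral_add sum.distrib)
next
  case (seq U)
  have mi: "\<And>i n. i < r \<Longrightarrow> U n \<in> borel_measurable (M i)"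
    using seq(1) M by (metis measurable_cong_sets)
  have "(\<integral>\<^sup>+x. (SUP n. U n) x \<partial>msum r M) = (\<integral>\<^sup>+x. (SUP n. U n x) \<partial>msum r M)"
    by (simp add: image_comp)
  also have "\<dots> = (SUP n. \<integral>\<^sup>+x. U n x \<partial>msum r M)"
    by (rule nn_integral_monotone_convergence_SUP) (use seq in auto)
  also have "\<dots> = (SUP n. \<Sum>i<r. \<integral>\<^sup>+x. U n x \<partial>M i)" using seq by simp
  also have "\<dots> = (\<Sum>i<r. SUP n. \<integral>\<^sup>+x. U n x \<partial>M i)"
    by (rule ennreal_SUP_sum) (use seq mi in \<open>auto simp: incseq_def le_fun_def intro!: nn_integral_mono\<close>)
  also have "\<dots> = (\<Sum>i<r. \<integral>\<^sup>+x. (SUP n. U n x) \<partial>M i)"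
    using seq mi by (intro sum.cong refl nn_integral_monotone_convergence_SUP[symmetric]) auto
  finally show ?case by (simp add: image_comp)
qed

lemma integrable_msum:
  fixes f :: "real \<Rightarrow> real"
  assumes M: "\<And>i. i < r \<Longrightarrow> sets (M i) = sets borel"
    and f: "f \<in> borel_measurable borel" "\<And>i. i < r \<Longrightarrow> integrable (M i) f"
  shows "integrable (msum r M) f"
proof (rule integrableI_bounded)
  have "(\<integral>\<^sup>+x. norm (f x) \<partial>msum r M) = (\<Sum>i<r. \<integral>\<^sup>+x. norm (f x) \<partial>M i)"
    by (rule nn_integral_msum) (use M f in auto)
  also have "\<dots> < \<infinity>" using f(2) by (auto simp: integrable_iff_bounded)
  finally show "(\<integral>\<^sup>+x. norm (f x) \<partial>msum r M) < \<infinity>" .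
qed (use f in auto)

lemma integral_msum:
  fixes f :: "real \<Rightarrow> real"
  assumes M: "\<And>i. i < r \<Longrightarrow> sets (M i) = sets borel"
    and f: "f \<in> borel_measurable borel" "\<And>i. i < r \<Longrightarrow> integrable (M i) f"
  shows "(\<integral>x. f x \<partial>msum r M) = (\<Sum>i<r. \<integral>x. f x \<partial>M i)"
proof -
  have a: "enn2real (\<Sum>i<r. h i) = (\<Sum>i<r. enn2real (h i))" if "\<And>i. i < r \<Longrightarrow> h i \<noteq> \<infinity>" for h :: "nat \<Rightarrow> ennreal"
    using that by (subst enn2real_sum) (auto simp: top.not_eq_extremum)
  have b: "(\<integral>\<^sup>+x. ennreal (f x) \<partial>M i) \<noteq> \<infinity>" "(\<integral>\<^sup>+x. ennreal (- f x) \<partial>M i) \<noteq> \<infinity>" if "i < r" for i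
    using f(2)[OF that] by (auto simp: real_integrable_def)
  have "(\<integral>x. f x \<partial>msum r M) = enn2real (\<integral>\<^sup>+x. ennreal (f x) \<partial>msum r M) - enn2real (\<integral>\<^sup>+x. ennreal (- f x) \<partial>msum r M)"
    by (rule real_lebesgue_integral_def[OF integrable_msum[OF M f]])
  also have "\<dots> = enn2real (\<Sum>i<r. \<integral>\<^sup>+x. ennreal (f x) \<partial>M i) - enn2real (\<Sum>i<r. \<integral>\<^sup>+x. ennreal (- f x) \<partial>M i)"
    using M f(1) by (simp add: nn_integral_msum)
  also have "\<dots> = (\<Sum>i<r. \<integral>x. f x \<partial>M i)"
    using f(2) by (subst (1 2) a) (auto simp: b[unfolded infinity_ennreal_def] real_lebesgue_integral_def sum_subtractf)
  finally show ?thesis .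
qed

lemma fin_borel_msum:
  assumes "\<And>i. i < r \<Longrightarrow> fin_borel (M i)"
  shows "fin_borel (msum r M)"
  unfolding fin_borel_def
proof
  have "emeasure (msum r M) UNIV = (\<Sum>i<r. emeasure (M i) UNIV)"
    using assms by (intro emeasure_msum) (auto dest: fin_borelD)
  also have "\<dots> < \<infinity>" using assms fin_borelD(5) by (auto simp: less_top)
  finally show "finite_measure (msum r M)" by (intro finite_measureI) auto
qed simp

lemma AE_msum:
  assumes "\<And>i. i < r \<Longrightarrow> sets (M i) = sets borel" "Measurable.pred borel P"
    and "\<And>i. i < r \<Longrightarrow> AE x in M i. P x"
  shows "AE x in msum r M. P x"
proof -
  have "emeasure (msum r M) {x. \<not> P x} = (\<Sum>i<r. emeasure (M i) {x. \<not> P x})"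
    using assms by (intro emeasure_msum) auto
  also have "\<dots> = 0"
  proof (intro sum.neutral ballI)
    fix i assume "i \<in> {..<r}"
    then have "AE x in M i. P x" "sets (M i) = sets borel" using assms by auto
    moreover have "space (M i) = UNIV" using sets_eq_imp_space_eq[OF calculation(2)] by simp
    ultimately show "emeasure (M i) {x. \<not> P x} = 0"
      using assms(2) by (subst (asm) AE_iff_measurable[OF _ refl]) auto
  qed
  finally show ?thesis using assms(2) by (subst AE_iff_measurable[OF _ refl]) auto
qed

text \<open>Two uses: atoms with varying weights, which encode point configurations, and the weights
  1/2, which give midpoints. Negative weights would be clipped to 0 by
  \<open>ennreal\<close>.\<close>

definition wsum :: "nat \<Rightarrow> (nat \<Rightarrow> real) \<Rightarrow> (nat \<Rightarrow> real measure) \<Rightarrow> real measure" where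
  "wsum n w M = msum n (\<lambda>i. density (M i) (\<lambda>_. ennreal (w i)))"

lemma sets_wsum [simp]: "sets (wsum n w M) = sets borel"
  by (simp add: wsum_def)

lemma space_wsum [simp]: "space (wsum n w M) = UNIV"
  by (simp add: wsum_def)

lemma fin_borel_density_const:
  assumes "fin_borel M"
  shows "fin_borel (density M (\<lambda>_. ennreal c))"
proof -
  have "emeasure (density M (\<lambda>_. ennreal c)) UNIV = ennreal c * emeasure M UNIV"
    using fin_borelD[OF assms] by (subst emeasure_density) (auto simp: nn_integral_cmult)
  also have "\<dots> < \<infinity>" using fin_borelD(5)[OF assms] by (simp add: ennreal_mult_less_top less_top)
  finally show ?thesis using fin_borelD[OF assms] unfolding fin_borel_def by (auto intro!: finite_measureI)
qed

lemma fin_borel_wsum: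
  assumes "\<And>i. i < n \<Longrightarrow> fin_borel (M i)"
  shows "fin_borel (wsum n w M)"
  unfolding wsum_def by (intro fin_borel_msum fin_borel_density_const assms)

lemma emeasure_wsum:
  assumes "\<And>i. i < n \<Longrightarrow> fin_borel (M i)" "A \<in> sets borel"
  shows "emeasure (wsum n w M) A = (\<Sum>i<n. ennreal (w i) * emeasure (M i) A)"
proof -
  have "emeasure (wsum n w M) A = (\<Sum>i<n. emeasure (density (M i) (\<lambda>_. ennreal (w i))) A)"
    unfolding wsum_def using assms by (intro emeasure_msum) (auto simp: fin_borelD)
  also have "\<dots> = (\<Sum>i<n. ennreal (w i) * emeasure (M i) A)"
    using assms fin_borelD(1) by (intro sum.cong refl) (simp add: emeasure_density_const)
  finally show ?thesis .
qed

lemma integral_wsum: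
  assumes M: "\<And>i. i < n \<Longrightarrow> fin_borel (M i)" and w: "\<And>i. i < n \<Longrightarrow> 0 \<le> w i" and f: "bdd_borel f"
  shows "(\<integral>x. f x \<partial>wsum n w M) = (\<Sum>i<n. w i * (\<integral>x. f x \<partial>M i))"
proof -
  have "(\<integral>x. f x \<partial>wsum n w M) = (\<Sum>i<n. \<integral>x. f x \<partial>density (M i) (\<lambda>_. ennreal (w i)))"
    unfolding wsum_def
    using integrable_bdd_borel[OF fin_borel_density_const[OF M] f] M f
    by (intro integral_msum) (auto simp: fin_borelD bdd_borel_meas)
  also have "\<dots> = (\<Sum>i<n. w i * (\<integral>x. f x \<partial>M i))"
  proof (intro sum.cong refl)
    fix i assume "i \<in> {..<n}"
    moreover have "f \<in> borel_measurable (M i)"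
      using integrable_bdd_borel[OF M f] calculation by auto
    ultimately show "(\<integral>x. f x \<partial>density (M i) (\<lambda>_. ennreal (w i))) = w i * (\<integral>x. f x \<partial>M i)"
      using w by (subst integral_density) auto
  qed
  finally show ?thesis .
qed

subsection \<open>Bilinear forms of difference kernels\<close>

definition kernel_form :: "(real \<Rightarrow> real) \<Rightarrow> real measure \<Rightarrow> real measure \<Rightarrow> real" where
  "kernel_form k M N = (\<integral>x. (\<integral>y. k (x - y) \<partial>N) \<partial>M)"

lemma bdd_borel_comp:
  assumes "bdd_borel k" "\<phi> \<in> borel_measurable borel"
  shows "bdd_borel (\<lambda>y. k (\<phi> y))"
proof -
  obtain B where "\<And>x. \<bar>k x\<bar> \<le> B" using bdd_borelE[OF assms(1)] by blast
  then show ?thesis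
    using measurable_compose[OF assms(2) bdd_borel_meas[OF assms(1)]] by (intro bdd_borelI) auto
qed

lemma bdd_borel_shift: "bdd_borel k \<Longrightarrow> bdd_borel (\<lambda>y. k (x - y))"
  by (rule bdd_borel_comp) auto

lemma bdd_borel_inner:
  assumes k: "bdd_borel k" and N: "fin_borel N" and \<phi>: "\<phi> \<in> borel_measurable borel" "\<psi> \<in> borel_measurable borel"
  shows "bdd_borel (\<lambda>x. \<integral>y. k (\<phi> x - \<psi> y) \<partial>N)"
proof -
  obtain B where B: "B > 0" "\<And>x. \<bar>k x\<bar> \<le> B" using bdd_borelE[OF k] by blast
  interpret N: sigma_finite_measure N using N by (rule fin_borelD)
  have [measurable]: "k \<in> borel_measurable borel" "\<phi> \<in> borel_measurable borel" "\<psi> \<in> borel_measurable borel"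
    using k \<phi> by (auto simp: bdd_borel_meas)
  have [measurable_cong]: "sets N = sets borel" using N by (rule fin_borelD)
  show ?thesis
  proof (rule bdd_borelI)
    show "(\<lambda>x. \<integral>y. k (\<phi> x - \<psi> y) \<partial>N) \<in> borel_measurable borel" by measurable
    fix x
    have i: "integrable N (\<lambda>y. k (\<phi> x - \<psi> y))"
      by (rule integrable_fin_borel[OF N _ B(2)]) measurable
    have "\<bar>\<integral>y. k (\<phi> x - \<psi> y) \<partial>N\<bar> \<le> (\<integral>y. \<bar>k (\<phi> x - \<psi> y)\<bar> \<partial>N)" by (rule integral_abs_bound)
    also have "\<dots> \<le> (\<integral>y. B \<partial>N)"
      using i B by (intro integral_mono integrable_abs finite_measure.integrable_const fin_borelD(3)[OF N])
    finally show "\<bar>\<integral>y. k (\<phi> x - \<psi> y) \<partial>N\<bar> \<le> (\<integral>y. B \<partial>N)" .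
  qed
qed

lemma bdd_borel_inner': "bdd_borel k \<Longrightarrow> fin_borel N \<Longrightarrow> bdd_borel (\<lambda>x. \<integral>y. k (x - y) \<partial>N)"
  using bdd_borel_inner[of k N "\<lambda>x. x" "\<lambda>x. x"] by simp

lemma kernel_form_pair:
  assumes k: "bdd_borel k" and M: "fin_borel M" and N: "fin_borel N"
  shows "integrable (M \<Otimes>\<^sub>M N) (\<lambda>z. k (fst z - snd z))"
    and "kernel_form k M N = (\<integral>z. k (fst z - snd z) \<partial>(M \<Otimes>\<^sub>M N))"
    and "kernel_form k M N = (\<integral>y. (\<integral>x. k (x - y) \<partial>M) \<partial>N)"
proof -
  obtain B where B: "B > 0" "\<And>x. \<bar>k x\<bar> \<le> B" using bdd_borelE[OF k] by blast
  interpret M: finite_measure M using M by (rule fin_borelD)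
  interpret N: finite_measure N using N by (rule fin_borelD)
  interpret pair_sigma_finite M N by unfold_locales
  interpret P: finite_measure "M \<Otimes>\<^sub>M N" by (rule finite_measure_pair_measure[OF N.finite_measure_axioms M.finite_measure_axioms])
  have [measurable]: "k \<in> borel_measurable borel" using k by (auto simp: bdd_borel_meas)
  have [measurable_cong]: "sets N = sets borel" "sets M = sets borel" using N M by (auto dest: fin_borelD)
  show i: "integrable (M \<Otimes>\<^sub>M N) (\<lambda>z. k (fst z - snd z))"
    by (rule P.integrable_const_bound[where B=B]) (use B in auto)
  then have i': "integrable (M \<Otimes>\<^sub>M N) (\<lambda>(x, y). k (x - y))" by (simp only: case_prod_unfold)
  show "kernel_form k M N = (\<integral>z. k (fst z - snd z) \<partial>(M \<Otimes>\<^sub>M N))"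
    using integral_fst'[OF i] by (simp add: kernel_form_def)
  show "kernel_form k M N = (\<integral>y. (\<integral>x. k (x - y) \<partial>M) \<partial>N)"
    using Fubini_integral[OF i'] by (simp add: kernel_form_def)
qed

lemma kernel_form_commute:
  assumes k: "bdd_borel k" and M: "fin_borel M" and N: "fin_borel N" and e: "\<And>x. k (- x) = k x"
  shows "kernel_form k M N = kernel_form k N M"
proof -
  have "k (x - y) = k (y - x)" for x y using e[of "x - y"] by simp
  then show ?thesis using kernel_form_pair(3)[OF k M N] by (simp add: kernel_form_def)
qed

lemma kernel_form_msum_left:
  assumes k: "bdd_borel k" and M: "\<And>i. i < r \<Longrightarrow> fin_borel (M i)" and N: "fin_borel N"
  shows "kernel_form k (msum r M) N = (\<Sum>i<r. kernel_form k (M i) N)"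
  unfolding kernel_form_def using M
  by (intro integral_msum integrable_bdd_borel bdd_borel_inner' k N bdd_borel_meas) (auto dest: fin_borelD)

lemma kernel_form_msum_right:
  assumes k: "bdd_borel k" and M: "fin_borel M" and N: "\<And>i. i < r \<Longrightarrow> fin_borel (N i)"
  shows "kernel_form k M (msum r N) = (\<Sum>i<r. kernel_form k M (N i))"
proof -
  have "(\<integral>y. k (x - y) \<partial>msum r N) = (\<Sum>i<r. \<integral>y. k (x - y) \<partial>N i)" for x
    using N by (intro integral_msum integrable_bdd_borel bdd_borel_shift k bdd_borel_meas) (auto dest: fin_borelD)
  then show ?thesis unfolding kernel_form_def
    using N by (simp add: Bochner_Integration.integral_sum integrable_bdd_borel[OF M bdd_borel_inner'[OF k]])
qed

lemma kernel_form_wsum_left: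
  assumes k: "bdd_borel k" and M: "\<And>i. i < r \<Longrightarrow> fin_borel (M i)" and N: "fin_borel N"
    and w: "\<And>i. i < r \<Longrightarrow> 0 \<le> w i"
  shows "kernel_form k (wsum r w M) N = (\<Sum>i<r. w i * kernel_form k (M i) N)"
  unfolding kernel_form_def using M w by (intro integral_wsum bdd_borel_inner' k N)

lemma kernel_form_wsum_right:
  assumes k: "bdd_borel k" and M: "fin_borel M" and N: "\<And>i. i < r \<Longrightarrow> fin_borel (N i)"
    and w: "\<And>i. i < r \<Longrightarrow> 0 \<le> w i"
  shows "kernel_form k M (wsum r w N) = (\<Sum>i<r. w i * kernel_form k M (N i))"
proof -
  have "(\<integral>y. k (x - y) \<partial>wsum r w N) = (\<Sum>i<r. w i * (\<integral>y. k (x - y) \<partial>N i))" for x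
    using N w by (intro integral_wsum bdd_borel_shift k) 
  then show ?thesis unfolding kernel_form_def
    using N by (simp add: Bochner_Integration.integral_sum integrable_bdd_borel[OF M bdd_borel_inner'[OF k]])
qed

definition mass :: "real measure \<Rightarrow> real" where "mass M = measure M UNIV"

lemma mass_nonneg: "0 \<le> mass M" by (simp add: mass_def)

lemma integral_const_mass: "fin_borel M \<Longrightarrow> (\<integral>x. c \<partial>M) = c * mass M" for c :: real
  using fin_borelD(2)[of M] by (simp add: mass_def)

lemma kernel_form_const: "fin_borel M \<Longrightarrow> fin_borel N \<Longrightarrow> kernel_form (\<lambda>_. c) M N = c * mass M * mass N"
  unfolding kernel_form_def by (simp only: integral_const_mass) (simp add: mult_ac)

lemma bdd_borel_const: "bdd_borel (\<lambda>_. c)"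
  by (rule bdd_borelI[where B="\<bar>c\<bar>"]) auto

lemma bdd_borel_add: "bdd_borel f \<Longrightarrow> bdd_borel g \<Longrightarrow> bdd_borel (\<lambda>x. f x + g x)"
proof -
  assume a: "bdd_borel f" "bdd_borel g"
  then obtain B C where "\<And>x. \<bar>f x\<bar> \<le> B" "\<And>x. \<bar>g x\<bar> \<le> C" by (metis bdd_borelE)
  then have "\<bar>f x + g x\<bar> \<le> B + C" for x by (meson abs_triangle_ineq add_mono order_trans)
  with a show ?thesis by (intro bdd_borelI borel_measurable_add) (auto dest: bdd_borel_meas)
qed

lemma kernel_form_add:
  assumes "bdd_borel k" "bdd_borel l" "fin_borel M" "fin_borel N"
  shows "kernel_form (\<lambda>x. k x + l x) M N = kernel_form k M N + kernel_form l M N"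
  using kernel_form_pair(1,2)[OF _ assms(3,4)] assms bdd_borel_add[of k l] by simp

text \<open>The left side is the form that \<open>kernel_form_distr\<close> gives to the energy of
  image measures under \<open>\<phi>\<close>. The energy after a deformation is thus bounded by
  comparing kernels pointwise, and only on sets that carry the measures.\<close>

lemma kernel_form_mono_map:
  assumes k: "bdd_borel k" and l: "bdd_borel l" and M: "fin_borel M" and N: "fin_borel N"
    and \<phi>: "\<phi> \<in> borel_measurable borel"
    and S: "AE x in M. x \<in> S" "AE y in N. y \<in> S'"
    and le: "\<And>x y. x \<in> S \<Longrightarrow> y \<in> S' \<Longrightarrow> k (\<phi> x - \<phi> y) \<le> l (x - y)"
  shows "(\<integral>x. (\<integral>y. k (\<phi> x - \<phi> y) \<partial>N) \<partial>M) \<le> kernel_form l M N"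
  unfolding kernel_form_def
proof (rule integral_mono_AE)
  have km: "k \<in> borel_measurable borel" using k by (rule bdd_borel_meas)
  show "integrable M (\<lambda>x. \<integral>y. k (\<phi> x - \<phi> y) \<partial>N)"
    by (intro integrable_bdd_borel M bdd_borel_inner k N \<phi>)
  show "integrable M (\<lambda>x. \<integral>y. l (x - y) \<partial>N)"
    by (intro integrable_bdd_borel M bdd_borel_inner' l N)
  show "AE x in M. (\<integral>y. k (\<phi> x - \<phi> y) \<partial>N) \<le> (\<integral>y. l (x - y) \<partial>N)"
    using S(1)
  proof eventually_elim
    case (elim x)
    obtain B where B: "\<And>x. \<bar>k x\<bar> \<le> B" using bdd_borelE[OF k] by blast
    have "integrable N (\<lambda>y. k (\<phi> x - \<phi> y))"
      by (rule integrable_fin_borel[OF N _ B]) (use km \<phi> in measurable)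
    then show ?case
      using S(2) le[OF elim] integrable_bdd_borel[OF N bdd_borel_shift[OF l]]
      by (intro integral_mono_AE) auto
  qed
qed

text \<open>For an even kernel this is the quadratic form of \<open>k\<close> at the signed measure
  \<open>M - N\<close>, written without signed measures.\<close>

definition kernel_dist :: "(real \<Rightarrow> real) \<Rightarrow> real measure \<Rightarrow> real measure \<Rightarrow> real" where
  "kernel_dist k M N = kernel_form k M M + kernel_form k N N - 2 * kernel_form k M N"

subsection \<open>Triangle kernels\<close>

text \<open>Up to the factor \<open>s\<close>, the length of the overlap of two intervals of length
  \<open>s\<close> whose positions differ by \<open>x\<close>. As the autocorrelation of an
  indicator function it is positive definite.\<close>

definition triangle :: "real \<Rightarrow> real \<Rightarrow> real" where "triangle s x = max 0 (1 - \<bar>x\<bar> / s)"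

lemma triangle_bounds: "s > 0 \<Longrightarrow> 0 \<le> triangle s x" "s > 0 \<Longrightarrow> triangle s x \<le> 1"
  by (auto simp: triangle_def)

lemma triangle_measurable [measurable]: "(\<lambda>z. triangle (f z) (g z)) \<in> borel_measurable M"
  if [measurable]: "f \<in> borel_measurable M" "g \<in> borel_measurable M"
  unfolding triangle_def by measurable

lemma bdd_borel_triangle: "s > 0 \<Longrightarrow> bdd_borel (triangle s)"
  by (rule bdd_borelI[where B=1]) (auto simp: triangle_def)

text \<open>The window \<open>{u<..u + s}\<close> contains both points exactly when \<open>u\<close>
  lies in \<open>{max x y - s..<min x y}\<close>.\<close>

lemma triangle_eq_nn_integral:
  assumes "s > 0"
  shows "(\<integral>\<^sup>+u. indicator {u<..u + s} x * indicator {u<..u + s} y \<partial>lborel) = ennreal (s * triangle s (x - y))"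
proof -
  have "(\<integral>\<^sup>+u. indicator {u<..u + s} x * indicator {u<..u + s} y \<partial>lborel)
      = (\<integral>\<^sup>+u. indicator {max x y - s..<min x y} u \<partial>lborel)"
    by (intro nn_integral_cong) (auto simp: indicator_def)
  also have "\<dots> = ennreal (max 0 (min x y - (max x y - s)))"
  proof -
    have "emeasure lborel {l..<v} = ennreal (max 0 (v - l))" for l v :: real
      by (cases "l \<le> v") simp_all
    then show ?thesis by simp
  qed
  also have "max 0 (min x y - (max x y - s)) = s * triangle s (x - y)"
    using assms by (auto simp: triangle_def max_def min_def abs_if right_diff_distrib field_simps)
  finally show ?thesis .
qed

text \<open>Fubini for the window representation of the kernel. The product form of the integrand is
  what turns \<open>kernel_dist\<close> into the integral of a square.\<close>

lemma kernel_form_triangle: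
  assumes s: "s > 0" and M: "fin_borel M" and N: "fin_borel N"
  shows "integrable lborel (\<lambda>u. measure M {u<..u + s} * measure N {u<..u + s})"
    and "kernel_form (triangle s) M N = (\<integral>u. measure M {u<..u + s} * measure N {u<..u + s} \<partial>lborel) / s"
proof -
  interpret M: finite_measure M using M by (rule fin_borelD)
  interpret N: finite_measure N using N by (rule fin_borelD)
  interpret MN: finite_measure "M \<Otimes>\<^sub>M N" by (rule finite_measure_pair_measure[OF N.finite_measure_axioms M.finite_measure_axioms])
  interpret pair_sigma_finite "M \<Otimes>\<^sub>M N" "lborel :: real measure" by unfold_locales
  have [measurable_cong]: "sets N = sets borel" "sets M = sets borel" using N M by (auto dest: fin_borelD)
  have [simp]: "space M = UNIV" "space N = UNIV" using M N by (auto dest: fin_borelD)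
  let ?f = "\<lambda>z u. indicator {u<..u + s} (fst z) * indicator {u<..u + s} (snd z) :: ennreal"
  let ?m = "\<lambda>u. measure M {u<..u + s} * measure N {u<..u + s}"
  have f: "(\<lambda>(z, u). ?f z u) \<in> borel_measurable ((M \<Otimes>\<^sub>M N) \<Otimes>\<^sub>M lborel)"
    unfolding indicator_def greaterThanAtMost_iff by measurable
  have inner: "(\<integral>\<^sup>+z. ?f z u \<partial>(M \<Otimes>\<^sub>M N)) = ennreal (?m u)" for u
  proof -
    have "(\<integral>\<^sup>+z. ?f z u \<partial>(M \<Otimes>\<^sub>M N)) = (\<integral>\<^sup>+z. indicator ({u<..u + s} \<times> {u<..u + s}) z \<partial>(M \<Otimes>\<^sub>M N))"
      by (intro nn_integral_cong) (auto simp: indicator_def)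
    also have "\<dots> = emeasure M {u<..u + s} * emeasure N {u<..u + s}"
      by (simp add: N.emeasure_pair_measure_Times)
    finally show ?thesis by (simp add: M.emeasure_eq_measure N.emeasure_eq_measure ennreal_mult)
  qed
  have eq: "(\<integral>\<^sup>+z. ennreal (s * triangle s (fst z - snd z)) \<partial>(M \<Otimes>\<^sub>M N)) = (\<integral>\<^sup>+u. ennreal (?m u) \<partial>lborel)"
    using Fubini'[OF f] s by (simp add: inner triangle_eq_nn_integral)
  have ip: "integrable (M \<Otimes>\<^sub>M N) (\<lambda>z. s * triangle s (fst z - snd z))"
    using kernel_form_pair(1)[OF bdd_borel_triangle[OF s] M N] by simp
  have "(\<integral>\<^sup>+z. ennreal (s * triangle s (fst z - snd z)) \<partial>(M \<Otimes>\<^sub>M N)) = ennreal (\<integral>z. s * triangle s (fst z - snd z) \<partial>(M \<Otimes>\<^sub>M N))"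
    using s triangle_bounds by (intro nn_integral_eq_integral ip) auto
  then have nn: "(\<integral>\<^sup>+u. ennreal (?m u) \<partial>lborel) = ennreal (s * kernel_form (triangle s) M N)"
    using kernel_form_pair(2)[OF bdd_borel_triangle[OF s] M N] eq by simp
  \<comment> \<open>Measurability of the window masses in \<open>u\<close> is inherited from the
    iterated integral.\<close>
  have meas: "?m \<in> borel_measurable lborel"
  proof -
    have f': "(\<lambda>(u, z). ?f z u) \<in> borel_measurable (lborel \<Otimes>\<^sub>M (M \<Otimes>\<^sub>M N))"
      unfolding indicator_def greaterThanAtMost_iff by measurable
    have "(\<lambda>u. \<integral>\<^sup>+z. ?f z u \<partial>(M \<Otimes>\<^sub>M N)) \<in> borel_measurable lborel"
      by (rule MN.borel_measurable_nn_integral[OF f'])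
    then have "(\<lambda>u. enn2real (ennreal (?m u))) \<in> borel_measurable lborel" unfolding inner by measurable
    then show ?thesis by simp
  qed
  show int: "integrable lborel ?m"
    using nn meas by (intro integrableI_nonneg) auto
  have "ennreal (\<integral>u. ?m u \<partial>lborel) = ennreal (s * kernel_form (triangle s) M N)"
    using nn nn_integral_eq_integral[OF int] by simp
  moreover have "0 \<le> kernel_form (triangle s) M N" unfolding kernel_form_def using s triangle_bounds by (intro integral_nonneg_AE) auto
  moreover have "0 \<le> (\<integral>u. ?m u \<partial>lborel)" by (intro integral_nonneg_AE) auto
  ultimately have "(\<integral>u. ?m u \<partial>lborel) = s * kernel_form (triangle s) M N" using s by simp
  then show "kernel_form (triangle s) M N = (\<integral>u. ?m u \<partial>lborel) / s" using s by (simp add: field_simps)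
qed

lemma kernel_dist_triangle:
  assumes s: "s > 0" and M: "fin_borel M" and N: "fin_borel N"
  shows "integrable lborel (\<lambda>u. (measure M {u<..u + s} - measure N {u<..u + s})\<^sup>2)"
    and "kernel_dist (triangle s) M N = (\<integral>u. (measure M {u<..u + s} - measure N {u<..u + s})\<^sup>2 \<partial>lborel) / s"
proof -
  have e: "(a - b)\<^sup>2 = a * a + b * b - 2 * (a * b)" for a b :: real by (simp add: power2_eq_square algebra_simps)
  note i = kernel_form_triangle(1)[OF s]
  show "integrable lborel (\<lambda>u. (measure M {u<..u + s} - measure N {u<..u + s})\<^sup>2)"
    unfolding e using i[OF M M] i[OF N N] i[OF M N] by (intro Bochner_Integration.integrable_diff
      Bochner_Integration.integrable_add integrable_mult_right)
  show "kernel_dist (triangle s) M N = (\<integral>u. (measure M {u<..u + s} - measure N {u<..u + s})\<^sup>2 \<partial>lborel) / s"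
    unfolding e kernel_dist_def kernel_form_triangle(2)[OF s M M] kernel_form_triangle(2)[OF s N N] kernel_form_triangle(2)[OF s M N]
    using i[OF M M] i[OF N N] i[OF M N] by (simp add: diff_divide_distrib add_divide_distrib)
qed

lemma kernel_dist_triangle_nonneg: "s > 0 \<Longrightarrow> fin_borel M \<Longrightarrow> fin_borel N \<Longrightarrow> 0 \<le> kernel_dist (triangle s) M N"
  by (simp add: kernel_dist_triangle(2))

subsection \<open>The truncated logarithmic kernel\<close>

text \<open>Tangent to \<open>- ln\<close> at \<open>d\<close>, equal to it up to \<open>L\<close>,
  constant beyond. It is applied with \<open>L\<close> above the diameter of the hull of the
  intervals, where the cap changes nothing; the cap keeps the kernel bounded and the range of widths
  in the mixture finite.\<close>

definition trunc_log :: "real \<Rightarrow> real \<Rightarrow> real \<Rightarrow> real" where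
  "trunc_log d L x = (if \<bar>x\<bar> < d then 1 - ln d - \<bar>x\<bar> / d else - ln (min \<bar>x\<bar> L))"

lemma one_minus_le_neg_ln: "u > 0 \<Longrightarrow> 1 - u \<le> - ln u" for u :: real
  using ln_le_minus_one[of u] by simp

lemma trunc_log_minus [simp]: "trunc_log d L (- x) = trunc_log d L x"
  by (simp add: trunc_log_def)

lemma trunc_log_le_ln:
  assumes "0 < d" "\<bar>x\<bar> \<le> L" "x \<noteq> 0"
  shows "trunc_log d L x \<le> - ln \<bar>x\<bar>"
  using assms one_minus_le_neg_ln[of "\<bar>x\<bar> / d"] by (auto simp: trunc_log_def ln_div)

lemma trunc_log_eq_ln: "d \<le> \<bar>x\<bar> \<Longrightarrow> \<bar>x\<bar> \<le> L \<Longrightarrow> trunc_log d L x = - ln \<bar>x\<bar>"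
  by (simp add: trunc_log_def)

lemma trunc_log_antimono:
  assumes d: "0 < d" "d \<le> L" and le: "\<bar>x\<bar> \<le> \<bar>y\<bar>"
  shows "trunc_log d L y \<le> trunc_log d L x"
proof -
  consider "\<bar>y\<bar> < d" | "\<bar>x\<bar> < d" "d \<le> \<bar>y\<bar>" | "d \<le> \<bar>x\<bar>" "d \<le> \<bar>y\<bar>" using le by linarith
  then show ?thesis
  proof cases
    case 1 then show ?thesis using d le by (simp add: trunc_log_def divide_right_mono)
  next
    case 2
    have "ln d \<le> ln (min \<bar>y\<bar> L)" using 2 d by (intro ln_mono) auto
    moreover have "0 \<le> 1 - \<bar>x\<bar> / d" using 2 d by simp
    moreover have "trunc_log d L x = 1 - ln d - \<bar>x\<bar> / d" "trunc_log d L y = - ln (min \<bar>y\<bar> L)" using 2 by (auto simp: trunc_log_def)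
    ultimately show ?thesis by linarith
  next
    case 3
    have "ln (min \<bar>x\<bar> L) \<le> ln (min \<bar>y\<bar> L)" using 3 d le by (intro ln_mono) auto
    then show ?thesis using 3 by (simp add: trunc_log_def)
  qed
qed

text \<open>As for \<open>- ln\<close> itself, contracting a distance by \<open>q\<close> raises the
  kernel by at most \<open>- ln q\<close>. On the linear part the increase is at most
  \<open>1 - q\<close>, which is below \<open>- ln q\<close>; when only the contracted point is
  below \<open>d\<close>, the tangent lies below the curve.\<close>

lemma trunc_log_scale:
  assumes d: "0 < d" "d \<le> L" and q: "0 < q" "q \<le> 1" and le: "q * \<bar>x\<bar> \<le> \<bar>y\<bar>"
  shows "trunc_log d L y \<le> trunc_log d L x - ln q"
proof -
  have "trunc_log d L y \<le> trunc_log d L (q * x)" using d q le by (intro trunc_log_antimono) (auto simp: abs_mult)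
  also have "\<dots> \<le> trunc_log d L x - ln q"
  proof -
    have qx: "\<bar>q * x\<bar> = q * \<bar>x\<bar>" "q * \<bar>x\<bar> \<le> \<bar>x\<bar>" using q by (auto simp: abs_mult mult_left_le_one_le)
    consider "\<bar>x\<bar> < d" | "q * \<bar>x\<bar> < d" "d \<le> \<bar>x\<bar>" | "d \<le> q * \<bar>x\<bar>" "d \<le> \<bar>x\<bar>" using qx by linarith
    then show ?thesis
    proof cases
      case 1
      have "(1 - q) * (\<bar>x\<bar> / d) \<le> (1 - q) * 1" using 1 d q by (intro mult_left_mono) auto
      also have "\<dots> \<le> - ln q" using one_minus_le_neg_ln[of q] q by simp
      finally show ?thesis using 1 qx d by (simp add: trunc_log_def algebra_simps diff_divide_distrib)
    next
      case 2
      have "x \<noteq> 0" using 2 d by auto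
      then have "1 - q * \<bar>x\<bar> / d \<le> - ln (q * \<bar>x\<bar> / d)" using d q by (intro one_minus_le_neg_ln) auto
      also have "\<dots> = - ln q - ln \<bar>x\<bar> + ln d" using \<open>x \<noteq> 0\<close> d q by (simp add: ln_div ln_mult)
      finally have *: "1 - q * \<bar>x\<bar> / d \<le> - ln q - ln \<bar>x\<bar> + ln d" .
      have "ln (min \<bar>x\<bar> L) \<le> ln \<bar>x\<bar>" using 2 d by (intro ln_mono) auto
      with * show ?thesis using 2 qx by (simp add: trunc_log_def)
    next
      case 3
      have "q * min \<bar>x\<bar> L \<le> min (q * \<bar>x\<bar>) L"
        using q d 3 by (auto simp: min_def mult_left_le_one_le intro: order_trans[OF mult_left_le_one_le])
      moreover have "0 < min \<bar>x\<bar> L" using d 3 by auto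
      ultimately have "ln (q * min \<bar>x\<bar> L) \<le> ln (min (q * \<bar>x\<bar>) L)" using q by (intro ln_mono) auto
      moreover have "ln (q * min \<bar>x\<bar> L) = ln q + ln (min \<bar>x\<bar> L)" using q \<open>0 < min \<bar>x\<bar> L\<close> by (intro ln_mult_pos)
      moreover have "trunc_log d L x = - ln (min \<bar>x\<bar> L)" "trunc_log d L (q * x) = - ln (min (q * \<bar>x\<bar>) L)"
        using 3 qx by (auto simp: trunc_log_def)
      ultimately show ?thesis by linarith
    qed
  qed
  finally show ?thesis .
qed

lemma trunc_log_bounds:
  assumes d: "0 < d" "d \<le> L"
  shows "- ln L \<le> trunc_log d L x" "trunc_log d L x \<le> 1 - ln d"
proof -
  show "trunc_log d L x \<le> 1 - ln d"
    using trunc_log_antimono[OF d, of 0 x] d by (simp add: trunc_log_def)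
  have "trunc_log d L (max \<bar>x\<bar> L) \<le> trunc_log d L x" by (rule trunc_log_antimono[OF d]) auto
  then show "- ln L \<le> trunc_log d L x" using d by (simp add: trunc_log_def abs_if max_def split: if_splits)
qed

lemma trunc_log_measurable [measurable]: "trunc_log d L \<in> borel_measurable borel"
  unfolding trunc_log_def[abs_def] by measurable

lemma bdd_borel_trunc_log:
  assumes "0 < d" "d \<le> L" shows "bdd_borel (trunc_log d L)"
  by (rule bdd_borelI[where B="\<bar>ln L\<bar> + \<bar>1 - ln d\<bar>"]) (use trunc_log_bounds[OF assms] in \<open>auto simp: abs_le_iff, (smt (verit))+\<close>)

text \<open>An even function that is convex and decreasing in \<open>\<bar>x\<bar>\<close> is, up to
  a constant, a mixture of triangles with density \<open>s\<close> times its second derivative. For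
  \<open>- ln\<close> on \<open>{d..L}\<close> this density is \<open>1 / s\<close>. The linear part
  below \<open>d\<close> contributes nothing, and the jump of the slope from \<open>- 1 / L\<close>
  to 0 at the cap produces the separate term \<open>triangle L\<close>.\<close>

lemma trunc_log_eq_triangle_integral:
  assumes d: "0 < d" "d \<le> L"
  shows "trunc_log d L x = - ln L + triangle L x + (\<integral>s. indicator {d..L} s * (triangle s x / s) \<partial>lborel)"
proof (cases "\<bar>x\<bar> < L")
  case False
  have "(\<lambda>s. indicator {d..L} s * (triangle s x / s)) = (\<lambda>s. 0)"
    using False d by (auto simp: fun_eq_iff indicator_def triangle_def field_simps max_def)
  moreover have "triangle L x = 0" using False d by (auto simp: triangle_def field_simps max_def)
  ultimately show ?thesis using False d by (simp add: trunc_log_def)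
next
  case True
  \<comment> \<open>Only the triangles with \<open>s > \<bar>x\<bar>\<close> are nonzero at
    \<open>x\<close>, so the integral effectively starts here.\<close>
  define a where "a = max d \<bar>x\<bar>"
  have a: "0 < a" "a \<le> L" using True d by (auto simp: a_def)
  have "(\<lambda>s. indicator {d..L} s * (triangle s x / s)) = (\<lambda>s. (1 / s - \<bar>x\<bar> / s\<^sup>2) * indicator {a..L} s)"
    using d by (auto simp: fun_eq_iff indicator_def triangle_def a_def field_simps max_def power2_eq_square)
  moreover have "(\<integral>s. (1 / s - \<bar>x\<bar> / s\<^sup>2) * indicator {a..L} s \<partial>lborel) = (ln L + \<bar>x\<bar> / L) - (ln a + \<bar>x\<bar> / a)"
  proof (rule integral_FTC_Icc_real)
    fix s assume "a \<le> s" "s \<le> L"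
    then have "s > 0" using a by auto
    then show "DERIV (\<lambda>s. ln s + \<bar>x\<bar> / s) s :> 1 / s - \<bar>x\<bar> / s\<^sup>2"
      by (auto intro!: derivative_eq_intros simp: power2_eq_square field_simps)
    show "isCont (\<lambda>s. 1 / s - \<bar>x\<bar> / s\<^sup>2) s" using \<open>s > 0\<close> by (intro continuous_intros) auto
  qed (use a in auto)
  ultimately have i: "(\<integral>s. indicator {d..L} s * (triangle s x / s) \<partial>lborel) = ln L + \<bar>x\<bar> / L - (ln a + \<bar>x\<bar> / a)" by simp
  have t: "triangle L x = 1 - \<bar>x\<bar> / L" using True d by (auto simp: triangle_def max_def field_simps)
  show ?thesis
  proof (cases "\<bar>x\<bar> < d")
    case True
    then show ?thesis using i t by (simp add: trunc_log_def a_def max_def)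
  next
    case False
    then have "a = \<bar>x\<bar>" "\<bar>x\<bar> > 0" using d by (auto simp: a_def)
    then show ?thesis using i t False True by (simp add: trunc_log_def)
  qed
qed

lemma kernel_form_trunc_log:
  assumes d: "0 < d" "d \<le> L" and M: "fin_borel M" and N: "fin_borel N"
  shows "integrable lborel (\<lambda>s. indicator {d..L} s / s * kernel_form (triangle s) M N)"
    and "kernel_form (trunc_log d L) M N = - ln L * mass M * mass N + kernel_form (triangle L) M N
           + (\<integral>s. indicator {d..L} s / s * kernel_form (triangle s) M N \<partial>lborel)"
proof -
  interpret M: finite_measure M using M by (rule fin_borelD)
  interpret N: finite_measure N using N by (rule fin_borelD)
  interpret MN: finite_measure "M \<Otimes>\<^sub>M N" by (rule finite_measure_pair_measure[OF N.finite_measure_axioms M.finite_measure_axioms])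
  interpret Q: pair_sigma_finite "M \<Otimes>\<^sub>M N" "lborel :: real measure" by unfold_locales
  have [measurable_cong]: "sets N = sets borel" "sets M = sets borel" using N M by (auto dest: fin_borelD)
  let ?f = "\<lambda>z s. indicator {d..L} s * (triangle s (fst z - snd z) / s)"
  have L: "L > 0" using d by auto
  have int: "integrable ((M \<Otimes>\<^sub>M N) \<Otimes>\<^sub>M lborel) (\<lambda>(z, s). ?f z s)"
  \<comment> \<open>The lower cutoff \<open>d\<close> bounds \<open>1 / s\<close>, so the integrand
    is bounded and lives on a set of finite measure.\<close>
  proof (rule Bochner_Integration.integrable_bound)
    have "emeasure ((M \<Otimes>\<^sub>M N) \<Otimes>\<^sub>M lborel) (space (M \<Otimes>\<^sub>M N) \<times> {d..L}) < \<infinity>"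
      using d MN.finite_emeasure_space
      by (subst lborel.emeasure_pair_measure_Times) (auto simp: ennreal_mult_eq_top_iff less_top[symmetric] simp del: MN.emeasure_finite)
    then show "integrable ((M \<Otimes>\<^sub>M N) \<Otimes>\<^sub>M lborel) (\<lambda>z. indicator (space (M \<Otimes>\<^sub>M N) \<times> {d..L}) z * (1 / d))"
      by (intro integrable_mult_left integrable_real_indicator) auto
    show "AE z in (M \<Otimes>\<^sub>M N) \<Otimes>\<^sub>M lborel. norm (case z of (z, s) \<Rightarrow> ?f z s)
        \<le> norm (indicator (space (M \<Otimes>\<^sub>M N) \<times> {d..L}) z * (1 / d))"
    proof (rule AE_I2)
      fix z assume z: "z \<in> space ((M \<Otimes>\<^sub>M N) \<Otimes>\<^sub>M (lborel :: real measure))"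
      obtain w s where zz: "z = (w, s)" by (rule prod.exhaust)
      have "triangle s (fst w - snd w) / s \<le> 1 / d" "0 \<le> triangle s (fst w - snd w) / s" if "d \<le> s"
        using triangle_bounds[of s "fst w - snd w"] d that by (auto intro!: frac_le)
      then show "norm (case z of (z, s) \<Rightarrow> ?f z s) \<le> norm (indicator (space (M \<Otimes>\<^sub>M N) \<times> {d..L}) z * (1 / d))"
        using z zz d by (auto simp: indicator_def space_pair_measure)
    qed
  qed measurable
  have inner: "(\<integral>z. ?f z s \<partial>(M \<Otimes>\<^sub>M N)) = indicator {d..L} s / s * kernel_form (triangle s) M N" for s
  proof (cases "s \<in> {d..L}")
    case True
    then have "s > 0" using d by auto
    then show ?thesis using True kernel_form_pair(2)[OF bdd_borel_triangle M N] by simp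
  qed simp
  show "integrable lborel (\<lambda>s. indicator {d..L} s / s * kernel_form (triangle s) M N)"
    using Q.integrable_snd[OF int] by (simp only: inner)
  have i1: "integrable (M \<Otimes>\<^sub>M N) (\<lambda>z. triangle L (fst z - snd z))" by (rule kernel_form_pair(1)[OF bdd_borel_triangle[OF L] M N])
  have i2: "integrable (M \<Otimes>\<^sub>M N) (\<lambda>z. \<integral>s. ?f z s \<partial>lborel)" using Q.integrable_fst[OF int] by simp
  have "kernel_form (trunc_log d L) M N = (\<integral>z. (- ln L + triangle L (fst z - snd z)) + (\<integral>s. ?f z s \<partial>lborel) \<partial>(M \<Otimes>\<^sub>M N))"
    unfolding kernel_form_pair(2)[OF bdd_borel_trunc_log[OF d] M N] trunc_log_eq_triangle_integral[OF d] ..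
  also have "\<dots> = (\<integral>z. - ln L + triangle L (fst z - snd z) \<partial>(M \<Otimes>\<^sub>M N)) + (\<integral>z. (\<integral>s. ?f z s \<partial>lborel) \<partial>(M \<Otimes>\<^sub>M N))"
    using i1 i2 by (intro Bochner_Integration.integral_add) auto
  also have "(\<integral>z. (\<integral>s. ?f z s \<partial>lborel) \<partial>(M \<Otimes>\<^sub>M N)) = (\<integral>s. indicator {d..L} s / s * kernel_form (triangle s) M N \<partial>lborel)"
    using Q.Fubini_integral[OF int] by (simp only: inner)
  also have "(\<integral>z. - ln L + triangle L (fst z - snd z) \<partial>(M \<Otimes>\<^sub>M N)) = - ln L * mass M * mass N + kernel_form (triangle L) M N"
    unfolding kernel_form_pair(2)[OF bdd_borel_add[OF bdd_borel_const[of "- ln L"] bdd_borel_triangle[OF L]] M N, symmetric]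
      kernel_form_add[OF bdd_borel_const bdd_borel_triangle[OF L] M N] kernel_form_const[OF M N] ..
  finally show "kernel_form (trunc_log d L) M N = - ln L * mass M * mass N + kernel_form (triangle L) M N
           + (\<integral>s. indicator {d..L} s / s * kernel_form (triangle s) M N \<partial>lborel)" .
qed

text \<open>Equal masses cancel the constant \<open>- ln L\<close>, whose sign is unfavourable for
  large \<open>L\<close>. Of the mixture only the atom at \<open>s = L\<close> is kept, which is
  enough to control smooth functions; the other triangles contribute a nonnegative amount.\<close>

lemma kernel_dist_trunc_log_ge:
  assumes d: "0 < d" "d \<le> L" and M: "fin_borel M" and N: "fin_borel N" and eq: "mass M = mass N"
  shows "kernel_dist (triangle L) M N \<le> kernel_dist (trunc_log d L) M N"
proof -
  note i = kernel_form_trunc_log(1)[OF d]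
  have "kernel_dist (trunc_log d L) M N - kernel_dist (triangle L) M N = (\<integral>s. indicator {d..L} s / s * kernel_form (triangle s) M M \<partial>lborel)
     + (\<integral>s. indicator {d..L} s / s * kernel_form (triangle s) N N \<partial>lborel) - 2 * (\<integral>s. indicator {d..L} s / s * kernel_form (triangle s) M N \<partial>lborel)"
    unfolding kernel_dist_def kernel_form_trunc_log(2)[OF d M M] kernel_form_trunc_log(2)[OF d N N] kernel_form_trunc_log(2)[OF d M N] using eq by simp
  also have "\<dots> = (\<integral>s. indicator {d..L} s / s * kernel_form (triangle s) M M + indicator {d..L} s / s * kernel_form (triangle s) N N
      - 2 * (indicator {d..L} s / s * kernel_form (triangle s) M N) \<partial>lborel)"
    using i[OF M M] i[OF N N] i[OF M N] by (simp del: times_divide_eq_left times_divide_eq_right)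
  also have "\<dots> = (\<integral>s. indicator {d..L} s / s * kernel_dist (triangle s) M N \<partial>lborel)"
    by (simp add: kernel_dist_def algebra_simps)
  also have "\<dots> \<ge> 0"
    using kernel_dist_triangle_nonneg[OF _ M N] d by (intro integral_nonneg_AE AE_I2) (auto simp: indicator_def)
  finally show ?thesis by simp
qed

lemma kernel_dist_trunc_log_nonneg:
  assumes d: "0 < d" "d \<le> L" and M: "fin_borel M" and N: "fin_borel N" and eq: "mass M = mass N"
  shows "0 \<le> kernel_dist (trunc_log d L) M N"
  using kernel_dist_trunc_log_ge[OF assms] kernel_dist_triangle_nonneg[OF _ M N, of L] d by simp

subsection \<open>Push-forwards, convolutions and mixtures\<close>

lemma fin_borel_distr:
  assumes M: "fin_borel M" and f: "f \<in> borel_measurable borel"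
  shows "fin_borel (distr M borel f)"
proof -
  have "f \<in> borel_measurable M" using f measurable_cong_sets[OF fin_borelD(1)[OF M] refl] by blast
  then show ?thesis unfolding fin_borel_def
    using finite_measure.finite_measure_distr[OF fin_borelD(3)[OF M]] by simp
qed

lemma integral_distr_borel:
  fixes g :: "real \<Rightarrow> real"
  assumes M: "fin_borel M" and f: "f \<in> borel_measurable borel" and g: "g \<in> borel_measurable borel"
  shows "(\<integral>x. g x \<partial>distr M borel f) = (\<integral>x. g (f x) \<partial>M)"
proof -
  have "f \<in> borel_measurable M" using f measurable_cong_sets[OF fin_borelD(1)[OF M] refl] by blast
  then show ?thesis using g by (rule integral_distr)
qed

lemma mass_distr:
  assumes M: "fin_borel M" and f: "f \<in> borel_measurable borel"
  shows "mass (distr M borel f) = mass M"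
  using integral_distr_borel[OF M f, of "\<lambda>_. 1"] integral_const_mass[OF M, of 1]
    integral_const_mass[OF fin_borel_distr[OF M f], of 1] by simp

lemma kernel_form_distr:
  assumes k: "bdd_borel k" and M: "fin_borel M" and N: "fin_borel N"
    and f: "f \<in> borel_measurable borel" and g: "g \<in> borel_measurable borel"
  shows "kernel_form k (distr M borel f) (distr N borel g) = (\<integral>x. (\<integral>y. k (f x - g y) \<partial>N) \<partial>M)"
proof -
  have [measurable]: "k \<in> borel_measurable borel" by (rule bdd_borel_meas[OF k])
  have "(\<integral>y. k (x - y) \<partial>distr N borel g) = (\<integral>y. k (x - g y) \<partial>N)" for x
    by (intro integral_distr_borel N g) measurable
  then have "kernel_form k (distr M borel f) (distr N borel g) = (\<integral>x. (\<integral>y. k (x - g y) \<partial>N) \<partial>distr M borel f)"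
    by (simp add: kernel_form_def)
  also have "\<dots> = (\<integral>x. (\<integral>y. k (f x - g y) \<partial>N) \<partial>M)"
    using bdd_borel_inner[OF k N _ g, of "\<lambda>x. x"] by (intro integral_distr_borel M f bdd_borel_meas) auto
  finally show ?thesis .
qed

lemma fin_borel_convolution:
  assumes "fin_borel M" "fin_borel N"
  shows "fin_borel (convolution M N)"
  using convolution_finite[of M N] assms by (auto simp: fin_borel_def)

lemma integral_convolution:
  assumes M: "fin_borel M" and U: "fin_borel U" and g: "bdd_borel g"
  shows "(\<integral>x. g x \<partial>convolution M U) = (\<integral>t. (\<integral>x. g (x + t) \<partial>M) \<partial>U)"
proof -
  have [measurable_cong]: "sets M = sets borel" "sets U = sets borel" using M U by (auto dest: fin_borelD)
  have [measurable]: "g \<in> borel_measurable borel" by (rule bdd_borel_meas[OF g])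
  have "(\<integral>x. g x \<partial>convolution M U) = (\<integral>z. g (fst z + snd z) \<partial>(M \<Otimes>\<^sub>M U))"
    unfolding convolution_def by (subst integral_distr) (auto simp: case_prod_unfold)
  also have "\<dots> = (\<integral>t. (\<integral>x. g (x + t) \<partial>M) \<partial>U)"
  proof -
    interpret M: finite_measure M using M by (rule fin_borelD)
    interpret U: finite_measure U using U by (rule fin_borelD)
    interpret MU: finite_measure "M \<Otimes>\<^sub>M U" by (rule finite_measure_pair_measure[OF U.finite_measure_axioms M.finite_measure_axioms])
    interpret Q: pair_sigma_finite M U by unfold_locales
    obtain B where B: "\<And>x. \<bar>g x\<bar> \<le> B" using bdd_borelE[OF g] by blast
    have "integrable (M \<Otimes>\<^sub>M U) (\<lambda>(x, t). g (x + t))"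
      by (rule MU.integrable_const_bound[where B=B]) (use B in \<open>auto simp: case_prod_unfold\<close>)
    from Q.integral_snd[OF this] show ?thesis by (simp add: case_prod_unfold)
  qed
  finally show ?thesis .
qed

lemma mass_convolution:
  assumes M: "fin_borel M" and U: "fin_borel U"
  shows "mass (convolution M U) = mass M * mass U"
  using integral_convolution[OF M U bdd_borel_const[of 1]]
  by (simp add: mass_def fin_borelD(2)[OF M] fin_borelD(2)[OF U] fin_borelD(2)[OF fin_borel_convolution[OF M U]])

lemma kernel_form_convolution_left:
  assumes k: "bdd_borel k" and M: "fin_borel M" and U: "fin_borel U" and N: "fin_borel N"
  shows "kernel_form k (convolution M U) N = (\<integral>t. kernel_form k (distr M borel (\<lambda>x. x + t)) N \<partial>U)"
proof -
  note b = bdd_borel_inner'[OF k N]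
  have "(\<integral>x. (\<integral>y. k (x + t - y) \<partial>N) \<partial>M) = kernel_form k (distr M borel (\<lambda>x. x + t)) N" for t
    unfolding kernel_form_def using integral_distr_borel[OF M _ bdd_borel_meas[OF b], of "\<lambda>x. x + t"] by simp
  then show ?thesis
    using integral_convolution[OF M U b] by (simp add: kernel_form_def)
qed

lemma integral_le_const:
  fixes c :: real
  assumes U: "fin_borel U" and m: "mass U = 1" and i: "integrable U h" and le: "\<And>t. h t \<le> c"
  shows "(\<integral>t. h t \<partial>U) \<le> c"
proof -
  have "(\<integral>t. h t \<partial>U) \<le> (\<integral>t. c \<partial>U)"
    using le i finite_measure.integrable_const[OF fin_borelD(3)[OF U]] by (intro integral_mono) auto
  then show ?thesis unfolding integral_const_mass[OF U] m by simp
qed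

lemma integrable_kernel_form_shift:
  assumes k: "bdd_borel k" and M: "fin_borel M" and U: "fin_borel U" and N: "fin_borel N"
  shows "integrable U (\<lambda>t. kernel_form k (distr M borel (\<lambda>x. x + t)) N)"
proof -
  \<comment> \<open>Rewritten as a difference kernel in \<open>t\<close> and \<open>- x\<close>, so
    that \<open>bdd_borel_inner\<close> yields measurability and boundedness in
    \<open>t\<close>.\<close>
  have e: "kernel_form k (distr M borel (\<lambda>x. x + t)) N = (\<integral>x. (\<integral>y. k ((t - (- x)) - y) \<partial>N) \<partial>M)" for t
    unfolding kernel_form_def using integral_distr_borel[OF M _ bdd_borel_meas[OF bdd_borel_inner'[OF k N]], of "\<lambda>x. x + t"]
    by (simp add: add.commute)
  show ?thesis unfolding e
    using bdd_borel_inner[OF bdd_borel_inner'[OF k N] M, of "\<lambda>t. t" "\<lambda>x. - x"]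
    by (intro integrable_bdd_borel[OF U]) auto
qed

text \<open>Translates share their mass and self-energy, so nonnegativity of
  \<open>kernel_dist\<close> between two of them bounds their mutual energy by this common
  self-energy.\<close>

lemma kernel_form_trunc_log_shift_le:
  assumes d: "0 < d" "d \<le> L" and M: "fin_borel M"
  shows "kernel_form (trunc_log d L) (distr M borel (\<lambda>x. x + t)) (distr M borel (\<lambda>x. x + u)) \<le> kernel_form (trunc_log d L) M M"
proof -
  note k = bdd_borel_trunc_log[OF d]
  have f: "fin_borel (distr M borel (\<lambda>x. x + t))" for t by (rule fin_borel_distr[OF M]) auto
  have s: "kernel_form (trunc_log d L) (distr M borel (\<lambda>x. x + t)) (distr M borel (\<lambda>x. x + t)) = kernel_form (trunc_log d L) M M" for t
    by (subst kernel_form_distr[OF k M M]) (auto simp: kernel_form_def)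
  have "mass (distr M borel (\<lambda>x. x + t)) = mass (distr M borel (\<lambda>x. x + u))"
    by (simp add: mass_distr[OF M])
  from kernel_dist_trunc_log_nonneg[OF d f f this] show ?thesis by (simp add: kernel_dist_def s)
qed

text \<open>Averaging over translations decreases the energy because \<open>kernel_dist (trunc_log d L)\<close> is nonnegative.\<close>

lemma kernel_form_trunc_log_convolution_le:
  assumes d: "0 < d" "d \<le> L" and M: "fin_borel M" and U: "fin_borel U" and m: "mass U = 1"
  shows "kernel_form (trunc_log d L) (convolution M U) (convolution M U) \<le> kernel_form (trunc_log d L) M M"
proof -
  note k = bdd_borel_trunc_log[OF d]
  have f: "fin_borel (distr M borel (\<lambda>x. x + t))" for t by (rule fin_borel_distr[OF M]) auto
  have c: "fin_borel (convolution M U)" by (rule fin_borel_convolution[OF M U])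
  have "kernel_form (trunc_log d L) (distr M borel (\<lambda>x. x + t)) (convolution M U) \<le> kernel_form (trunc_log d L) M M" for t
    unfolding kernel_form_commute[OF k f c trunc_log_minus] kernel_form_convolution_left[OF k M U f]
    by (rule integral_le_const[OF U m integrable_kernel_form_shift[OF k M U f] kernel_form_trunc_log_shift_le[OF d M]])
  then show ?thesis
    unfolding kernel_form_convolution_left[OF k M U c]
    by (rule integral_le_const[OF U m integrable_kernel_form_shift[OF k M U c]])
qed

lemma convolution_msum:
  assumes M: "\<And>i. i < r \<Longrightarrow> fin_borel (M i)" and U: "fin_borel U"
  shows "convolution (msum r M) U = msum r (\<lambda>i. convolution (M i) U)"
proof (rule measure_eqI)
  fix A assume "A \<in> sets (convolution (msum r M) U)"
  then have A: "A \<in> sets borel" by simp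
  have [measurable_cong]: "sets U = sets borel" using U by (auto dest: fin_borelD)
  interpret U: finite_measure U using U by (rule fin_borelD)
  have "emeasure (convolution (msum r M) U) A = (\<integral>\<^sup>+x. \<integral>\<^sup>+y. indicator A (x + y) \<partial>U \<partial>msum r M)"
    using A U fin_borel_msum[of r M] M by (intro convolution_emeasure') (auto dest: fin_borelD)
  also have "\<dots> = (\<Sum>i<r. \<integral>\<^sup>+x. \<integral>\<^sup>+y. indicator A (x + y) \<partial>U \<partial>M i)"
    using A M by (intro nn_integral_msum) (auto dest: fin_borelD)
  also have "\<dots> = (\<Sum>i<r. emeasure (convolution (M i) U) A)"
    using A U M by (intro sum.cong refl convolution_emeasure'[symmetric]) (auto dest: fin_borelD)
  also have "\<dots> = emeasure (msum r (\<lambda>i. convolution (M i) U)) A"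
    using A by (simp add: emeasure_msum)
  finally show "emeasure (convolution (msum r M) U) A = emeasure (msum r (\<lambda>i. convolution (M i) U)) A" .
qed simp

lemma distr_msum:
  assumes M: "\<And>i. i < r \<Longrightarrow> fin_borel (M i)" and f: "f \<in> borel_measurable borel"
  shows "distr (msum r M) borel f = msum r (\<lambda>i. distr (M i) borel f)"
proof (rule measure_eqI)
  fix A assume "A \<in> sets (distr (msum r M) borel f)"
  then have A: "A \<in> sets borel" by simp
  have "f -` A \<in> sets borel" using measurable_sets[OF f A] by simp
  then have "emeasure (distr (msum r M) borel f) A = (\<Sum>i<r. emeasure (M i) (f -` A))"
    using A f M by (simp add: emeasure_distr emeasure_msum fin_borelD)
  also have "\<dots> = (\<Sum>i<r. emeasure (distr (M i) borel f) A)"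
  proof (intro sum.cong refl)
    fix i assume "i \<in> {..<r}"
    then have "f \<in> borel_measurable (M i)" "space (M i) = UNIV"
      using f measurable_cong_sets[OF fin_borelD(1)[OF M] refl, of i] fin_borelD(2)[OF M] by auto
    then show "emeasure (M i) (f -` A) = emeasure (distr (M i) borel f) A" using A by (simp add: emeasure_distr)
  qed
  also have "\<dots> = emeasure (msum r (\<lambda>i. distr (M i) borel f)) A" using A by (simp add: emeasure_msum)
  finally show "emeasure (distr (msum r M) borel f) A = emeasure (msum r (\<lambda>i. distr (M i) borel f)) A" .
qed simp

definition mix :: "real measure \<Rightarrow> real measure \<Rightarrow> real measure" where
  "mix M N = wsum 2 (\<lambda>_. 1 / 2) (\<lambda>i. if i = 0 then M else N)"

lemma fin_borel_mix: "fin_borel M \<Longrightarrow> fin_borel N \<Longrightarrow> fin_borel (mix M N)"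
  unfolding mix_def by (rule fin_borel_wsum) auto

lemma emeasure_mix:
  assumes "fin_borel M" "fin_borel N" "A \<in> sets borel"
  shows "emeasure (mix M N) A = ennreal (1 / 2) * (emeasure M A + emeasure N A)"
  unfolding mix_def using assms by (subst emeasure_wsum) (auto simp: numeral_2_eq_2 distrib_left)

lemma msum_mix:
  assumes M: "\<And>i. i < r \<Longrightarrow> fin_borel (M i)" and N: "\<And>i. i < r \<Longrightarrow> fin_borel (N i)"
  shows "msum r (\<lambda>i. mix (M i) (N i)) = mix (msum r M) (msum r N)"
proof (rule measure_eqI)
  fix A assume "A \<in> sets (msum r (\<lambda>i. mix (M i) (N i)))"
  then have A: "A \<in> sets borel" by simp
  show "emeasure (msum r (\<lambda>i. mix (M i) (N i))) A = emeasure (mix (msum r M) (msum r N)) A"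
    using A M N fin_borel_msum[of r M] fin_borel_msum[of r N]
    by (simp add: emeasure_mix emeasure_msum fin_borelD fin_borel_mix sum.distrib sum_distrib_left distrib_left)
qed (simp add: mix_def)

text \<open>Parallelogram identity; the term with \<open>kernel_dist\<close> is the gain that makes
  convexity quantitative.\<close>

lemma kernel_form_mix:
  assumes k: "bdd_borel k" and M: "fin_borel M" and N: "fin_borel N" and e: "\<And>x. k (- x) = k x"
  shows "kernel_form k (mix M N) (mix M N) = kernel_form k M M / 2 + kernel_form k N N / 2 - kernel_dist k M N / 4"
proof -
  have f: "fin_borel (if i = 0 then M else N)" for i :: nat using M N by simp
  have "kernel_form k (mix M N) X = (kernel_form k M X + kernel_form k N X) / 2" if "fin_borel X" for X
    unfolding mix_def by (subst kernel_form_wsum_left[OF k f that]) (auto simp: numeral_2_eq_2)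
  moreover have "kernel_form k X (mix M N) = (kernel_form k X M + kernel_form k X N) / 2" if "fin_borel X" for X
    unfolding mix_def by (subst kernel_form_wsum_right[OF k that f]) (auto simp: numeral_2_eq_2)
  note 2 = calculation(1)[OF fin_borel_mix[OF M N]] this[OF M] this[OF N]
  show ?thesis
    unfolding 2 using kernel_form_commute[OF k M N e] by (simp add: kernel_dist_def field_simps)
qed

subsection \<open>Energies of tuples of measures\<close>

text \<open>The Angelesco energy for the truncated kernel. Each ordered pair of different indices
  has weight 1/2, and this is rearranged into energies of the single measures and of their sum, so
  that convexity and averaging for one measure apply term by term.\<close>

definition tuple_energy :: "real \<Rightarrow> real \<Rightarrow> nat \<Rightarrow> (nat \<Rightarrow> real measure) \<Rightarrow> real" where
  "tuple_energy d L r \<eta> = (\<Sum>j<r. kernel_form (trunc_log d L) (\<eta> j) (\<eta> j)) / 2 + kernel_form (trunc_log d L) (msum r \<eta>) (msum r \<eta>) / 2"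

lemma tuple_energy_eq_sum:
  assumes d: "0 < d" "d \<le> L" and M: "\<And>i. i < r \<Longrightarrow> fin_borel (\<eta> i)"
  shows "tuple_energy d L r \<eta> = (\<Sum>j<r. \<Sum>k<r. (if j = k then 1 else 1 / 2) * kernel_form (trunc_log d L) (\<eta> j) (\<eta> k))"
proof -
  note k = bdd_borel_trunc_log[OF d]
  have "kernel_form (trunc_log d L) (msum r \<eta>) (msum r \<eta>) = (\<Sum>j<r. \<Sum>k<r. kernel_form (trunc_log d L) (\<eta> j) (\<eta> k))"
    using M by (simp add: kernel_form_msum_left[OF k _ fin_borel_msum] kernel_form_msum_right[OF k])
  moreover have "(\<Sum>j<r. \<Sum>k<r. (if j = k then 1 else 1 / 2) * kernel_form (trunc_log d L) (\<eta> j) (\<eta> k))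
    = (\<Sum>j<r. kernel_form (trunc_log d L) (\<eta> j) (\<eta> j) / 2 + (\<Sum>k<r. kernel_form (trunc_log d L) (\<eta> j) (\<eta> k) / 2))"
  proof (intro sum.cong refl)
    fix j assume j: "j \<in> {..<r}"
    have "(\<Sum>k<r. (if j = k then 1 else 1 / 2) * kernel_form (trunc_log d L) (\<eta> j) (\<eta> k))
      = (\<Sum>k<r. (if j = k then kernel_form (trunc_log d L) (\<eta> j) (\<eta> j) / 2 else 0) + kernel_form (trunc_log d L) (\<eta> j) (\<eta> k) / 2)"
      by (intro sum.cong refl) auto
    also have "\<dots> = kernel_form (trunc_log d L) (\<eta> j) (\<eta> j) / 2 + (\<Sum>k<r. kernel_form (trunc_log d L) (\<eta> j) (\<eta> k) / 2)"
      using j by (simp add: sum.distrib sum.delta)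
    finally show "(\<Sum>k<r. (if j = k then 1 else 1 / 2) * kernel_form (trunc_log d L) (\<eta> j) (\<eta> k)) = \<dots>" .
  qed
  ultimately show ?thesis by (simp add: tuple_energy_def sum.distrib sum_divide_distrib)
qed

lemma tuple_energy_convolution_le:
  assumes d: "0 < d" "d \<le> L" and M: "\<And>i. i < r \<Longrightarrow> fin_borel (\<eta> i)" and U: "fin_borel U" "mass U = 1"
  shows "tuple_energy d L r (\<lambda>j. convolution (\<eta> j) U) \<le> tuple_energy d L r \<eta>"
proof -
  have "msum r (\<lambda>j. convolution (\<eta> j) U) = convolution (msum r \<eta>) U"
    using M U by (simp add: convolution_msum)
  then show ?thesis unfolding tuple_energy_def
    using M by (simp only:) (intro add_mono divide_right_mono sum_mono kernel_form_trunc_log_convolution_le d U fin_borel_msum; simp)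
qed

lemma mass_msum: "(\<And>i. i < r \<Longrightarrow> fin_borel (M i)) \<Longrightarrow> mass (msum r M) = (\<Sum>i<r. mass (M i))"
  using emeasure_msum[of r M UNIV] fin_borel_msum[of r M]
  by (simp add: mass_def measure_def fin_borelD)
    (subst enn2real_sum; simp add: less_top[symmetric] fin_borelD(5)[unfolded infinity_ennreal_def])

text \<open>Each summand is convex by the parallelogram identity. Only the gain of the total measure
  is recorded, since the limit concerns the sum of the measures; 1/8 is 1/4 from that identity times
  1/2 from \<open>tuple_energy\<close>.\<close>

lemma tuple_energy_mix_le:
  assumes d: "0 < d" "d \<le> L" and M: "\<And>i. i < r \<Longrightarrow> fin_borel (\<eta> i)" and N: "\<And>i. i < r \<Longrightarrow> fin_borel (\<nu> i)"
    and m: "\<And>i. i < r \<Longrightarrow> mass (\<eta> i) = mass (\<nu> i)"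
  shows "tuple_energy d L r (\<lambda>j. mix (\<eta> j) (\<nu> j)) \<le> tuple_energy d L r \<eta> / 2 + tuple_energy d L r \<nu> / 2 - kernel_dist (trunc_log d L) (msum r \<eta>) (msum r \<nu>) / 8"
proof -
  note k = bdd_borel_trunc_log[OF d]
  let ?I = "\<lambda>M. kernel_form (trunc_log d L) M M"
  have "(\<Sum>j<r. ?I (mix (\<eta> j) (\<nu> j))) \<le> (\<Sum>j<r. ?I (\<eta> j) / 2 + ?I (\<nu> j) / 2)"
    using M N m kernel_dist_trunc_log_nonneg[OF d] by (intro sum_mono) (simp add: kernel_form_mix[OF k])
  moreover have "?I (msum r (\<lambda>j. mix (\<eta> j) (\<nu> j))) = ?I (msum r \<eta>) / 2 + ?I (msum r \<nu>) / 2 - kernel_dist (trunc_log d L) (msum r \<eta>) (msum r \<nu>) / 4"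
    using M N by (simp add: msum_mix kernel_form_mix[OF k] fin_borel_msum)
  ultimately show ?thesis by (simp add: tuple_energy_def sum.distrib sum_divide_distrib[symmetric] field_simps)
qed

subsection \<open>Supports\<close>

text \<open>The complement of the support is a union of null balls, and by Lindelof countably many
  of them cover it.\<close>

lemma AE_in_msupp:
  assumes M: "sets M = sets borel"
  shows "AE x in M. x \<in> msupp M"
proof -
  define F where "F = {ball x e | x e. emeasure M (ball x e) = 0}"
  obtain F' where F': "F' \<subseteq> F" "countable F'" "\<Union>F' = \<Union>F"
    by (rule Lindelof[of F]) (auto simp: F_def)
  have "S \<in> null_sets M" if "S \<in> F'" for S
    using that F'(1) M by (auto simp: F_def intro!: null_setsI)
  then have "(\<Union>S\<in>F'. S) \<in> null_sets M" using F'(2) by (intro null_sets_UN') auto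
  then have "\<Union>F \<in> null_sets M" using F'(3) by simp
  moreover have "{x \<in> space M. x \<notin> msupp M} \<subseteq> \<Union>F"
  proof
    fix x assume "x \<in> {x \<in> space M. x \<notin> msupp M}"
    then obtain e where "e > 0" "emeasure M (ball x e) = 0" by (auto simp: msupp_def not_less)
    then show "x \<in> \<Union>F" unfolding F_def by (intro UnionI[of "ball x e"]) auto
  qed
  ultimately show ?thesis by (rule AE_I')
qed

lemma msupp_subset_closed:
  assumes M: "sets M = sets borel" and ae: "AE x in M. x \<in> S" and S: "closed S"
  shows "msupp M \<subseteq> S"
proof
  fix x assume x: "x \<in> msupp M"
  show "x \<in> S"
  proof (rule ccontr)
    assume "x \<notin> S"
    then obtain e where e: "e > 0" "ball x e \<subseteq> - S"
      using S by (metis ComplI open_Compl open_contains_ball)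
    have "AE y in M. y \<notin> ball x e" using ae e(2) by (auto elim!: eventually_mono)
    then have "emeasure M {y \<in> space M. y \<in> ball x e} = 0" by (intro emeasure_eq_0_AE) auto
    also have "{y \<in> space M. y \<in> ball x e} = ball x e" using sets_eq_imp_space_eq[OF M] by auto
    finally have "emeasure M (ball x e) = 0" .
    with x e(1) show False by (auto simp: msupp_def)
  qed
qed

lemma mass_eq_emeasure: "fin_borel M \<Longrightarrow> ennreal (mass M) = emeasure M UNIV"
  using finite_measure.emeasure_eq_measure[OF fin_borelD(3)] by (simp add: mass_def)

lemma emeasure_AE_subset:
  assumes M: "fin_borel M" and S: "S \<in> sets borel" and ae: "AE x in M. x \<in> S"
  shows "emeasure M S = ennreal (mass M)"
proof -
  have "emeasure M S = emeasure M UNIV"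
    using ae S fin_borelD(1)[OF M] by (intro emeasure_eq_AE) auto
  then show ?thesis using mass_eq_emeasure[OF M] by simp
qed

text \<open>Replaces the support condition by one that is easily followed through images, mixtures
  and convolutions. Since \<open>s i > 0\<close>, the equation in \<open>ennreal\<close> determines
  the real mass.\<close>

lemma admissible_iff:
  assumes s: "\<And>i. i < r \<Longrightarrow> 0 < s i"
  shows "admissible r a b s \<eta> \<longleftrightarrow>
    (\<forall>i<r. fin_borel (\<eta> i) \<and> (AE x in \<eta> i. x \<in> {a i..b i}) \<and> mass (\<eta> i) = s i)"
proof -
  have "(sets (\<eta> i) = sets borel \<and> finite_measure (\<eta> i)
      \<and> msupp (\<eta> i) \<subseteq> {a i..b i} \<and> emeasure (\<eta> i) {a i..b i} = ennreal (s i))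
      \<longleftrightarrow> (fin_borel (\<eta> i) \<and> (AE x in \<eta> i. x \<in> {a i..b i}) \<and> mass (\<eta> i) = s i)" if i: "i < r" for i
  proof (rule iffI; elim conjE)
    assume h: "sets (\<eta> i) = sets borel" "finite_measure (\<eta> i)" "msupp (\<eta> i) \<subseteq> {a i..b i}"
      "emeasure (\<eta> i) {a i..b i} = ennreal (s i)"
    have f: "fin_borel (\<eta> i)" using h by (simp add: fin_borel_def)
    have ae: "AE x in \<eta> i. x \<in> {a i..b i}" using AE_in_msupp[OF h(1)] h(3) by (auto elim!: eventually_mono)
    have "mass (\<eta> i) = s i"
      using emeasure_AE_subset[OF f _ ae] h(4) s[OF i] mass_nonneg[of "\<eta> i"] by simp
    with f ae show "fin_borel (\<eta> i) \<and> (AE x in \<eta> i. x \<in> {a i..b i}) \<and> mass (\<eta> i) = s i" by blast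
  next
    assume h: "fin_borel (\<eta> i)" "AE x in \<eta> i. x \<in> {a i..b i}" "mass (\<eta> i) = s i"
    have "emeasure (\<eta> i) {a i..b i} = ennreal (s i)" using emeasure_AE_subset[OF h(1) _ h(2)] h(3) by simp
    moreover have "msupp (\<eta> i) \<subseteq> {a i..b i}" by (rule msupp_subset_closed[OF fin_borelD(1)[OF h(1)] h(2)]) simp
    ultimately show "sets (\<eta> i) = sets borel \<and> finite_measure (\<eta> i)
      \<and> msupp (\<eta> i) \<subseteq> {a i..b i} \<and> emeasure (\<eta> i) {a i..b i} = ennreal (s i)"
      using h(1) by (simp add: fin_borel_def)
  qed
  then show ?thesis unfolding admissible_def by blast
qed

subsection \<open>Logarithmic energy versus the truncated kernel\<close>

text \<open>What \<open>trunc_log\<close> removes from \<open>- ln \<bar>x\<bar>\<close> near 0. The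
  value at 0 is infinite, so that atoms are charged with infinite energy.\<close>

definition log_excess :: "real \<Rightarrow> real \<Rightarrow> ennreal" where
  "log_excess d x = (if x = 0 then \<infinity> else if \<bar>x\<bar> < d then ennreal (- ln \<bar>x\<bar> - (1 - ln d - \<bar>x\<bar> / d)) else 0)"

lemma log_excess_measurable [measurable]: "log_excess d \<in> borel_measurable borel"
  unfolding log_excess_def[abs_def] by measurable

text \<open>An integrable majorant for the logarithmic singularity whose primitive is a multiple of
  \<open>sqrt\<close>. The primitive is not differentiable at 0, hence the interior form of the
  fundamental theorem.\<close>

lemma nn_integral_sqrt_kernel:
  assumes d: "0 < d"
  shows "(\<integral>\<^sup>+x. ennreal (if x \<in> {0<..<d} then 2 * sqrt d / sqrt x else 0) \<partial>lborel) = ennreal (4 * d)"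
proof -
  have "((\<lambda>x. 2 * sqrt d / sqrt x) has_integral (4 * sqrt d * sqrt d - 4 * sqrt d * sqrt 0)) {0..d}"
  proof (rule fundamental_theorem_of_calculus_interior)
    show "continuous_on {0..d} (\<lambda>x. 4 * sqrt d * sqrt x)" by (intro continuous_intros)
    fix x assume "x \<in> {0<..<d}"
    then show "((\<lambda>x. 4 * sqrt d * sqrt x) has_vector_derivative 2 * sqrt d / sqrt x) (at x)"
      unfolding has_real_derivative_iff_has_vector_derivative[symmetric]
      by (auto intro!: derivative_eq_intros simp: field_simps)
  qed (use d in auto)
  moreover have "4 * sqrt d * sqrt d - 4 * sqrt d * sqrt 0 = 4 * d" using d by (simp add: mult.assoc)
  ultimately have "((\<lambda>x. 2 * sqrt d / sqrt x) has_integral (4 * d)) {0..d}" by metis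
  then have "((\<lambda>x. if x \<in> {0..d} then 2 * sqrt d / sqrt x else 0) has_integral (4 * d)) UNIV"
    by (subst has_integral_restrict_UNIV)
  then have "((\<lambda>x. if x \<in> {0<..<d} then 2 * sqrt d / sqrt x else 0) has_integral (4 * d)) UNIV"
    by (rule has_integral_spike[rotated 2, where S="{0, d}"]) auto
  then show ?thesis
    using d by (intro nn_integral_has_integral_lborel) auto
qed

text \<open>The bound is linear in \<open>d\<close> by scaling: in
  \<open>u = \<bar>x\<bar> / d\<close> the excess is at most \<open>2 / sqrt u\<close>, by
  \<open>ln_le_minus_one\<close> at \<open>1 / sqrt u\<close>. Each side of 0 contributes
  \<open>4 * d\<close>.\<close>

lemma nn_integral_log_excess_le:
  assumes d: "0 < d"
  shows "(\<integral>\<^sup>+x. log_excess d x \<partial>lborel) \<le> ennreal (8 * d)"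
proof -
  let ?f = "\<lambda>x. ennreal (if x \<in> {0<..<d} then 2 * sqrt d / sqrt x else 0)"
  have "(\<integral>\<^sup>+x. log_excess d x \<partial>lborel) \<le> (\<integral>\<^sup>+x. ?f x + ?f (- x) \<partial>lborel)"
  proof (rule nn_integral_mono_AE)
    have "AE x in lborel. x \<noteq> (0::real)" by (rule AE_lborel_singleton)
    then show "AE x in lborel. log_excess d x \<le> ?f x + ?f (- x)"
    proof eventually_elim
      case (elim x)
      show ?case
      proof (cases "\<bar>x\<bar> < d")
        case True
        define u where "u = \<bar>x\<bar> / d"
        have u: "0 < u" "\<bar>x\<bar> = u * d" using elim d by (auto simp: u_def)
        have "1 - 1 / sqrt u \<le> ln (sqrt u)"
          using ln_le_minus_one[of "1 / sqrt u"] u by (simp add: ln_div)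
        then have "- ln u \<le> 2 / sqrt u - 2" using u by (simp add: ln_sqrt)
        then have "- ln \<bar>x\<bar> - (1 - ln d - \<bar>x\<bar> / d) \<le> 2 / sqrt u"
          using u d True elim by (simp add: ln_mult)
        also have "2 / sqrt u = 2 * sqrt d / sqrt \<bar>x\<bar>"
          unfolding u_def using d by (simp add: real_sqrt_divide)
        finally have "log_excess d x \<le> ennreal (2 * sqrt d / sqrt \<bar>x\<bar>)"
          using True elim by (auto simp: log_excess_def intro: ennreal_leI)
        also have "\<dots> = ?f x + ?f (- x)" using True elim d by (cases "x > 0") auto
        finally show ?thesis .
      qed (use elim in \<open>simp add: log_excess_def\<close>)
    qed
  qed
  also have "\<dots> = (\<integral>\<^sup>+x. ?f x \<partial>lborel) + (\<integral>\<^sup>+x. ?f (- x) \<partial>lborel)" by (rule nn_integral_add) auto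
  also have "(\<integral>\<^sup>+x. ?f (- x) \<partial>lborel) = (\<integral>\<^sup>+x. ?f x \<partial>lborel)"
    using nn_integral_real_affine[of ?f "- 1" 0] by (simp cong: if_cong)
  finally show ?thesis
    unfolding nn_integral_sqrt_kernel[OF d] using d by (simp add: ennreal_plus[symmetric] del: ennreal_plus)
qed

text \<open>For \<open>C \<ge> 0\<close>, expresses a Lebesgue density at most \<open>C\<close>
  without choosing a density.\<close>

definition dominated :: "real \<Rightarrow> real measure \<Rightarrow> bool" where
  "dominated C N \<longleftrightarrow> (\<forall>A\<in>sets borel. emeasure N A \<le> ennreal C * emeasure lborel A)"

lemma nn_integral_le_scaled:
  assumes s: "sets N = sets M" and le: "\<And>A. A \<in> sets M \<Longrightarrow> emeasure N A \<le> ennreal C * emeasure M A"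
    and f: "f \<in> borel_measurable M"
  shows "(\<integral>\<^sup>+x. f x \<partial>N) \<le> ennreal C * (\<integral>\<^sup>+x. f x \<partial>M)"
proof -
  have "N \<le> density M (\<lambda>_. ennreal C)"
    using le s by (subst le_measure) (auto simp: emeasure_density_const)
  then have "(\<integral>\<^sup>+x. f x \<partial>N) \<le> (\<integral>\<^sup>+x. f x \<partial>density M (\<lambda>_. ennreal C))"
    using s by (intro nn_integral_mono_measure) auto
  also have "\<dots> = ennreal C * (\<integral>\<^sup>+x. f x \<partial>M)"
    using f by (simp add: nn_integral_density nn_integral_cmult)
  finally show ?thesis .
qed

lemma nn_integral_dominated:
  assumes N: "sets N = sets borel" and dom: "dominated C N" and f: "f \<in> borel_measurable borel"
  shows "(\<integral>\<^sup>+x. f x \<partial>N) \<le> ennreal C * (\<integral>\<^sup>+x. f x \<partial>lborel)"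
  using N dom f by (intro nn_integral_le_scaled) (auto simp: dominated_def)

text \<open>Translation and reflection invariance of Lebesgue measure bound the inner integral
  uniformly in \<open>x\<close>, so \<open>M\<close> enters through its mass alone.\<close>

lemma nn_integral_log_excess_dominated:
  assumes M: "fin_borel M" and N: "fin_borel N" and dom: "dominated C N" and d: "0 < d" and C: "0 \<le> C"
  shows "(\<integral>\<^sup>+x. \<integral>\<^sup>+y. log_excess d (x - y) \<partial>N \<partial>M) \<le> ennreal (mass M * (C * (8 * d)))"
proof -
  have "(\<integral>\<^sup>+y. log_excess d (x - y) \<partial>N) \<le> ennreal (C * (8 * d))" for x
  proof -
    have "(\<integral>\<^sup>+y. log_excess d (x - y) \<partial>N) \<le> ennreal C * (\<integral>\<^sup>+y. log_excess d (x - y) \<partial>lborel)"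
      using N dom by (intro nn_integral_dominated) (auto dest: fin_borelD)
    also have "(\<integral>\<^sup>+y. log_excess d (x - y) \<partial>lborel) = (\<integral>\<^sup>+y. log_excess d y \<partial>lborel)"
      using nn_integral_real_affine[of "log_excess d" "- 1" x] by simp
    also have "ennreal C * (\<integral>\<^sup>+y. log_excess d y \<partial>lborel) \<le> ennreal C * ennreal (8 * d)"
      by (intro mult_left_mono nn_integral_log_excess_le d) auto
    finally show ?thesis using C d by (simp add: ennreal_mult)
  qed
  then have "(\<integral>\<^sup>+x. \<integral>\<^sup>+y. log_excess d (x - y) \<partial>N \<partial>M) \<le> (\<integral>\<^sup>+x. ennreal (C * (8 * d)) \<partial>M)"
    by (intro nn_integral_mono) auto
  also have "\<dots> = ennreal (mass M * (C * (8 * d)))"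
    using mass_eq_emeasure[OF M] fin_borelD(2)[OF M] C d mass_nonneg[of M]
    by (simp add: ennreal_mult mult.commute)
  finally show ?thesis .
qed

text \<open>For \<open>d \<le> 1\<close> the kernel is nonnegative where it is truncated. The excess
  therefore enters only the first integral of \<open>log_energy\<close>, while the subtracted one is
  unchanged and finite, so the difference of extended reals is well behaved.\<close>

lemma log_energy_eq:
  assumes d: "0 < d" "d \<le> 1" "d \<le> L" and M: "fin_borel M" and N: "fin_borel N"
    and S: "AE x in M. x \<in> S" "AE y in N. y \<in> S'" and L: "\<And>x y. x \<in> S \<Longrightarrow> y \<in> S' \<Longrightarrow> \<bar>x - y\<bar> \<le> L"
  shows "log_energy M N = ereal (kernel_form (trunc_log d L) M N) + enn2ereal (\<integral>\<^sup>+x. \<integral>\<^sup>+y. log_excess d (x - y) \<partial>N \<partial>M)"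
proof -
  have [measurable_cong]: "sets M = sets borel" "sets N = sets borel" using M N by (auto dest: fin_borelD)
  interpret N: finite_measure N using N by (rule fin_borelD)
  note k = bdd_borel_trunc_log[OF d(1,3)]
  let ?K = "trunc_log d L"
  define a where "a = (\<integral>\<^sup>+x. \<integral>\<^sup>+y. ennreal (?K (x - y)) \<partial>N \<partial>M)"
  define b where "b = (\<integral>\<^sup>+x. \<integral>\<^sup>+y. ennreal (- ?K (x - y)) \<partial>N \<partial>M)"
  define g where "g = (\<integral>\<^sup>+x. \<integral>\<^sup>+y. log_excess d (x - y) \<partial>N \<partial>M)"
  have pos: "(if z = w then \<infinity> else ennreal (- ln \<bar>z - w\<bar>)) = ennreal (?K (z - w)) + log_excess d (z - w)"
    and neg: "(if z = w then 0 else ennreal (ln \<bar>z - w\<bar>)) = ennreal (- ?K (z - w))"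
    if "\<bar>z - w\<bar> \<le> L" for z w
  proof -
    have ld: "ln d \<le> 0" using d by simp
    consider "z = w" | "z \<noteq> w" "\<bar>z - w\<bar> < d" | "z \<noteq> w" "d \<le> \<bar>z - w\<bar>" by linarith
    then have "(if z = w then \<infinity> else ennreal (- ln \<bar>z - w\<bar>)) = ennreal (?K (z - w)) + log_excess d (z - w)
      \<and> (if z = w then 0 else ennreal (ln \<bar>z - w\<bar>)) = ennreal (- ?K (z - w))"
    proof cases
      case 1
      have "ln d \<le> 1" using ld by linarith
      then show ?thesis using 1 d by (auto simp: log_excess_def trunc_log_def ennreal_neg)
    next
      case 2
      have "\<bar>z - w\<bar> / d \<le> 1" using 2 d by simp
      then have "0 \<le> 1 - ln d - \<bar>z - w\<bar> / d" using ld by linarith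
      then have kp: "?K (z - w) = 1 - ln d - \<bar>z - w\<bar> / d" "0 \<le> ?K (z - w)" using 2 by (auto simp: trunc_log_def)
      have le: "?K (z - w) \<le> - ln \<bar>z - w\<bar>" using 2 d that by (intro trunc_log_le_ln) auto
      have "ennreal (?K (z - w)) + log_excess d (z - w) = ennreal (?K (z - w)) + ennreal (- ln \<bar>z - w\<bar> - ?K (z - w))"
        using 2 kp by (simp add: log_excess_def)
      also have "\<dots> = ennreal (- ln \<bar>z - w\<bar>)" using kp le by (subst ennreal_plus[symmetric]) auto
      finally show ?thesis using 2 kp order_trans[OF kp(2) le] by (auto simp: ennreal_neg)
    next
      case 3
      then have "?K (z - w) = - ln \<bar>z - w\<bar>" using that by (intro trunc_log_eq_ln) auto
      then show ?thesis using 3 d by (auto simp: log_excess_def)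
    qed
    then show "(if z = w then \<infinity> else ennreal (- ln \<bar>z - w\<bar>)) = ennreal (?K (z - w)) + log_excess d (z - w)"
      "(if z = w then 0 else ennreal (ln \<bar>z - w\<bar>)) = ennreal (- ?K (z - w))" by auto
  qed
  have "(\<integral>\<^sup>+z. \<integral>\<^sup>+w. (if z = w then \<infinity> else ennreal (- ln \<bar>z - w\<bar>)) \<partial>N \<partial>M)
    = (\<integral>\<^sup>+z. \<integral>\<^sup>+w. ennreal (?K (z - w)) + log_excess d (z - w) \<partial>N \<partial>M)"
  proof (rule nn_integral_cong_AE)
    show "AE z in M. (\<integral>\<^sup>+w. (if z = w then \<infinity> else ennreal (- ln \<bar>z - w\<bar>)) \<partial>N)
       = (\<integral>\<^sup>+w. ennreal (?K (z - w)) + log_excess d (z - w) \<partial>N)"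
      using S(1)
    proof eventually_elim
      case (elim z)
      show ?case by (rule nn_integral_cong_AE, use S(2) in eventually_elim) (use elim L pos in auto)
    qed
  qed
  also have "\<dots> = a + g" unfolding a_def g_def
    by (subst nn_integral_add[symmetric]) (auto intro!: nn_integral_cong nn_integral_add)
  finally have P: "(\<integral>\<^sup>+z. \<integral>\<^sup>+w. (if z = w then \<infinity> else ennreal (- ln \<bar>z - w\<bar>)) \<partial>N \<partial>M) = a + g" .
  have Q: "(\<integral>\<^sup>+z. \<integral>\<^sup>+w. (if z = w then 0 else ennreal (ln \<bar>z - w\<bar>)) \<partial>N \<partial>M) = b"
    unfolding b_def
  proof (rule nn_integral_cong_AE)
    show "AE z in M. (\<integral>\<^sup>+w. (if z = w then 0 else ennreal (ln \<bar>z - w\<bar>)) \<partial>N) = (\<integral>\<^sup>+w. ennreal (- ?K (z - w)) \<partial>N)"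
      using S(1)
    proof eventually_elim
      case (elim z)
      show ?case by (rule nn_integral_cong_AE, use S(2) in eventually_elim) (use elim L neg in auto)
    qed
  qed
  have i: "integrable (M \<Otimes>\<^sub>M N) (\<lambda>z. ?K (fst z - snd z))" by (rule kernel_form_pair(1)[OF k M N])
  have a': "a = (\<integral>\<^sup>+z. ennreal (?K (fst z - snd z)) \<partial>(M \<Otimes>\<^sub>M N))"
    and b': "b = (\<integral>\<^sup>+z. ennreal (- ?K (fst z - snd z)) \<partial>(M \<Otimes>\<^sub>M N))"
    unfolding a_def b_def by (subst N.nn_integral_fst[symmetric]; simp)+
  have fin: "a \<noteq> \<infinity>" "b \<noteq> \<infinity>" using i unfolding a' b' by (auto simp: real_integrable_def)
  have "kernel_form ?K M N = enn2real a - enn2real b"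
    unfolding kernel_form_pair(2)[OF k M N] a' b' by (rule real_lebesgue_integral_def[OF i])
  moreover obtain a1 b1 where "a = ennreal a1" "b = ennreal b1" "0 \<le> a1" "0 \<le> b1"
    using fin by (metis ennreal_cases infinity_ennreal_def)
  ultimately show ?thesis
    unfolding log_energy_def P Q g_def[symmetric]
    by (cases g) (auto simp: enn2ereal_ennreal plus_ennreal.rep_eq)
qed

subsection \<open>Smoothing admissible tuples\<close>

text \<open>Weight 1/2 on ordered pairs equals weight 1 on pairs \<open>j < k\<close>. The former
  suits quadratic forms, the latter is the form of \<open>angelesco_energy\<close>.\<close>

lemma sum_pairs_symmetric:
  fixes f :: "nat \<Rightarrow> nat \<Rightarrow> real"
  assumes "\<And>j k. j < r \<Longrightarrow> k < r \<Longrightarrow> f j k = f k j"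
  shows "(\<Sum>j<r. \<Sum>k<r. (if j = k then 1 else 1 / 2) * f j k) = (\<Sum>j<r. f j j) + (\<Sum>j<r. \<Sum>k\<in>{j<..<r}. f j k)"
  using assms
proof (induction r)
  case (Suc r)
  have "{j<..<Suc r} = insert r {j<..<r}" if "j < r" for j using that by auto
  then have "(\<Sum>j<r. \<Sum>k\<in>{j<..<Suc r}. f j k) = (\<Sum>j<r. f j r + (\<Sum>k\<in>{j<..<r}. f j k))"
    by (intro sum.cong refl) simp
  moreover have "{r<..<Suc r} = {}" by auto
  moreover have "(\<Sum>j<r. (if j = r then 1 else 1 / 2) * f j r) = (\<Sum>j<r. f j r / 2)"
    "(\<Sum>k<r. (if r = k then 1 else 1 / 2) * f r k) = (\<Sum>j<r. f j r / 2)"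
    using Suc.prems by (auto intro!: sum.cong)
  ultimately show ?case using Suc.IH Suc.prems by (simp add: sum.distrib sum_divide_distrib[symmetric])
qed simp

locale intervals =
  fixes r :: nat and a b s :: "nat \<Rightarrow> real"
  assumes ab: "\<And>i. i < r \<Longrightarrow> a i < b i"
    and disj: "\<And>i j. i < r \<Longrightarrow> j < r \<Longrightarrow> i \<noteq> j \<Longrightarrow> {a i..b i} \<inter> {a j..b j} = {}"
    and spos: "\<And>i. i < r \<Longrightarrow> 0 < s i"
    and ssum: "(\<Sum>i<r. s i) = 1"
begin

definition "lo = Min (a ` {..<r})"
definition "hi = Max (b ` {..<r})"
text \<open>The added 1 gives both \<open>1 < L\<close>, so that every \<open>d \<le> 1\<close> is
  an allowed truncation, and \<open>hi - lo < L\<close>, so that a window of length \<open>L\<close>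
  ending at a point of the hull contains all of the hull to its left.\<close>

definition "L = hi - lo + 1"

lemma r_pos: "0 < r" using ssum by (cases r) auto

lemma lo_hi: "i < r \<Longrightarrow> lo \<le> a i" "i < r \<Longrightarrow> b i \<le> hi"
  by (auto simp: lo_def hi_def)

lemma in_hull: "i < r \<Longrightarrow> x \<in> {a i..b i} \<Longrightarrow> x \<in> {lo..hi}"
  using lo_hi[of i] by auto

lemma lo_less_hi: "lo < hi" using lo_hi[OF r_pos] ab[OF r_pos] by linarith

lemma L_gt_1: "1 < L" using lo_less_hi by (simp add: L_def)

lemma s_le_1:
  assumes "i < r"
  shows "s i \<le> 1"
proof -
  have "s i \<le> (\<Sum>j<r. s j)" by (rule member_le_sum) (use assms in \<open>auto intro: less_imp_le[OF spos]\<close>)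
  then show ?thesis by (simp only: ssum)
qed

lemma dist_le_L: "x \<in> {lo..hi} \<Longrightarrow> y \<in> {lo..hi} \<Longrightarrow> \<bar>x - y\<bar> \<le> L"
  by (auto simp: L_def abs_le_iff)

abbreviation "adm \<equiv> admissible r a b s"

lemma admD:
  assumes "adm \<eta>" "i < r"
  shows "fin_borel (\<eta> i)" "AE x in \<eta> i. x \<in> {a i..b i}" "mass (\<eta> i) = s i" "AE x in \<eta> i. x \<in> {lo..hi}"
proof -
  show f: "fin_borel (\<eta> i)" and ae: "AE x in \<eta> i. x \<in> {a i..b i}" and "mass (\<eta> i) = s i"
    using assms admissible_iff[of r s a b \<eta>] spos by auto
  show "AE x in \<eta> i. x \<in> {lo..hi}" by (rule eventually_mono[OF ae]) (use in_hull[OF assms(2)] in auto)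
qed

lemma admI:
  assumes "\<And>i. i < r \<Longrightarrow> fin_borel (\<eta> i)" "\<And>i. i < r \<Longrightarrow> AE x in \<eta> i. x \<in> {a i..b i}" "\<And>i. i < r \<Longrightarrow> mass (\<eta> i) = s i"
  shows "adm \<eta>"
  using assms admissible_iff[of r s a b \<eta>] spos by auto

lemma adm_mix:
  assumes "adm \<eta>" "adm \<nu>"
  shows "adm (\<lambda>i. mix (\<eta> i) (\<nu> i))"
proof (rule admI)
  fix i assume i: "i < r"
  note e = admD[OF assms(1) i] and n = admD[OF assms(2) i]
  show f: "fin_borel (mix (\<eta> i) (\<nu> i))" using e n by (intro fin_borel_mix)
  have "emeasure (mix (\<eta> i) (\<nu> i)) UNIV = ennreal (s i)"
  proof -
    have "emeasure (mix (\<eta> i) (\<nu> i)) UNIV = ennreal (1 / 2) * (ennreal (s i) + ennreal (s i))"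
      using e(1,3) n(1,3) by (simp add: emeasure_mix mass_eq_emeasure[symmetric])
    also have "\<dots> = ennreal (1 / 2) * ennreal (s i + s i)"
      unfolding ennreal_plus[OF less_imp_le[OF spos[OF i]] less_imp_le[OF spos[OF i]]] ..
    also have "\<dots> = ennreal (1 / 2 * (s i + s i))" using spos[OF i] by (intro ennreal_mult[symmetric]) auto
    finally show ?thesis by simp
  qed
  then show "mass (mix (\<eta> i) (\<nu> i)) = s i"
    using mass_eq_emeasure[OF f] mass_nonneg spos[OF i] by simp
  have "emeasure (mix (\<eta> i) (\<nu> i)) (- {a i..b i}) = 0"
  proof -
    have "emeasure M (- {a i..b i}) = 0" if "fin_borel M" "AE x in M. x \<in> {a i..b i}" for M
      using that fin_borelD[OF that(1)] by (subst (asm) AE_iff_measurable[OF _ refl]) (auto simp: Compl_eq)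
    then show ?thesis using e n by (simp add: emeasure_mix)
  qed
  then show "AE x in mix (\<eta> i) (\<nu> i). x \<in> {a i..b i}"
    by (intro AE_I[where N="- {a i..b i}"]) (auto simp: mix_def)
qed

lemma msum_adm:
  assumes "adm \<eta>"
  shows "fin_borel (msum r \<eta>)" "mass (msum r \<eta>) = 1" "AE x in msum r \<eta>. x \<in> (\<Union>i<r. {a i..b i})"
    "AE x in msum r \<eta>. x \<in> {lo..hi}"
proof -
  note d = admD[OF assms]
  show "fin_borel (msum r \<eta>)" by (intro fin_borel_msum d)
  show "mass (msum r \<eta>) = 1" using d ssum by (simp add: mass_msum)
  show "AE x in msum r \<eta>. x \<in> {lo..hi}"
    using d by (intro AE_msum) (auto dest: fin_borelD)
  show "AE x in msum r \<eta>. x \<in> (\<Union>i<r. {a i..b i})"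
  proof (rule AE_msum)
    fix i assume i: "i < r"
    show "sets (\<eta> i) = sets borel" using d(1)[OF i] by (rule fin_borelD)
    show "AE x in \<eta> i. x \<in> (\<Union>i<r. {a i..b i})" by (rule eventually_mono[OF d(2)[OF i]]) (use i in auto)
  qed simp
qed

lemma energy_ge_tuple_energy:
  assumes d: "0 < d" "d \<le> 1" and \<eta>: "adm \<eta>"
  shows "ereal (tuple_energy d L r \<eta>) \<le> angelesco_energy r \<eta>"
proof -
  have dL: "d \<le> L" using d L_gt_1 by simp
  note k = bdd_borel_trunc_log[OF d(1) dL]
  have e: "ereal (kernel_form (trunc_log d L) (\<eta> j) (\<eta> k)) \<le> log_energy (\<eta> j) (\<eta> k)" if "j < r" "k < r" for j k
    using that admD[OF \<eta>] dist_le_L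
    by (subst log_energy_eq[OF d dL, where S="{lo..hi}" and S'="{lo..hi}"]) (auto intro: add_increasing2)
  have "tuple_energy d L r \<eta> = (\<Sum>j<r. kernel_form (trunc_log d L) (\<eta> j) (\<eta> j)) + (\<Sum>j<r. \<Sum>k\<in>{j<..<r}. kernel_form (trunc_log d L) (\<eta> j) (\<eta> k))"
    using admD(1)[OF \<eta>] by (subst tuple_energy_eq_sum[OF d(1) dL]) (auto intro!: sum_pairs_symmetric kernel_form_commute[OF k])
  then show ?thesis
    unfolding angelesco_energy_def using e
    by (simp add: sum_ereal[symmetric] plus_ereal.simps(1)[symmetric] del: sum_ereal plus_ereal.simps(1)) (intro add_mono sum_mono; simp)
qed

text \<open>Domination bounds the excess of each pair by \<open>C * (8 * d)\<close>, the masses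
  being at most 1; \<open>real r + real r * real r\<close> is a crude count of the pairs.\<close>

lemma energy_le_tuple_energy:
  assumes d: "0 < d" "d \<le> 1" and \<eta>: "adm \<eta>" and C: "0 \<le> C" "\<And>i. i < r \<Longrightarrow> dominated C (\<eta> i)"
  shows "angelesco_energy r \<eta> \<le> ereal (tuple_energy d L r \<eta> + (real r + real r * real r) * (C * (8 * d)))"
proof -
  have dL: "d \<le> L" using d L_gt_1 by simp
  note k = bdd_borel_trunc_log[OF d(1) dL]
  define e where "e = C * (8 * d)"
  have min_energy: "0 \<le> e" using C d by (simp add: e_def)
  have e: "log_energy (\<eta> j) (\<eta> k) \<le> ereal (kernel_form (trunc_log d L) (\<eta> j) (\<eta> k) + e)" if "j < r" "k < r" for j k
  proof -
    have "(\<integral>\<^sup>+x. \<integral>\<^sup>+y. log_excess d (x - y) \<partial>\<eta> k \<partial>\<eta> j) \<le> ennreal (mass (\<eta> j) * (C * (8 * d)))"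
      using that admD(1)[OF \<eta>] C d by (intro nn_integral_log_excess_dominated) auto
    also have "\<dots> \<le> ennreal e"
      unfolding e_def[symmetric] using admD(3)[OF \<eta> that(1)] s_le_1[OF that(1)] min_energy
      by (intro ennreal_leI) (simp add: mult_left_le_one_le less_imp_le[OF spos[OF that(1)]])
    finally have "enn2ereal (\<integral>\<^sup>+x. \<integral>\<^sup>+y. log_excess d (x - y) \<partial>\<eta> k \<partial>\<eta> j) \<le> enn2ereal (ennreal e)"
      by (simp add: less_eq_ennreal.rep_eq)
    then have "enn2ereal (\<integral>\<^sup>+x. \<integral>\<^sup>+y. log_excess d (x - y) \<partial>\<eta> k \<partial>\<eta> j) \<le> ereal e" using min_energy by (simp add: enn2ereal_ennreal)
    then have "ereal (kernel_form (trunc_log d L) (\<eta> j) (\<eta> k)) + enn2ereal (\<integral>\<^sup>+x. \<integral>\<^sup>+y. log_excess d (x - y) \<partial>\<eta> k \<partial>\<eta> j)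
      \<le> ereal (kernel_form (trunc_log d L) (\<eta> j) (\<eta> k)) + ereal e" by (intro add_left_mono)
    then show ?thesis
      using that admD[OF \<eta>] dist_le_L
      by (subst log_energy_eq[OF d dL, where S="{lo..hi}" and S'="{lo..hi}"]) auto
  qed
  have tuple_energy: "tuple_energy d L r \<eta> = (\<Sum>j<r. kernel_form (trunc_log d L) (\<eta> j) (\<eta> j)) + (\<Sum>j<r. \<Sum>k\<in>{j<..<r}. kernel_form (trunc_log d L) (\<eta> j) (\<eta> k))"
    using admD(1)[OF \<eta>] by (subst tuple_energy_eq_sum[OF d(1) dL]) (auto intro!: sum_pairs_symmetric kernel_form_commute[OF k])
  have "angelesco_energy r \<eta> \<le> (\<Sum>j<r. ereal (kernel_form (trunc_log d L) (\<eta> j) (\<eta> j) + e))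
      + (\<Sum>j<r. \<Sum>k\<in>{j<..<r}. ereal (kernel_form (trunc_log d L) (\<eta> j) (\<eta> k) + e))"
    unfolding angelesco_energy_def using e by (intro add_mono sum_mono) auto
  also have "\<dots> = ereal (tuple_energy d L r \<eta> + (real r * e + (\<Sum>j<r. real (card {j<..<r}) * e)))"
    by (simp add: tuple_energy sum.distrib)
  also have "\<dots> \<le> ereal (tuple_energy d L r \<eta> + (real r * e + (\<Sum>j<r. real r * e)))"
  proof -
    have "real (card {j<..<r}) * e \<le> real r * e" for j using min_energy by (intro mult_right_mono) auto
    then have "(\<Sum>j<r. real (card {j<..<r}) * e) \<le> (\<Sum>j<r. real r * e)" by (intro sum_mono)
    then show ?thesis by (simp del: card_greaterThanLessThan)
  qed
  finally show ?thesis by (simp add: e_def algebra_simps)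
qed

section \<open>Contraction of all intervals towards their midpoints\<close>

definition "\<Lambda> = 1 + (hi - lo) / Min (insert 1 {a j - b i | i j. i < r \<and> j < r \<and> b i < a j})"

text \<open>\<open>\<gamma>\<close> is the smallest gap between two intervals, capped at 1;
  inserting 1 keeps the minimum defined when there is only one interval. It is the denominator in
  \<open>\<Lambda>\<close>.\<close>

lemma gap:
  defines "\<gamma> \<equiv> Min (insert 1 {a j - b i | i j. i < r \<and> j < r \<and> b i < a j})"
  shows "0 < \<gamma>" and "\<lbrakk>i < r; j < r; i \<noteq> j; x \<in> {a i..b i}; y \<in> {a j..b j}\<rbrakk> \<Longrightarrow> \<gamma> \<le> \<bar>x - y\<bar>"
proof -
  have "{a j - b i | i j. i < r \<and> j < r \<and> b i < a j} \<subseteq> (\<lambda>(i, j). a j - b i) ` ({..<r} \<times> {..<r})" by auto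
  then have fin: "finite {a j - b i | i j. i < r \<and> j < r \<and> b i < a j}" by (rule finite_subset) auto
  show "0 < \<gamma>" unfolding \<gamma>_def using fin by (subst Min_gr_iff) auto
  have le: "\<gamma> \<le> a j - b i" if "i < r" "j < r" "b i < a j" for i j
    unfolding \<gamma>_def using that fin by (intro Min_le) auto
  assume h: "i < r" "j < r" "i \<noteq> j" "x \<in> {a i..b i}" "y \<in> {a j..b j}"
  have "b i < a j \<or> b j < a i"
  proof (rule ccontr)
    assume "\<not> (b i < a j \<or> b j < a i)"
    then have "max (a i) (a j) \<in> {a i..b i} \<inter> {a j..b j}" using ab[OF h(1)] ab[OF h(2)] by auto
    then show False using disj[OF h(1,2,3)] by auto
  qed
  then show "\<gamma> \<le> \<bar>x - y\<bar>" using le[OF h(1,2)] le[OF h(2,1)] h(4,5) by auto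
qed

lemma \<Lambda>_ge_1: "1 \<le> \<Lambda>"
  unfolding \<Lambda>_def using gap(1) lo_less_hi by simp

text \<open>Displacement from the midpoint of the interval that contains \<open>x\<close>;
  disjointness makes at most one summand nonzero.\<close>

definition ctr :: "real \<Rightarrow> real" where
  "ctr x = (\<Sum>i<r. indicator {a i..b i} x * (x - (a i + b i) / 2))"

lemma ctr_measurable [measurable]: "ctr \<in> borel_measurable borel"
  unfolding ctr_def[abs_def] by measurable

lemma ctr_eq:
  assumes "i < r" "x \<in> {a i..b i}"
  shows "ctr x = x - (a i + b i) / 2"
proof -
  have "ctr x = (\<Sum>j<r. if j = i then x - (a i + b i) / 2 else 0)"
    unfolding ctr_def
  proof (intro sum.cong refl)
    fix j assume "j \<in> {..<r}"
    then have "j = i \<or> x \<notin> {a j..b j}" using disj[of j i] assms by blast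
    then show "indicator {a j..b j} x * (x - (a j + b j) / 2) = (if j = i then x - (a i + b i) / 2 else 0)"
      using assms by (auto simp: indicator_def)
  qed
  then show ?thesis using assms by simp
qed

text \<open>Within one interval the slope is 1. Between different intervals \<open>ctr\<close>
  varies by at most \<open>hi - lo\<close>, while the distance is at least \<open>\<gamma>\<close>;
  \<open>\<Lambda>\<close> covers both cases.\<close>

lemma ctr_lipschitz:
  assumes "x \<in> (\<Union>i<r. {a i..b i})" "y \<in> (\<Union>i<r. {a i..b i})"
  shows "\<bar>ctr x - ctr y\<bar> \<le> \<Lambda> * \<bar>x - y\<bar>"
proof -
  obtain i j where i: "i < r" "x \<in> {a i..b i}" and j: "j < r" "y \<in> {a j..b j}" using assms by auto
  define \<gamma> where "\<gamma> = Min (insert 1 {a j - b i | i j. i < r \<and> j < r \<and> b i < a j})"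
  have g: "0 < \<gamma>" using gap(1) by (simp add: \<gamma>_def)
  show ?thesis
  proof (cases "i = j")
    case True
    then have "\<bar>ctr x - ctr y\<bar> = 1 * \<bar>x - y\<bar>" using ctr_eq[OF i] ctr_eq[OF j] by simp
    also have "\<dots> \<le> \<Lambda> * \<bar>x - y\<bar>" using \<Lambda>_ge_1 by (intro mult_right_mono) auto
    finally show ?thesis .
  next
    case False
    then have gle: "\<gamma> \<le> \<bar>x - y\<bar>" unfolding \<gamma>_def using gap(2)[OF i(1) j(1) _ i(2) j(2)] by simp
    have "\<bar>ctr x\<bar> \<le> (hi - lo) / 2" "\<bar>ctr y\<bar> \<le> (hi - lo) / 2"
      using ctr_eq[OF i] ctr_eq[OF j] i j lo_hi[OF i(1)] lo_hi[OF j(1)] by (auto simp: abs_le_iff field_simps)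
    then have "\<bar>ctr x - ctr y\<bar> \<le> hi - lo"
      using abs_triangle_ineq4[of "ctr x" "ctr y"] by argo
    then have "\<bar>ctr x - ctr y\<bar> \<le> (hi - lo) / \<gamma> * \<gamma>" using g by simp
    also have "\<dots> \<le> \<Lambda> * \<bar>x - y\<bar>"
      unfolding \<Lambda>_def \<gamma>_def[symmetric] using g gle lo_less_hi by (intro mult_mono) auto
    finally show ?thesis .
  qed
qed

text \<open>Moves each point by the fraction \<open>c\<close> towards the midpoint of its own
  interval, which leaves room at the endpoints for a convolution. A single map serves all
  components, so it can be applied to the total measure as well.\<close>

definition shrink :: "real \<Rightarrow> real \<Rightarrow> real" where "shrink c x = x - c * ctr x"

lemma shrink_measurable [measurable]: "shrink c \<in> borel_measurable borel"
  unfolding shrink_def[abs_def] by measurable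

text \<open>The kernel decreases with distance, so a lower bound on distances is what the energy
  estimate needs; the factor plays the part of \<open>q\<close> in
  \<open>trunc_log_scale\<close>.\<close>

lemma shrink_bilip:
  fixes x y c :: real
  assumes c: "0 \<le> c" and xy: "x \<in> (\<Union>i<r. {a i..b i})" "y \<in> (\<Union>i<r. {a i..b i})"
  shows "(1 - c * \<Lambda>) * \<bar>x - y\<bar> \<le> \<bar>shrink c x - shrink c y\<bar>"
proof -
  have "\<bar>c * (ctr x - ctr y)\<bar> \<le> c * (\<Lambda> * \<bar>x - y\<bar>)"
    unfolding abs_mult abs_of_nonneg[OF c] by (rule mult_left_mono[OF ctr_lipschitz[OF xy] c])
  moreover have "(1 - c * \<Lambda>) * \<bar>x - y\<bar> = \<bar>x - y\<bar> - c * (\<Lambda> * \<bar>x - y\<bar>)"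
    unfolding left_diff_distrib mult.assoc by (rule arg_cong2[where f="(-)"]) (rule mult_1_left refl)+
  ultimately have "(1 - c * \<Lambda>) * \<bar>x - y\<bar> \<le> \<bar>x - y\<bar> - \<bar>c * (ctr x - ctr y)\<bar>"
    by (metis diff_left_mono)
  also have "\<dots> \<le> \<bar>(x - y) - c * (ctr x - ctr y)\<bar>" by (rule abs_triangle_ineq2)
  also have "(x - y) - c * (ctr x - ctr y) = shrink c x - shrink c y" by (simp add: shrink_def right_diff_distrib)
  finally show ?thesis .
qed

lemma shrink_in:
  assumes c: "c \<le> 1" "0 \<le> c" and i: "i < r" and x: "x \<in> {a i..b i}" and h: "h \<le> c * ((b i - a i) / 2)"
  shows "shrink c x \<in> {a i + h..b i - h}"
proof -
  have e: "shrink c x = x - c * (x - (a i + b i) / 2)"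
    unfolding shrink_def ctr_eq[OF i x] ..
  have "0 \<le> (1 - c) * (x - a i)" "0 \<le> (1 - c) * (b i - x)" using x c by auto
  moreover have "x - c * (x - (a i + b i) / 2) - a i - c * ((b i - a i) / 2) = (1 - c) * (x - a i)"
    "b i - c * ((b i - a i) / 2) - (x - c * (x - (a i + b i) / 2)) = (1 - c) * (b i - x)"
    by (simp_all add: field_simps)
  ultimately have "0 \<le> shrink c x - a i - c * ((b i - a i) / 2)" "0 \<le> b i - c * ((b i - a i) / 2) - shrink c x"
    unfolding e by metis+
  then show ?thesis using h unfolding atLeastAtMost_iff by argo
qed

section \<open>Convolution with uniform measures\<close>

definition unif :: "real \<Rightarrow> real measure" where "unif h = uniform_measure lborel {- h..h}"

lemma unif:
  assumes "0 < h"
  shows "fin_borel (unif h)" "mass (unif h) = 1" "AE t in unif h. \<bar>t\<bar> \<le> h"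
    "\<And>A. A \<in> sets borel \<Longrightarrow> emeasure (unif h) A \<le> ennreal (1 / (2 * h)) * emeasure lborel A"
proof -
  have e: "emeasure lborel {- h..h} = ennreal (2 * h)" using assms by simp
  interpret prob_space "unif h" unfolding unif_def
    by (rule prob_space_uniform_measure) (use assms in \<open>simp_all add: e\<close>)
  show f: "fin_borel (unif h)" unfolding fin_borel_def using finite_measure_axioms by (simp add: unif_def)
  show "mass (unif h) = 1" using prob_space fin_borelD(2)[OF f] by (simp add: mass_def)
  show "AE t in unif h. \<bar>t\<bar> \<le> h"
    unfolding unif_def by (rule AE_uniform_measureI) (auto simp: abs_le_iff)
  fix A :: "real set" assume A: "A \<in> sets borel"
  have "emeasure (unif h) A = emeasure lborel ({- h..h} \<inter> A) / ennreal (2 * h)"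
    unfolding unif_def using A by (subst emeasure_uniform_measure) (auto simp: e)
  also have "\<dots> \<le> emeasure lborel A / ennreal (2 * h)"
    using A by (intro divide_right_mono_ennreal emeasure_mono) auto
  also have "\<dots> = ennreal (1 / (2 * h)) * emeasure lborel A"
  proof -
    have "inverse (ennreal (2 * h)) = ennreal (1 / (2 * h))"
      using assms by (subst inverse_ennreal) (auto simp: inverse_eq_divide)
    then show ?thesis unfolding divide_ennreal_def by (metis mult.commute)
  qed
  finally show "emeasure (unif h) A \<le> ennreal (1 / (2 * h)) * emeasure lborel A" .
qed

text \<open>The uniform law has density at most \<open>1 / (2 * h)\<close>, and averaging its
  translates over a measure of mass at most 1 keeps this bound.\<close>

lemma dominated_convolution:
  assumes M: "fin_borel M" and m: "mass M \<le> 1" and h: "0 < h"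
  shows "dominated (1 / (2 * h)) (convolution M (unif h))"
  unfolding dominated_def
proof
  fix A :: "real set" assume A: "A \<in> sets borel"
  note u = unif[OF h]
  have "emeasure (convolution M (unif h)) A = (\<integral>\<^sup>+x. emeasure (unif h) {t. t + x \<in> A} \<partial>M)"
    using A M u(1) by (intro convolution_emeasure) (auto dest: fin_borelD)
  also have "\<dots> \<le> (\<integral>\<^sup>+x. ennreal (1 / (2 * h)) * emeasure lborel A \<partial>M)"
  proof (rule nn_integral_mono)
    fix x
    have "(\<lambda>t. t + x) -` A \<inter> space borel \<in> sets borel" using A by (intro measurable_sets[where A=borel]) auto
    then have B: "{t. t + x \<in> A} \<in> sets borel" by (simp add: vimage_def)
    have "emeasure lborel {t. t + x \<in> A} = emeasure (distr lborel borel (\<lambda>t. x + t)) A"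
      using A by (subst emeasure_distr) (auto simp: vimage_def add.commute)
    also have "\<dots> = emeasure lborel A" by (simp add: lborel_distr_plus)
    finally show "emeasure (unif h) {t. t + x \<in> A} \<le> ennreal (1 / (2 * h)) * emeasure lborel A"
      using u(4)[OF B] by simp
  qed
  also have "\<dots> = ennreal (1 / (2 * h)) * emeasure lborel A * ennreal (mass M)"
    using mass_eq_emeasure[OF M] fin_borelD(2)[OF M] by simp
  also have "\<dots> \<le> ennreal (1 / (2 * h)) * emeasure lborel A * 1"
    using m by (intro mult_left_mono) (auto simp: ennreal_le_1)
  finally show "emeasure (convolution M (unif h)) A \<le> ennreal (1 / (2 * h)) * emeasure lborel A" by simp
qed

lemma AE_convolution:
  assumes M: "fin_borel M" and V: "fin_borel V" and S: "S \<in> sets borel"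
    and "AE x in M. AE t in V. x + t \<in> S"
  shows "AE x in convolution M V. x \<in> S"
proof -
  have "emeasure (convolution M V) (- S) = (\<integral>\<^sup>+x. \<integral>\<^sup>+t. indicator (- S) (x + t) \<partial>V \<partial>M)"
    using M V S by (intro convolution_emeasure') (auto dest: fin_borelD)
  also have "\<dots> = (\<integral>\<^sup>+x. 0 \<partial>M)"
  proof (rule nn_integral_cong_AE)
    show "AE x in M. (\<integral>\<^sup>+t. indicator (- S) (x + t) \<partial>V) = 0"
      using assms(4)
    proof eventually_elim
      case (elim x)
      have "(\<integral>\<^sup>+t. indicator (- S) (x + t) \<partial>V) = (\<integral>\<^sup>+t. 0 \<partial>V)"
        by (rule nn_integral_cong_AE) (use elim in \<open>auto elim!: eventually_mono\<close>)
      then show ?case by simp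
    qed
  qed
  finally show ?thesis using S by (intro AE_I[where N="- S"]) auto
qed

text \<open>This uniformity replaces compactness: \<open>C\<close> and \<open>d0\<close> depend on
  the intervals and on \<open>\<epsilon>\<close>, but not on \<open>\<eta>\<close> or
  \<open>d\<close>. Shrinking costs \<open>\<epsilon> / 2\<close>, convolution costs nothing by
  averaging over translations, and undoing the truncation costs \<open>\<epsilon> / 2\<close>
  because the convolved measures have bounded density.\<close>

lemma smoothing:
  assumes \<epsilon>: "0 < \<epsilon>"
  obtains C d0 where "0 < C" "0 < d0" "d0 \<le> 1"
    "\<And>d \<eta>. \<lbrakk>0 < d; d \<le> d0; adm \<eta>\<rbrakk> \<Longrightarrow> \<exists>\<eta>'. adm \<eta>' \<and> (\<forall>i<r. dominated C (\<eta>' i))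
       \<and> angelesco_energy r \<eta>' \<le> ereal (tuple_energy d L r \<eta> + \<epsilon>)"
proof -
  \<comment> \<open>Chosen so that \<open>1 - c * \<Lambda> = exp (- (\<epsilon> / 2))\<close>,
    whose negative logarithm is the loss allowed to the shrinking.\<close>
  define c where "c = (1 - exp (- (\<epsilon> / 2))) / \<Lambda>"
  define q where "q = exp (- (\<epsilon> / 2))"
  have q: "q = 1 - c * \<Lambda>" "0 < q" "q \<le> 1" using \<Lambda>_ge_1 \<epsilon> by (auto simp: c_def q_def)
  have c: "0 < c" "c \<le> 1"
  proof -
    have "0 < \<Lambda>" "0 < 1 - exp (- (\<epsilon> / 2))" using \<Lambda>_ge_1 \<epsilon> by auto
    then show "0 < c" by (simp add: c_def)
    have "1 - exp (- (\<epsilon> / 2)) \<le> 1 * \<Lambda>" using \<Lambda>_ge_1 exp_gt_zero[of "- (\<epsilon> / 2)"] by linarith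
    then show "c \<le> 1" unfolding c_def using \<open>0 < \<Lambda>\<close> by (simp only: pos_divide_le_eq)
  qed
  \<comment> \<open>Every shrunk interval keeps a margin of at least \<open>h\<close> on both sides,
    so a translation by at most \<open>h\<close> stays inside.\<close>
  define h where "h = c * Min ((\<lambda>i. (b i - a i) / 2) ` {..<r})"
  have h: "0 < h" unfolding h_def
  proof (intro mult_pos_pos c)
    have "{..<r} \<noteq> {}" using r_pos by auto
    then show "0 < Min ((\<lambda>i. (b i - a i) / 2) ` {..<r})" using ab by (subst Min_gr_iff) auto
  qed
  have hle: "h \<le> c * ((b i - a i) / 2)" if "i < r" for i
    unfolding h_def using c that by (intro mult_left_mono Min_le) auto
  define C where "C = 1 / (2 * h)"
  have C: "0 < C" using h by (simp add: C_def)
  \<comment> \<open>Makes the total excess from \<open>energy_le_tuple_energy\<close> at most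
    \<open>\<epsilon> / 2\<close>; \<open>C\<close> is already fixed at this point.\<close>
  define d0 where "d0 = min 1 (\<epsilon> / 2 / ((real r + real r * real r) * (C * 8)))"
  have d0: "0 < d0" "d0 \<le> 1" using r_pos C \<epsilon> by (auto simp: d0_def add_pos_pos)
  define \<phi> where "\<phi> = shrink c"
  have \<phi>m [measurable]: "\<phi> \<in> borel_measurable borel" unfolding \<phi>_def by measurable
  show ?thesis
  proof (rule that[OF C d0])
    fix d \<eta> assume d: "0 < d" "d \<le> d0" and \<eta>: "adm \<eta>"
    have d1: "d \<le> 1" "d \<le> L" using d d0 L_gt_1 by auto
    note k = bdd_borel_trunc_log[OF d(1) d1(2)]
    note \<eta>D = admD[OF \<eta>]
    define \<xi> where "\<xi> = (\<lambda>i. distr (\<eta> i) borel \<phi>)"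
    have \<xi>: "fin_borel (\<xi> i)" "mass (\<xi> i) = s i" if "i < r" for i
      using \<eta>D[OF that] by (auto simp: \<xi>_def mass_distr intro: fin_borel_distr)
    have le: "kernel_form (trunc_log d L) (distr M borel \<phi>) (distr M borel \<phi>) \<le> kernel_form (trunc_log d L) M M + \<epsilon> / 2 * mass M"
      if M: "fin_borel M" "mass M \<le> 1" and ae: "AE x in M. x \<in> (\<Union>i<r. {a i..b i})" for M
    proof -
      have "kernel_form (trunc_log d L) (distr M borel \<phi>) (distr M borel \<phi>) \<le> kernel_form (\<lambda>x. trunc_log d L x + \<epsilon> / 2) M M"
        unfolding kernel_form_distr[OF k M(1) M(1) \<phi>m \<phi>m]
      proof (rule kernel_form_mono_map[OF k bdd_borel_add[OF k bdd_borel_const] M(1) M(1) \<phi>m ae ae])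
        fix x y assume "x \<in> (\<Union>i<r. {a i..b i})" "y \<in> (\<Union>i<r. {a i..b i})"
        from trunc_log_scale[OF d(1) d1(2) q(2,3) shrink_bilip[OF less_imp_le[OF c(1)] this, folded q(1) \<phi>_def]]
        show "trunc_log d L (\<phi> x - \<phi> y) \<le> trunc_log d L (x - y) + \<epsilon> / 2" by (simp add: q_def)
      qed
      also have "\<dots> = kernel_form (trunc_log d L) M M + \<epsilon> / 2 * mass M * mass M"
        by (simp add: kernel_form_add[OF k bdd_borel_const M(1) M(1)] kernel_form_const[OF M(1) M(1)])
      \<comment> \<open>The squared mass is weakened to the mass, so that the losses of the
        components add up, with the masses \<open>s j\<close>, to the total mass 1.\<close>
      also have "\<dots> \<le> kernel_form (trunc_log d L) M M + \<epsilon> / 2 * mass M"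
        using \<epsilon> M(2) mass_nonneg[of M] by (simp add: mult_left_le)
      finally show ?thesis .
    qed
    have ms: "msum r \<xi> = distr (msum r \<eta>) borel \<phi>"
      using distr_msum[of r \<eta> \<phi>] \<eta>D(1) by (simp add: \<xi>_def)
    have self: "kernel_form (trunc_log d L) (\<xi> j) (\<xi> j) \<le> kernel_form (trunc_log d L) (\<eta> j) (\<eta> j) + \<epsilon> / 2 * s j" if j: "j < r" for j
    proof -
      have "AE x in \<eta> j. x \<in> (\<Union>i<r. {a i..b i})" by (rule eventually_mono[OF \<eta>D(2)[OF j]]) (use j in auto)
      then show ?thesis using le[of "\<eta> j"] \<eta>D[OF j] s_le_1[OF j] by (simp add: \<xi>_def)
    qed
    \<comment> \<open>Half of \<open>\<epsilon> / 2\<close> comes from the components, the other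
      half from their sum.\<close>
    have EK1: "tuple_energy d L r \<xi> \<le> tuple_energy d L r \<eta> + \<epsilon> / 2"
    proof -
      have "(\<Sum>j<r. kernel_form (trunc_log d L) (\<xi> j) (\<xi> j)) \<le> (\<Sum>j<r. kernel_form (trunc_log d L) (\<eta> j) (\<eta> j) + \<epsilon> / 2 * s j)"
        by (intro sum_mono self) auto
      also have "\<dots> = (\<Sum>j<r. kernel_form (trunc_log d L) (\<eta> j) (\<eta> j)) + \<epsilon> / 2"
        by (simp add: sum.distrib sum_distrib_left[symmetric] ssum sum_divide_distrib[symmetric])
      finally show ?thesis
        using le[of "msum r \<eta>"] msum_adm[OF \<eta>] by (simp add: tuple_energy_def ms)
    qed
    define \<eta>' where "\<eta>' = (\<lambda>i. convolution (\<xi> i) (unif h))"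
    have adm': "adm \<eta>'"
    proof (rule admI)
      fix i assume i: "i < r"
      show "fin_borel (\<eta>' i)" unfolding \<eta>'_def by (intro fin_borel_convolution \<xi> i unif h)
      show "mass (\<eta>' i) = s i" unfolding \<eta>'_def using \<xi>[OF i] unif[OF h] by (simp add: mass_convolution)
      show "AE x in \<eta>' i. x \<in> {a i..b i}" unfolding \<eta>'_def
      proof (rule AE_convolution)
        have "\<phi> x \<in> {a i + h..b i - h}" if "x \<in> {a i..b i}" for x
          unfolding \<phi>_def by (rule shrink_in[OF c(2) less_imp_le[OF c(1)] i that hle[OF i]])
        then have "AE x in \<eta> i. \<phi> x \<in> {a i + h..b i - h}" by (rule eventually_mono[OF \<eta>D(2)[OF i]])
        moreover have "\<phi> \<in> measurable (\<eta> i) borel"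
          using \<phi>m measurable_cong_sets[OF fin_borelD(1)[OF \<eta>D(1)[OF i]] refl] by blast
        ultimately have "AE x in \<xi> i. x \<in> {a i + h..b i - h}"
          unfolding \<xi>_def by (subst AE_distr_iff) auto
        then show "AE x in \<xi> i. AE t in unif h. x + t \<in> {a i..b i}"
        proof (rule eventually_mono)
          fix x assume x: "x \<in> {a i + h..b i - h}"
          show "AE t in unif h. x + t \<in> {a i..b i}" by (rule eventually_mono[OF unif(3)[OF h]]) (use x in auto)
        qed
      qed (use \<xi>[OF i] unif[OF h] in auto)
    qed
    have dom: "dominated C (\<eta>' i)" if "i < r" for i
      unfolding \<eta>'_def C_def using \<xi>[OF that] s_le_1[OF that] h by (intro dominated_convolution) auto
    have "angelesco_energy r \<eta>' \<le> ereal (tuple_energy d L r \<eta>' + (real r + real r * real r) * (C * (8 * d)))"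
      using d d1 C by (intro energy_le_tuple_energy adm' dom) auto
    also have "\<dots> \<le> ereal (tuple_energy d L r \<eta> + \<epsilon>)"
    proof -
      have "tuple_energy d L r \<eta>' \<le> tuple_energy d L r \<xi>"
        unfolding \<eta>'_def using \<xi> unif[OF h] d d1 by (intro tuple_energy_convolution_le) auto
      moreover have "(real r + real r * real r) * (C * (8 * d)) \<le> \<epsilon> / 2"
      proof -
        have "d \<le> \<epsilon> / 2 / ((real r + real r * real r) * (C * 8))" using d by (simp add: d0_def)
        moreover have "0 < (real r + real r * real r) * (C * 8)" using r_pos C by (simp add: add_pos_pos)
        ultimately have "d * ((real r + real r * real r) * (C * 8)) \<le> \<epsilon> / 2" by (simp only: pos_le_divide_eq)
        then show ?thesis by (simp only: mult_ac)
      qed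
      ultimately show ?thesis using EK1 by simp
    qed
    finally show "\<exists>\<eta>'. adm \<eta>' \<and> (\<forall>i<r. dominated C (\<eta>' i)) \<and> angelesco_energy r \<eta>' \<le> ereal (tuple_energy d L r \<eta> + \<epsilon>)"
      using adm' dom by blast
  qed
qed

end

subsection \<open>Test functions\<close>

text \<open>Integration by parts: \<open>f x\<close> is \<open>f hi\<close> minus the integral of
  \<open>f'\<close> over \<open>{x..hi}\<close>. The condition \<open>x \<le> t\<close> is written
  as membership of \<open>x\<close> in the window \<open>{t - L<..t}\<close>, whose lower end lies
  below \<open>lo\<close>, so that the same window masses occur as in the triangle kernel of width
  \<open>L\<close>.\<close>

lemma integral_test_function:
  fixes f f' :: "real \<Rightarrow> real"
  assumes M: "fin_borel M" and ae: "AE x in M. x \<in> {lo..hi}" and lohi: "lo < hi" and L: "hi - lo < L"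
    and f: "\<And>x. (f has_real_derivative f' x) (at x)" and f': "continuous_on UNIV f'"
  shows "integrable lborel (\<lambda>t. indicator {lo..hi} t * f' t * measure M {t - L<..t})"
    and "(\<integral>x. f x \<partial>M) = f hi * mass M - (\<integral>t. indicator {lo..hi} t * f' t * measure M {t - L<..t} \<partial>lborel)"
proof -
  interpret M: finite_measure M using M by (rule fin_borelD)
  interpret Q: pair_sigma_finite M "lborel :: real measure" by unfold_locales
  have [measurable_cong]: "sets M = sets borel" using M by (rule fin_borelD)
  have [measurable]: "f' \<in> borel_measurable borel" using f' by (rule borel_measurable_continuous_onI)
  have "compact (f' ` {lo..hi})" using f' by (intro compact_continuous_image continuous_on_subset[OF f']) auto
  then have "bounded (f' ` {lo..hi})" by (rule compact_imp_bounded)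
  then obtain B where "\<forall>y\<in>f' ` {lo..hi}. norm y \<le> B" unfolding bounded_iff by blast
  then have B: "\<And>t. t \<in> {lo..hi} \<Longrightarrow> \<bar>f' t\<bar> \<le> B" by auto
  let ?h = "\<lambda>x t. indicator {lo..hi} t * f' t * (if t - L < x \<and> x \<le> t then 1 else 0 :: real)"
  have int: "integrable (M \<Otimes>\<^sub>M lborel) (\<lambda>(x, t). ?h x t)"
  proof (rule Bochner_Integration.integrable_bound)
    have "emeasure (M \<Otimes>\<^sub>M lborel) (space M \<times> {lo..hi}) < \<infinity>"
      using lohi M.finite_emeasure_space
      by (subst lborel.emeasure_pair_measure_Times) (auto simp: ennreal_mult_eq_top_iff less_top[symmetric] simp del: M.emeasure_finite)
    then show "integrable (M \<Otimes>\<^sub>M lborel) (\<lambda>z. indicator (space M \<times> {lo..hi}) z * B)"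
      by (intro integrable_mult_left integrable_real_indicator) auto
    show "AE z in M \<Otimes>\<^sub>M lborel. norm (case z of (x, t) \<Rightarrow> ?h x t) \<le> norm (indicator (space M \<times> {lo..hi}) z * B)"
      by (rule AE_I2) (use B in \<open>force simp: indicator_def space_pair_measure split: prod.splits\<close>)
  qed measurable
  have inner: "(\<integral>x. ?h x t \<partial>M) = indicator {lo..hi} t * f' t * measure M {t - L<..t}" for t
  proof -
    have "(\<integral>x. ?h x t \<partial>M) = (\<integral>x. indicator {lo..hi} t * f' t * indicator {t - L<..t} x \<partial>M)"
      by (intro Bochner_Integration.integral_cong) (auto simp: indicator_def)
    then show ?thesis using fin_borelD(2)[OF M] by simp
  qed
  show "integrable lborel (\<lambda>t. indicator {lo..hi} t * f' t * measure M {t - L<..t})"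
    using Q.integrable_snd[OF int] by (simp only: inner)
  have ftc: "f x = f hi - (\<integral>t. ?h x t \<partial>lborel)" if x: "x \<in> {lo..hi}" for x
  proof -
    have "(\<integral>t. ?h x t \<partial>lborel) = (\<integral>t. f' t * indicator {x..hi} t \<partial>lborel)"
      using x L by (intro Bochner_Integration.integral_cong) (auto simp: indicator_def)
    also have "\<dots> = f hi - f x"
      using x f' f by (intro integral_FTC_Icc_real) (auto simp: continuous_on_eq_continuous_at)
    finally show ?thesis by simp
  qed
  have "f \<in> borel_measurable borel"
    using f by (intro borel_measurable_continuous_onI) (meson DERIV_isCont continuous_at_imp_continuous_on)
  then have fm: "f \<in> borel_measurable M" by measurable
  have i1: "integrable M (\<lambda>x. \<integral>t. ?h x t \<partial>lborel)" using Q.integrable_fst[OF int] by simp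
  have "(\<integral>x. f x \<partial>M) = (\<integral>x. f hi - (\<integral>t. ?h x t \<partial>lborel) \<partial>M)"
  proof (rule integral_cong_AE[OF fm])
    show "(\<lambda>x. f hi - (\<integral>t. ?h x t \<partial>lborel)) \<in> borel_measurable M"
      by (rule borel_measurable_diff[OF borel_measurable_const borel_measurable_integrable[OF i1]])
    show "AE x in M. f x = f hi - (\<integral>t. ?h x t \<partial>lborel)" by (rule eventually_mono[OF ae]) (rule ftc)
  qed
  also have "\<dots> = (\<integral>x. f hi \<partial>M) - (\<integral>x. (\<integral>t. ?h x t \<partial>lborel) \<partial>M)"
    by (intro Bochner_Integration.integral_diff i1 M.integrable_const)
  also have "(\<integral>x. (\<integral>t. ?h x t \<partial>lborel) \<partial>M) = (\<integral>t. indicator {lo..hi} t * f' t * measure M {t - L<..t} \<partial>lborel)"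
    using Q.Fubini_integral[OF int] by (simp only: inner)
  finally show "(\<integral>x. f x \<partial>M) = f hi * mass M - (\<integral>t. indicator {lo..hi} t * f' t * measure M {t - L<..t} \<partial>lborel)"
    by (simp only: integral_const_mass[OF M])
qed

text \<open>Both terms are governed by the difference \<open>?\<sigma>\<close> of the window masses:
  the kernel distance dominates its squared norm divided by \<open>L\<close>, and the test function
  pairs it with \<open>f'\<close>. Completing the square gives the inequality.\<close>

lemma kernel_dist_test_function:
  fixes f f' :: "real \<Rightarrow> real"
  assumes d: "0 < d" "d \<le> L" and M: "fin_borel M" "AE x in M. x \<in> {lo..hi}" and N: "fin_borel N" "AE x in N. x \<in> {lo..hi}"
    and eq: "mass M = mass N" and lohi: "lo < hi" and L: "hi - lo < L"
    and f: "\<And>x. (f has_real_derivative f' x) (at x)" and f': "continuous_on UNIV f'"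
  shows "- (\<tau>\<^sup>2 * (L * (\<integral>t. indicator {lo..hi} t * (f' t)\<^sup>2 \<partial>lborel))) \<le> kernel_dist (trunc_log d L) M N / 4 - \<tau> * ((\<integral>x. f x \<partial>N) - (\<integral>x. f x \<partial>M))"
proof -
  have Lp: "0 < L" using d by simp
  let ?i = "\<lambda>t. indicator {lo..hi} t :: real"
  let ?\<sigma> = "\<lambda>t. measure N {t - L<..t} - measure M {t - L<..t}"
  note tM = integral_test_function[OF M lohi L f f']
  note tN = integral_test_function[OF N lohi L f f']
  have i1: "integrable lborel (\<lambda>t. ?i t * f' t * ?\<sigma> t)"
    using Bochner_Integration.integrable_diff[OF tN(1) tM(1)] by (simp only: right_diff_distrib)
  have diff: "(\<integral>x. f x \<partial>N) - (\<integral>x. f x \<partial>M) = - (\<integral>t. ?i t * f' t * ?\<sigma> t \<partial>lborel)"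
    using Bochner_Integration.integral_diff[OF tN(1) tM(1)] tM(2) tN(2) eq by (simp add: right_diff_distrib)
  have sq: "integrable lborel (\<lambda>u. (measure M {u<..u + L} - measure N {u<..u + L})\<^sup>2)" by (rule kernel_dist_triangle(1)[OF Lp M(1) N(1)])
  \<comment> \<open>The triangle kernel indexes windows by their left end, the test function by
    their right end; the shift by \<open>- L\<close> identifies them.\<close>
  have e: "(measure M {- L + 1 * t<..- L + 1 * t + L} - measure N {- L + 1 * t<..- L + 1 * t + L})\<^sup>2 = (?\<sigma> t)\<^sup>2" for t
    by (simp add: power2_commute)
  have i2: "integrable lborel (\<lambda>t. (?\<sigma> t)\<^sup>2)"
    using lborel_integrable_real_affine[OF sq, of 1 "- L"] unfolding e by simp
  have "(\<integral>u. (measure M {u<..u + L} - measure N {u<..u + L})\<^sup>2 \<partial>lborel) = (\<integral>t. (?\<sigma> t)\<^sup>2 \<partial>lborel)"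
    using lborel_integral_real_affine[of 1 "\<lambda>u. (measure M {u<..u + L} - measure N {u<..u + L})\<^sup>2" "- L"] unfolding e by simp
  then have DT: "kernel_dist (triangle L) M N = (\<integral>t. (?\<sigma> t)\<^sup>2 \<partial>lborel) / L" by (simp only: kernel_dist_triangle(2)[OF Lp M(1) N(1)])
  have i3: "integrable lborel (\<lambda>t. ?i t * (?\<sigma> t)\<^sup>2)"
    using integrable_mult_indicator[OF _ i2, of "{lo..hi}"] by simp
  have "continuous_on {lo..hi} (\<lambda>t. (f' t)\<^sup>2)" by (intro continuous_intros continuous_on_subset[OF f']) auto
  then have i4: "integrable lborel (\<lambda>t. ?i t * (f' t)\<^sup>2)"
    using borel_integrable_atLeastAtMost'[of lo hi "\<lambda>t. (f' t)\<^sup>2"] by (simp add: set_integrable_def)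
  \<comment> \<open>The scaling of the square gives the coefficients \<open>1 / (4 * L)\<close>,
    \<open>\<tau>\<close> and \<open>\<tau>\<^sup>2 * L\<close>; the first produces the factor 1/4
    of the kernel distance.\<close>
  have "0 \<le> (\<integral>t. L * (?i t * (?\<sigma> t / (2 * L) + \<tau> * f' t)\<^sup>2) \<partial>lborel)"
    using Lp by (intro integral_nonneg_AE AE_I2) auto
  also have "\<dots> = (\<integral>t. (1 / (4 * L)) * (?i t * (?\<sigma> t)\<^sup>2) + \<tau> * (?i t * f' t * ?\<sigma> t) + (\<tau>\<^sup>2 * L) * (?i t * (f' t)\<^sup>2) \<partial>lborel)"
    using Lp by (intro Bochner_Integration.integral_cong refl) (simp add: power2_eq_square field_simps)
  also have "\<dots> = (1 / (4 * L)) * (\<integral>t. ?i t * (?\<sigma> t)\<^sup>2 \<partial>lborel) + \<tau> * (\<integral>t. ?i t * f' t * ?\<sigma> t \<partial>lborel)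
      + (\<tau>\<^sup>2 * L) * (\<integral>t. ?i t * (f' t)\<^sup>2 \<partial>lborel)"
    by (subst Bochner_Integration.integral_add, (intro Bochner_Integration.integrable_add integrable_mult_right i1 i3 i4)+)
      (subst Bochner_Integration.integral_add, (intro integrable_mult_right i1 i3 i4)+, simp only: integral_mult_right_zero)
  also have "(1 / (4 * L)) * (\<integral>t. ?i t * (?\<sigma> t)\<^sup>2 \<partial>lborel) \<le> (1 / (4 * L)) * (\<integral>t. (?\<sigma> t)\<^sup>2 \<partial>lborel)"
    using Lp i2 i3 by (intro mult_left_mono integral_mono) (auto simp: indicator_def)
  also have "\<dots> = kernel_dist (triangle L) M N / 4" using Lp by (simp add: DT)
  also have "\<dots> \<le> kernel_dist (trunc_log d L) M N / 4" using kernel_dist_trunc_log_ge[OF d M(1) N(1) eq] by simp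
  finally show ?thesis unfolding diff by (simp add: mult.assoc)
qed

subsection \<open>Coercivity at the minimizer\<close>

locale minimizer = intervals +
  fixes \<omega> :: "nat \<Rightarrow> real measure"
  assumes omega: "energy_minimizer r a b s \<omega>"
begin

lemma adm_omega: "adm \<omega>" using omega by (simp add: energy_minimizer_def)

lemma energy_le: "adm \<eta> \<Longrightarrow> angelesco_energy r \<omega> \<le> angelesco_energy r \<eta>"
  using omega by (simp add: energy_minimizer_def)

definition "min_energy = real_of_ereal (angelesco_energy r \<omega>)"

text \<open>Bounded above by comparison with a smoothing of \<open>\<omega>\<close> itself, and
  below by its truncated energy.\<close>

lemma energy_omega: "angelesco_energy r \<omega> = ereal min_energy"
proof -
  have "(0::real) < 1" by simp
  from smoothing[OF this]
  obtain C d0 where d0: "0 < d0" "d0 \<le> 1"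
    and sm: "\<And>d \<eta>. \<lbrakk>0 < d; d \<le> d0; adm \<eta>\<rbrakk> \<Longrightarrow> \<exists>\<eta>'. adm \<eta>' \<and> (\<forall>i<r. dominated C (\<eta>' i))
       \<and> angelesco_energy r \<eta>' \<le> ereal (tuple_energy d L r \<eta> + 1)"
    by metis
  obtain \<eta>' where "adm \<eta>'" "angelesco_energy r \<eta>' \<le> ereal (tuple_energy d0 L r \<omega> + 1)"
    using sm[OF d0(1) order_refl adm_omega] by blast
  then have "angelesco_energy r \<omega> \<le> ereal (tuple_energy d0 L r \<omega> + 1)" using energy_le order_trans by blast
  moreover have "ereal (tuple_energy d0 L r \<omega>) \<le> angelesco_energy r \<omega>" by (rule energy_ge_tuple_energy[OF d0 adm_omega])
  ultimately show ?thesis unfolding min_energy_def by (cases "angelesco_energy r \<omega>") auto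
qed

lemma tuple_energy_omega_le: "0 < d \<Longrightarrow> d \<le> 1 \<Longrightarrow> tuple_energy d L r \<omega> \<le> min_energy"
  using energy_ge_tuple_energy[OF _ _ adm_omega, of d] by (simp add: energy_omega)

text \<open>Any tuple can be smoothed at the cost \<open>\<epsilon>\<close> and then competes with
  the minimizer. One \<open>d\<close> works for all tuples, which takes the place of lower
  semicontinuity of the energy.\<close>

lemma tuple_energy_ge:
  assumes "0 < \<epsilon>"
  obtains d where "0 < d" "d \<le> 1" "\<And>\<eta>. adm \<eta> \<Longrightarrow> min_energy - \<epsilon> \<le> tuple_energy d L r \<eta>"
proof -
  obtain C d0 where d0: "0 < d0" "d0 \<le> 1"
    and sm: "\<And>d \<eta>. \<lbrakk>0 < d; d \<le> d0; adm \<eta>\<rbrakk> \<Longrightarrow> \<exists>\<eta>'. adm \<eta>' \<and> (\<forall>i<r. dominated C (\<eta>' i))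
       \<and> angelesco_energy r \<eta>' \<le> ereal (tuple_energy d L r \<eta> + \<epsilon>)"
    using smoothing[OF assms] by metis
  have "min_energy - \<epsilon> \<le> tuple_energy d0 L r \<eta>" if \<eta>: "adm \<eta>" for \<eta>
  proof -
    obtain \<eta>' where "adm \<eta>'" "angelesco_energy r \<eta>' \<le> ereal (tuple_energy d0 L r \<eta> + \<epsilon>)"
      using sm[OF d0(1) order_refl \<eta>] by blast
    then have "ereal min_energy \<le> ereal (tuple_energy d0 L r \<eta> + \<epsilon>)" using energy_le order_trans energy_omega by metis
    then show ?thesis by simp
  qed
  then show ?thesis using that d0 by blast
qed

text \<open>The lower bound is applied at the midpoint of \<open>\<omega>\<close> and
  \<open>\<nu>\<close>. Multiplying by two turns \<open>\<epsilon>\<close> into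
  \<open>2 * \<epsilon>\<close> and the gain 1/8 into 1/4.\<close>

lemma tuple_energy_coercive:
  assumes d: "0 < d" "d \<le> 1" and ge: "\<And>\<eta>. adm \<eta> \<Longrightarrow> min_energy - \<epsilon> \<le> tuple_energy d L r \<eta>" and \<nu>: "adm \<nu>"
  shows "min_energy - 2 * \<epsilon> + kernel_dist (trunc_log d L) (msum r \<omega>) (msum r \<nu>) / 4 \<le> tuple_energy d L r \<nu>"
proof -
  have dL: "d \<le> L" using d L_gt_1 by simp
  have "tuple_energy d L r (\<lambda>i. mix (\<omega> i) (\<nu> i)) \<le> tuple_energy d L r \<omega> / 2 + tuple_energy d L r \<nu> / 2 - kernel_dist (trunc_log d L) (msum r \<omega>) (msum r \<nu>) / 8"
    using admD[OF adm_omega] admD[OF \<nu>] by (intro tuple_energy_mix_le d dL) auto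
  moreover have "min_energy - \<epsilon> \<le> tuple_energy d L r (\<lambda>i. mix (\<omega> i) (\<nu> i))" by (intro ge adm_mix adm_omega \<nu>)
  ultimately show ?thesis using tuple_energy_omega_le[OF d] by argo
qed

definition "slope_const f' = L * (\<integral>t. indicator {lo..hi} t * (f' t)\<^sup>2 \<partial>lborel)" for f' :: "real \<Rightarrow> real"

text \<open>The kernel distance gained by coercivity absorbs the linear term in \<open>f\<close> and
  leaves a loss quadratic in \<open>\<tau>\<close>.\<close>

lemma tuple_energy_test_function:
  assumes d: "0 < d" "d \<le> 1" and ge: "\<And>\<eta>. adm \<eta> \<Longrightarrow> min_energy - \<epsilon> \<le> tuple_energy d L r \<eta>" and \<nu>: "adm \<nu>"
    and f: "\<And>x. (f has_real_derivative f' x) (at x)" and f': "continuous_on UNIV f'"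
  shows "min_energy - 2 * \<epsilon> - \<tau>\<^sup>2 * slope_const f' \<le> tuple_energy d L r \<nu> - \<tau> * ((\<integral>x. f x \<partial>msum r \<nu>) - (\<integral>x. f x \<partial>msum r \<omega>))"
proof -
  have dL: "d \<le> L" using d L_gt_1 by simp
  have "- (\<tau>\<^sup>2 * slope_const f') \<le> kernel_dist (trunc_log d L) (msum r \<omega>) (msum r \<nu>) / 4 - \<tau> * ((\<integral>x. f x \<partial>msum r \<nu>) - (\<integral>x. f x \<partial>msum r \<omega>))"
    unfolding slope_const_def using msum_adm[OF adm_omega] msum_adm[OF \<nu>] lo_less_hi
    by (intro kernel_dist_test_function d dL f f') (auto simp: L_def)
  moreover have "min_energy - 2 * \<epsilon> + kernel_dist (trunc_log d L) (msum r \<omega>) (msum r \<nu>) / 4 \<le> tuple_energy d L r \<nu>"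
    by (rule tuple_energy_coercive[OF d _ \<nu>]) (rule ge)
  ultimately show ?thesis by argo
qed

end

subsection \<open>Configurations of points\<close>

definition coupling :: "nat \<Rightarrow> nat \<Rightarrow> real" where "coupling j k = (if j = k then 1 else 1 / 2)"

lemma coupling_bounds: "0 < coupling j k" "coupling j k \<le> 1" by (auto simp: coupling_def)

lemma coupling_commute: "coupling j k = coupling k j" by (auto simp: coupling_def)

text \<open>Each coordinate carries exactly one label, so the sums over labels collapse.\<close>

lemma sum_regroup:
  fixes c :: "nat \<Rightarrow> nat \<Rightarrow> real"
  assumes g: "\<And>m. m < n \<Longrightarrow> g m < r"
  shows "(\<Sum>j<r. \<Sum>k<r. c j k * (\<Sum>m<n. \<Sum>m'<n. (if g m = j then u m else 0) * ((if g m' = k then v m' else 0) * h m m')))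
    = (\<Sum>m<n. \<Sum>m'<n. c (g m) (g m') * (u m * (v m' * h m m')))"
proof -
  let ?F = "\<lambda>j k m m'. c j k * ((if g m = j then u m else 0) * ((if g m' = k then v m' else 0) * h m m'))"
  have "(\<Sum>j<r. \<Sum>k<r. c j k * (\<Sum>m<n. \<Sum>m'<n. (if g m = j then u m else 0) * ((if g m' = k then v m' else 0) * h m m')))
    = (\<Sum>j<r. \<Sum>k<r. \<Sum>m<n. \<Sum>m'<n. ?F j k m m')" by (simp only: sum_distrib_left)
  also have "\<dots> = (\<Sum>j<r. \<Sum>m<n. \<Sum>k<r. \<Sum>m'<n. ?F j k m m')" by (intro sum.cong refl sum.swap)
  also have "\<dots> = (\<Sum>m<n. \<Sum>j<r. \<Sum>k<r. \<Sum>m'<n. ?F j k m m')" by (rule sum.swap)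
  also have "\<dots> = (\<Sum>m<n. \<Sum>j<r. \<Sum>m'<n. \<Sum>k<r. ?F j k m m')" by (intro sum.cong refl sum.swap)
  also have "\<dots> = (\<Sum>m<n. \<Sum>m'<n. \<Sum>j<r. \<Sum>k<r. ?F j k m m')" by (intro sum.cong refl sum.swap)
  also have "\<dots> = (\<Sum>m<n. \<Sum>m'<n. c (g m) (g m') * (u m * (v m' * h m m')))"
  proof (intro sum.cong refl)
    fix m m' assume m: "m \<in> {..<n}" "m' \<in> {..<n}"
    have "(\<Sum>j<r. \<Sum>k<r. ?F j k m m') = (\<Sum>j<r. if g m = j then c j (g m') * (u m * (v m' * h m m')) else 0)"
    proof (intro sum.cong refl)
      fix j
      have "(\<Sum>k<r. ?F j k m m') = (\<Sum>k<r. if g m' = k then (if g m = j then c j k * (u m * (v m' * h m m')) else 0) else 0)"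
        by (intro sum.cong refl) auto
      then show "(\<Sum>k<r. ?F j k m m') = (if g m = j then c j (g m') * (u m * (v m' * h m m')) else 0)"
        using m g by (simp add: sum.delta)
    qed
    then show "(\<Sum>j<r. \<Sum>k<r. ?F j k m m') = c (g m) (g m') * (u m * (v m' * h m m'))"
      using m g by (simp add: sum.delta)
  qed
  finally show ?thesis .
qed

lemma fin_borel_return: "fin_borel (return borel (x::real))"
proof -
  interpret prob_space "return borel x" by (rule prob_space_return) simp
  show ?thesis unfolding fin_borel_def using finite_measure_axioms by simp
qed

lemma integral_return_borel: "f \<in> borel_measurable borel \<Longrightarrow> (\<integral>y. f y \<partial>return borel x) = f x" for f :: "real \<Rightarrow> real"
  by (rule integral_return) auto

lemma kernel_form_return: "bdd_borel k \<Longrightarrow> kernel_form k (return borel x) (return borel y) = k (x - y)"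
  unfolding kernel_form_def
  by (subst integral_return_borel) (auto intro!: integral_return_borel bdd_borel_meas bdd_borel_inner' bdd_borel_shift fin_borel_return)

context intervals
begin

text \<open>A configuration enters the energy estimates as the tuple of its weighted atoms. Atoms
  have infinite logarithmic energy, but their truncated energy is a finite double sum, diagonal
  included.\<close>

lemma point_measures:
  assumes g: "\<And>m. m < n \<Longrightarrow> g m < r" and x: "\<And>m. m < n \<Longrightarrow> x m \<in> {a (g m)..b (g m)}"
    and w: "\<And>m. m < n \<Longrightarrow> 0 \<le> w m" and ws: "\<And>j. j < r \<Longrightarrow> (\<Sum>m<n. if g m = j then w m else 0) = s j"
  defines "\<nu> \<equiv> \<lambda>j. wsum n (\<lambda>m. if g m = j then w m else 0) (\<lambda>m. return borel (x m))"
  shows "adm \<nu>"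
    and "\<lbrakk>0 < d; d \<le> L\<rbrakk> \<Longrightarrow> tuple_energy d L r \<nu> = (\<Sum>m<n. \<Sum>m'<n. coupling (g m) (g m') * (w m * (w m' * trunc_log d L (x m - x m'))))"
    and "continuous_on UNIV f \<Longrightarrow> (\<integral>x. f x \<partial>msum r \<nu>) = (\<Sum>m<n. w m * f (x m))"
proof -
  have \<nu>: "\<nu> j = wsum n (\<lambda>m. if g m = j then w m else 0) (\<lambda>m. return borel (x m))" for j by (simp add: \<nu>_def)
  have f: "fin_borel (\<nu> j)" for j unfolding \<nu>_def by (intro fin_borel_wsum fin_borel_return)
  have w': "m < n \<Longrightarrow> 0 \<le> (if g m = j then w m else 0)" for m j using w by auto
  have int: "(\<integral>x. h x \<partial>\<nu> j) = (\<Sum>m<n. (if g m = j then w m else 0) * h (x m))" if "bdd_borel h" for h j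
    unfolding \<nu>_def using integral_wsum[OF fin_borel_return w' that] bdd_borel_meas[OF that] by (simp add: integral_return_borel)
  show adm: "adm \<nu>"
  proof (rule admI)
    fix i assume i: "i < r"
    show "fin_borel (\<nu> i)" by (rule f)
    have "mass (\<nu> i) = (\<integral>x. 1 \<partial>\<nu> i)" by (simp only: integral_const_mass[OF f] mult_1_left)
    also have "\<dots> = (\<Sum>m<n. if g m = i then w m else 0)" using int[OF bdd_borel_const[of 1]] by simp
    finally show "mass (\<nu> i) = s i" using ws[OF i] by simp
    have "emeasure (\<nu> i) (- {a i..b i}) = (\<Sum>m<n. ennreal (if g m = i then w m else 0) * indicator (- {a i..b i}) (x m))"
      unfolding \<nu>_def by (subst emeasure_wsum) (auto intro: fin_borel_return)
    also have "\<dots> = 0" using x by (intro sum.neutral) auto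
    finally show "AE x in \<nu> i. x \<in> {a i..b i}"
      using fin_borelD[OF f] by (intro AE_I[where N="- {a i..b i}"]) auto
  qed
  show "tuple_energy d L r \<nu> = (\<Sum>m<n. \<Sum>m'<n. coupling (g m) (g m') * (w m * (w m' * trunc_log d L (x m - x m'))))" if d: "0 < d" "d \<le> L"
  proof -
    note k = bdd_borel_trunc_log[OF d]
    have kernel_form: "kernel_form (trunc_log d L) (\<nu> j) (\<nu> k) = (\<Sum>m<n. \<Sum>m'<n. (if g m = j then w m else 0) * ((if g m' = k then w m' else 0) * trunc_log d L (x m - x m')))" for j k
    proof -
      have "kernel_form (trunc_log d L) (\<nu> j) (\<nu> k) = (\<Sum>m<n. (if g m = j then w m else 0) * kernel_form (trunc_log d L) (return borel (x m)) (\<nu> k))"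
        unfolding \<nu>[of j] by (rule kernel_form_wsum_left[OF k fin_borel_return f w'])
      also have "\<dots> = (\<Sum>m<n. (if g m = j then w m else 0) * (\<Sum>m'<n. (if g m' = k then w m' else 0) * kernel_form (trunc_log d L) (return borel (x m)) (return borel (x m'))))"
        unfolding \<nu>[of k] by (subst kernel_form_wsum_right[OF k fin_borel_return fin_borel_return w']; (assumption | rule refl))
      finally show ?thesis by (simp only: kernel_form_return[OF k] sum_distrib_left)
    qed
    show ?thesis
      unfolding tuple_energy_eq_sum[OF d f] kernel_form coupling_def[symmetric] by (rule sum_regroup[OF g])
  qed
  show "(\<integral>x. f x \<partial>msum r \<nu>) = (\<Sum>m<n. w m * f (x m))" if c: "continuous_on UNIV f"
  proof -
    \<comment> \<open>Clamping to the hull makes \<open>f\<close> bounded and leaves it unchanged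
      where the measures live.\<close>
    define h where "h = (\<lambda>x. f (max lo (min hi x)))"
    have fm: "f \<in> borel_measurable borel" using c by (rule borel_measurable_continuous_onI)
    have hm: "h \<in> borel_measurable borel"
      unfolding h_def by (rule measurable_compose[OF _ fm]) measurable
    have "compact (f ` {lo..hi})" by (intro compact_continuous_image continuous_on_subset[OF c]) auto
    then have "bounded (f ` {lo..hi})" by (rule compact_imp_bounded)
    then obtain B where "\<forall>y\<in>f ` {lo..hi}. norm y \<le> B" unfolding bounded_iff by blast
    then have "\<bar>h x\<bar> \<le> B" for x unfolding h_def using lo_less_hi by auto
    then have h: "bdd_borel h" by (rule bdd_borelI[OF hm])
    have hf: "h x = f x" if "x \<in> {lo..hi}" for x using that by (auto simp: h_def min_def max_def)
    have "(\<integral>x. f x \<partial>msum r \<nu>) = (\<integral>x. h x \<partial>msum r \<nu>)"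
      using fm hm by (intro integral_cong_AE eventually_mono[OF msum_adm(4)[OF adm]]) (auto simp: hf)
    also have "\<dots> = (\<Sum>j<r. \<integral>x. h x \<partial>\<nu> j)"
      by (intro integral_msum hm integrable_bdd_borel[OF f h]) (simp add: fin_borelD(1)[OF f])
    also have "\<dots> = (\<Sum>m<n. \<Sum>j<r. (if g m = j then w m else 0) * h (x m))"
      unfolding int[OF h] by (rule sum.swap)
    also have "\<dots> = (\<Sum>m<n. w m * f (x m))"
    proof (intro sum.cong refl)
      fix m assume m: "m \<in> {..<n}"
      then have mn: "m < n" by simp
      have "h (x m) = f (x m)" by (rule hf[OF in_hull[OF g[OF mn] x[OF mn]]])
      then show "(\<Sum>j<r. (if g m = j then w m else 0) * h (x m)) = w m * f (x m)"
        using m g by (simp add: sum_distrib_right[symmetric] sum.delta)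
    qed
    finally show ?thesis .
  qed
qed

end

context minimizer
begin

text \<open>Label counts are only approximately \<open>s j * real n\<close>, so equal weights
  \<open>1 / real n\<close> need not be admissible. The weights \<open>s (g m) / N (g m)\<close>
  are, and returning to equal weights costs an error proportional to
  \<open>\<theta>\<close>.\<close>

lemma config_lower_bound:
  assumes d: "0 < d" "d \<le> 1" and ge: "\<And>\<eta>. adm \<eta> \<Longrightarrow> min_energy - \<epsilon> \<le> tuple_energy d L r \<eta>"
    and g: "\<And>m. m < n \<Longrightarrow> g m < r" and x: "\<And>m. m < n \<Longrightarrow> x m \<in> {a (g m)..b (g m)}"
    and cnt: "\<And>j. j < r \<Longrightarrow> 0 < card {m. m < n \<and> g m = j}"
    and \<theta>: "\<And>j. j < r \<Longrightarrow> \<bar>s j * real n / real (card {m. m < n \<and> g m = j}) - 1\<bar> \<le> \<theta>" "\<theta> \<le> 1"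
    and f: "\<And>x. (f has_real_derivative f' x) (at x)" and f': "continuous_on UNIV f'"
    and B: "\<And>x. x \<in> {lo..hi} \<Longrightarrow> \<bar>f x\<bar> \<le> B" and \<kappa>: "\<And>x. \<bar>trunc_log d L x\<bar> \<le> \<kappa>"
  shows "(real n)\<^sup>2 * (min_energy - 2 * \<epsilon> - \<tau>\<^sup>2 * slope_const f' - \<theta> * (3 * \<kappa> + \<bar>\<tau>\<bar> * B))
    \<le> (\<Sum>m<n. \<Sum>m'<n. coupling (g m) (g m') * trunc_log d L (x m - x m'))
      - \<tau> * (real n * (\<Sum>m<n. f (x m)) - (real n)\<^sup>2 * (\<integral>x. f x \<partial>msum r \<omega>))"
proof -
  have dL: "d \<le> L" using d L_gt_1 by simp
  define N where "N = (\<lambda>j. real (card {m. m < n \<and> g m = j}))"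
  define w where "w = (\<lambda>m. s (g m) / N (g m))"
  have n0: "0 < n"
  proof (rule ccontr)
    assume "\<not> 0 < n" then show False using cnt[OF r_pos] by simp
  qed
  have \<theta>0: "0 \<le> \<theta>" using \<theta>(1)[OF r_pos] by linarith
  have w0: "0 \<le> w m" if "m < n" for m unfolding w_def N_def using spos[OF g[OF that]] by simp
  have ws: "(\<Sum>m<n. if g m = j then w m else 0) = s j" if j: "j < r" for j
  proof -
    have "(\<Sum>m<n. if g m = j then w m else 0) = (\<Sum>m\<in>{m. m < n \<and> g m = j}. w m)"
      by (simp add: sum.If_cases lessThan_def Collect_conj_eq)
    also have "\<dots> = (\<Sum>m\<in>{m. m < n \<and> g m = j}. s j / N j)" by (intro sum.cong refl) (simp add: w_def)
    also have "\<dots> = N j * (s j / N j)" by (simp add: N_def)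
    also have "\<dots> = s j"
    proof -
      have "N j \<noteq> 0" unfolding N_def using cnt[OF j] by linarith
      then show ?thesis by simp
    qed
    finally show ?thesis .
  qed
  have wn: "\<bar>real n * w m - 1\<bar> \<le> \<theta>" if "m < n" for m
    using \<theta>(1)[OF g[OF that]] by (simp add: w_def N_def mult.commute)
  define \<nu> where "\<nu> = (\<lambda>j. wsum n (\<lambda>m. if g m = j then w m else 0) (\<lambda>m. return borel (x m)))"
  have pm: "adm \<nu>" unfolding \<nu>_def by (rule point_measures(1)[OF _ _ w0 ws]) (use g x in auto)
  have pm2: "tuple_energy d L r \<nu> = (\<Sum>m<n. \<Sum>m'<n. coupling (g m) (g m') * (w m * (w m' * trunc_log d L (x m - x m'))))"
    unfolding \<nu>_def by (rule point_measures(2)[OF _ _ w0 ws]) (use g x d dL in auto)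
  have pm3: "continuous_on UNIV h \<Longrightarrow> (\<integral>x. h x \<partial>msum r \<nu>) = (\<Sum>m<n. w m * h (x m))" for h
    unfolding \<nu>_def by (rule point_measures(3)[OF _ _ w0 ws]) (use g x in auto)
  have fc: "continuous_on UNIV f" using f by (meson DERIV_isCont continuous_at_imp_continuous_on)
  have "min_energy - 2 * \<epsilon> - \<tau>\<^sup>2 * slope_const f' \<le> tuple_energy d L r \<nu> - \<tau> * ((\<integral>x. f x \<partial>msum r \<nu>) - (\<integral>x. f x \<partial>msum r \<omega>))"
    by (rule tuple_energy_test_function[OF d _ pm f f']) (rule ge)
  then have 1: "(real n)\<^sup>2 * (min_energy - 2 * \<epsilon> - \<tau>\<^sup>2 * slope_const f') \<le> (real n)\<^sup>2 * (tuple_energy d L r \<nu> - \<tau> * ((\<integral>x. f x \<partial>msum r \<nu>) - (\<integral>x. f x \<partial>msum r \<omega>)))"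
    by (rule mult_left_mono) simp
  have \<kappa>0: "0 \<le> \<kappa>" using \<kappa>[of 0] by linarith
  have 2: "(real n)\<^sup>2 * tuple_energy d L r \<nu> \<le> (\<Sum>m<n. \<Sum>m'<n. coupling (g m) (g m') * trunc_log d L (x m - x m')) + (real n)\<^sup>2 * (\<theta> * (3 * \<kappa>))"
  proof -
    have "(real n)\<^sup>2 * tuple_energy d L r \<nu> = (\<Sum>m<n. \<Sum>m'<n. (real n)\<^sup>2 * (coupling (g m) (g m') * (w m * (w m' * trunc_log d L (x m - x m')))))"
      unfolding pm2 by (simp only: sum_distrib_left)
    also have "\<dots> \<le> (\<Sum>m<n. \<Sum>m'<n. coupling (g m) (g m') * trunc_log d L (x m - x m') + \<theta> * (3 * \<kappa>))"
    proof (intro sum_mono)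
      fix m m' assume m: "m \<in> {..<n}" "m' \<in> {..<n}"
      \<comment> \<open>The change of weights contributes \<open>(1 + p) * (1 + q) - 1\<close>, at
        most \<open>3 * \<theta>\<close> in modulus because \<open>\<theta> \<le> 1\<close>; hence
        the constant 3 in the statement.\<close>
      define p q k where "p = real n * w m - 1" and "q = real n * w m' - 1" and "k = coupling (g m) (g m') * trunc_log d L (x m - x m')"
      have pq: "\<bar>p\<bar> \<le> \<theta>" "\<bar>q\<bar> \<le> \<theta>" using wn m by (auto simp: p_def q_def)
      have "\<bar>k\<bar> \<le> 1 * \<kappa>"
        unfolding k_def abs_mult using coupling_bounds[of "g m" "g m'"] \<kappa> by (intro mult_mono) auto
      moreover have "\<bar>p + q + p * q\<bar> \<le> 3 * \<theta>"
      proof -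
        have "\<bar>p * q\<bar> \<le> \<theta> * 1" unfolding abs_mult using pq \<theta> by (intro mult_mono) auto
        then show ?thesis using pq by linarith
      qed
      ultimately have "\<bar>(p + q + p * q) * k\<bar> \<le> (3 * \<theta>) * \<kappa>"
        unfolding abs_mult using \<theta>0 by (intro mult_mono) auto
      moreover have "(real n)\<^sup>2 * (coupling (g m) (g m') * (w m * (w m' * trunc_log d L (x m - x m')))) = k + (p + q + p * q) * k"
        unfolding p_def q_def k_def by (simp add: power2_eq_square algebra_simps)
      ultimately show "(real n)\<^sup>2 * (coupling (g m) (g m') * (w m * (w m' * trunc_log d L (x m - x m')))) \<le> k + \<theta> * (3 * \<kappa>)"
        by (simp add: mult_ac abs_le_iff)
    qed
    also have "\<dots> = (\<Sum>m<n. \<Sum>m'<n. coupling (g m) (g m') * trunc_log d L (x m - x m')) + (real n)\<^sup>2 * (\<theta> * (3 * \<kappa>))"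
      by (simp add: sum.distrib power2_eq_square)
    finally show ?thesis .
  qed
  have 3: "\<tau> * (real n * (\<Sum>m<n. f (x m)) - (real n)\<^sup>2 * (\<integral>x. f x \<partial>msum r \<nu>)) \<le> (real n)\<^sup>2 * (\<theta> * (\<bar>\<tau>\<bar> * B))"
  proof -
    have "real n * (\<Sum>m<n. f (x m)) - (real n)\<^sup>2 * (\<integral>x. f x \<partial>msum r \<nu>) = (\<Sum>m<n. real n * ((1 - real n * w m) * f (x m)))"
      unfolding pm3[OF fc] by (simp add: sum_distrib_left sum_subtractf[symmetric] power2_eq_square algebra_simps)
    also have "\<bar>\<dots>\<bar> \<le> (\<Sum>m<n. real n * (\<theta> * B))"
    proof (rule sum_abs[THEN order_trans], intro sum_mono)
      fix m assume m: "m \<in> {..<n}"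
      have "x m \<in> {lo..hi}" using in_hull[OF g x] m by blast
      then have "\<bar>(1 - real n * w m) * f (x m)\<bar> \<le> \<theta> * B"
        unfolding abs_mult using wn[of m] m B \<theta>0 by (intro mult_mono) (auto simp: abs_minus_commute)
      then show "\<bar>real n * ((1 - real n * w m) * f (x m))\<bar> \<le> real n * (\<theta> * B)"
        unfolding abs_mult[of "real n"] by (intro mult_mono) auto
    qed
    also have "\<dots> = (real n)\<^sup>2 * (\<theta> * B)" by (simp add: power2_eq_square)
    finally have "\<bar>\<tau> * (real n * (\<Sum>m<n. f (x m)) - (real n)\<^sup>2 * (\<integral>x. f x \<partial>msum r \<nu>))\<bar> \<le> \<bar>\<tau>\<bar> * ((real n)\<^sup>2 * (\<theta> * B))"
      unfolding abs_mult[of \<tau>] by (intro mult_left_mono) auto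
    then show ?thesis by (simp add: mult_ac abs_le_iff)
  qed
  from 1 2 3 show ?thesis by (simp add: algebra_simps)
qed

end

subsection \<open>Dominated approximations of the minimizer\<close>

text \<open>The untruncated energy as a real number, meaningful when the kernel is integrable; for
  measures of bounded density on a bounded set it agrees with \<open>log_energy\<close>.\<close>

definition log_form :: "real measure \<Rightarrow> real measure \<Rightarrow> real" where
  "log_form M N = (\<integral>z. - ln \<bar>fst z - snd z\<bar> \<partial>(M \<Otimes>\<^sub>M N))"

lemma log_form_commute:
  assumes M: "fin_borel M" and N: "fin_borel N"
  shows "log_form M N = log_form N M"
proof -
  interpret A: finite_measure M using M by (rule fin_borelD)
  interpret B: finite_measure N using N by (rule fin_borelD)
  interpret Q: pair_sigma_finite M N by unfold_locales
  have [measurable_cong]: "sets M = sets borel" "sets N = sets borel" using M N by (auto dest: fin_borelD)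
  have "log_form M N = (\<integral>z. - ln \<bar>fst z - snd z\<bar> \<partial>distr (N \<Otimes>\<^sub>M M) (M \<Otimes>\<^sub>M N) (\<lambda>(x, y). (y, x)))"
    unfolding log_form_def by (subst Q.distr_pair_swap) (rule refl)
  also have "\<dots> = log_form N M"
    unfolding log_form_def by (subst integral_distr) (auto simp: case_prod_unfold abs_minus_commute)
  finally show ?thesis .
qed

text \<open>The kernel is split at \<open>d = 1\<close> into \<open>trunc_log\<close> and its
  excess. Bounded density makes the excess integrable, and since the excess is infinite on the
  diagonal, the diagonal is null.\<close>

lemma log_form_dominated:
  assumes L: "1 \<le> L" and M: "fin_borel M" and N: "fin_borel N" and dom: "dominated C N" and C: "0 \<le> C"
    and S: "AE x in M. x \<in> S" "AE y in N. y \<in> S'" and SL: "\<And>x y. x \<in> S \<Longrightarrow> y \<in> S' \<Longrightarrow> \<bar>x - y\<bar> \<le> L"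
  shows "integrable (M \<Otimes>\<^sub>M N) (\<lambda>z. - ln \<bar>fst z - snd z\<bar>)"
    and "AE z in M \<Otimes>\<^sub>M N. fst z \<noteq> snd z"
    and "log_energy M N = ereal (log_form M N)"
proof -
  interpret M: finite_measure M using M by (rule fin_borelD)
  interpret N: finite_measure N using N by (rule fin_borelD)
  interpret Q: pair_sigma_finite M N by unfold_locales
  have [measurable_cong]: "sets M = sets borel" "sets N = sets borel" using M N by (auto dest: fin_borelD)
  have k: "bdd_borel (trunc_log 1 L)" by (rule bdd_borel_trunc_log) (use L in auto)
  let ?g = "\<lambda>z. log_excess 1 (fst z - snd z)"
  have geq: "(\<integral>\<^sup>+z. ?g z \<partial>(M \<Otimes>\<^sub>M N)) = (\<integral>\<^sup>+x. \<integral>\<^sup>+y. log_excess 1 (x - y) \<partial>N \<partial>M)"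
    by (subst N.nn_integral_fst[symmetric]) auto
  have gfin: "(\<integral>\<^sup>+z. ?g z \<partial>(M \<Otimes>\<^sub>M N)) \<noteq> \<infinity>"
    using nn_integral_log_excess_dominated[OF M N dom zero_less_one_class.zero_less_one C] unfolding geq by (auto simp: top_unique)
  have gAE: "AE z in M \<Otimes>\<^sub>M N. ?g z \<noteq> \<infinity>"
    by (rule nn_integral_PInf_AE[OF _ gfin]) measurable
  then show ne: "AE z in M \<Otimes>\<^sub>M N. fst z \<noteq> snd z"
    by (rule eventually_mono) (auto simp: log_excess_def)
  have inS: "AE z in M \<Otimes>\<^sub>M N. \<bar>fst z - snd z\<bar> \<le> L"
  proof (rule Q.AE_pair_measure)
    show "{z \<in> space (M \<Otimes>\<^sub>M N). \<bar>fst z - snd z\<bar> \<le> L} \<in> sets (M \<Otimes>\<^sub>M N)" by measurable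
    show "AE x in M. AE y in N. \<bar>fst (x, y) - snd (x, y)\<bar> \<le> L"
      by (rule eventually_mono[OF S(1)], rule eventually_mono[OF S(2)]) (use SL in auto)
  qed
  have ge: "(\<integral>\<^sup>+z. ennreal (enn2real (?g z)) \<partial>(M \<Otimes>\<^sub>M N)) = (\<integral>\<^sup>+z. ?g z \<partial>(M \<Otimes>\<^sub>M N))"
    by (rule nn_integral_cong_AE, rule eventually_mono[OF gAE]) (simp add: less_top)
  have gi: "integrable (M \<Otimes>\<^sub>M N) (\<lambda>z. enn2real (?g z))"
    using gfin by (intro integrableI_nonneg) (auto simp: ge less_top)
  have eq: "AE z in M \<Otimes>\<^sub>M N. - ln \<bar>fst z - snd z\<bar> = trunc_log 1 L (fst z - snd z) + enn2real (?g z)"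
    using ne inS
  proof eventually_elim
    case (elim z)
    let ?x = "fst z - snd z"
    show ?case
    proof (cases "\<bar>?x\<bar> < 1")
      case True
      have "0 \<le> - ln \<bar>?x\<bar> - (1 - ln 1 - \<bar>?x\<bar> / 1)"
        using trunc_log_le_ln[of 1 ?x L] True L elim by (simp add: trunc_log_def)
      then show ?thesis using True elim by (simp add: trunc_log_def log_excess_def)
    next
      case False
      then show ?thesis using elim by (auto simp: trunc_log_def log_excess_def)
    qed
  qed
  have ki: "integrable (M \<Otimes>\<^sub>M N) (\<lambda>z. trunc_log 1 L (fst z - snd z))" by (rule kernel_form_pair(1)[OF k M N])
  have m: "(\<lambda>z. - ln \<bar>fst z - snd z\<bar>) \<in> borel_measurable (M \<Otimes>\<^sub>M N)" by measurable
  show "integrable (M \<Otimes>\<^sub>M N) (\<lambda>z. - ln \<bar>fst z - snd z\<bar>)"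
    using Bochner_Integration.integrable_add[OF ki gi] by (subst integrable_cong_AE[OF m _ eq]) auto
  have "log_form M N = (\<integral>z. trunc_log 1 L (fst z - snd z) + enn2real (?g z) \<partial>(M \<Otimes>\<^sub>M N))"
    unfolding log_form_def by (rule integral_cong_AE[OF m _ eq]) measurable
  also have "\<dots> = kernel_form (trunc_log 1 L) M N + (\<integral>z. enn2real (?g z) \<partial>(M \<Otimes>\<^sub>M N))"
    unfolding kernel_form_pair(2)[OF k M N] by (rule Bochner_Integration.integral_add[OF ki gi])
  also have "(\<integral>z. enn2real (?g z) \<partial>(M \<Otimes>\<^sub>M N)) = enn2real (\<integral>\<^sup>+z. ?g z \<partial>(M \<Otimes>\<^sub>M N))"
    unfolding ge[symmetric] by (rule integral_eq_nn_integral) auto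
  finally have J: "log_form M N = kernel_form (trunc_log 1 L) M N + enn2real (\<integral>\<^sup>+z. ?g z \<partial>(M \<Otimes>\<^sub>M N))" .
  obtain G where G: "(\<integral>\<^sup>+z. ?g z \<partial>(M \<Otimes>\<^sub>M N)) = ennreal G" "0 \<le> G"
    using gfin by (metis ennreal_cases infinity_ennreal_def)
  show "log_energy M N = ereal (log_form M N)"
    using log_energy_eq[OF zero_less_one_class.zero_less_one order_refl L M N S SL] G J unfolding geq[symmetric]
    by (simp add: enn2ereal_ennreal)
qed

context minimizer
begin

lemma energy_eq_log_form:
  assumes \<eta>: "adm \<eta>" and C: "0 \<le> C" "\<And>i. i < r \<Longrightarrow> dominated C (\<eta> i)"
  shows "angelesco_energy r \<eta> = ereal (\<Sum>j<r. \<Sum>k<r. coupling j k * log_form (\<eta> j) (\<eta> k))"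
proof -
  note D = admD[OF \<eta>]
  have sym: "log_form (\<eta> j) (\<eta> k) = log_form (\<eta> k) (\<eta> j)" if "j < r" "k < r" for j k
    using D(1) that by (intro log_form_commute)
  have e: "log_energy (\<eta> j) (\<eta> k) = ereal (log_form (\<eta> j) (\<eta> k))" if "j < r" "k < r" for j k
    by (rule log_form_dominated(3)[OF less_imp_le[OF L_gt_1] D(1)[OF that(1)] D(1)[OF that(2)] C(2)[OF that(2)] C(1) D(4)[OF that(1)] D(4)[OF that(2)] dist_le_L])
  have "angelesco_energy r \<eta> = (\<Sum>j<r. ereal (log_form (\<eta> j) (\<eta> j))) + (\<Sum>j<r. \<Sum>k\<in>{j<..<r}. ereal (log_form (\<eta> j) (\<eta> k)))"
    unfolding angelesco_energy_def using e by (intro arg_cong2[where f="(+)"] sum.cong refl) auto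
  also have "\<dots> = ereal ((\<Sum>j<r. log_form (\<eta> j) (\<eta> j)) + (\<Sum>j<r. \<Sum>k\<in>{j<..<r}. log_form (\<eta> j) (\<eta> k)))" by simp
  also have "(\<Sum>j<r. log_form (\<eta> j) (\<eta> j)) + (\<Sum>j<r. \<Sum>k\<in>{j<..<r}. log_form (\<eta> j) (\<eta> k)) = (\<Sum>j<r. \<Sum>k<r. coupling j k * log_form (\<eta> j) (\<eta> k))"
    unfolding coupling_def by (rule sum_pairs_symmetric[symmetric]) (rule sym)
  finally show ?thesis .
qed

text \<open>Comparison with the product of the \<open>\<mu> i\<close> asks for more than a bounded
  Lebesgue density. The smoothed minimizer is cut off to the set where \<open>f i\<close> is at
  least \<open>1 / real (Suc n)\<close> and normalized; there Lebesgue measure is at most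
  \<open>real (Suc n)\<close> times \<open>\<mu> i\<close>. Since \<open>f i > 0\<close> almost
  everywhere on the interval, the energies converge as the cutoff is removed. The resulting measures
  are probabilities, hence the factors \<open>s j * s k\<close>.\<close>

lemma dominated_approximation:
  assumes \<mu>: "\<And>i. i < r \<Longrightarrow> sets (\<mu> i) = sets borel"
    and f: "\<And>i. i < r \<Longrightarrow> f i \<in> borel_measurable borel"
    and ge: "\<And>i A. i < r \<Longrightarrow> A \<in> sets borel \<Longrightarrow> (\<integral>\<^sup>+x\<in>A. f i x \<partial>lborel) \<le> emeasure (\<mu> i) A"
    and pos: "\<And>i. i < r \<Longrightarrow> AE x in lborel. x \<in> {a i..b i} \<longrightarrow> f i x > 0"
    and \<epsilon>: "0 < \<epsilon>"
  obtains C \<eta> where "0 < C" "\<And>i. i < r \<Longrightarrow> fin_borel (\<eta> i)" "\<And>i. i < r \<Longrightarrow> mass (\<eta> i) = 1"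
    "\<And>i A. i < r \<Longrightarrow> A \<in> sets borel \<Longrightarrow> emeasure (\<eta> i) A \<le> ennreal C * emeasure (\<mu> i) A"
    "\<And>j k. j < r \<Longrightarrow> k < r \<Longrightarrow> integrable (\<eta> j \<Otimes>\<^sub>M \<eta> k) (\<lambda>z. - ln \<bar>fst z - snd z\<bar>)"
    "\<And>j k. j < r \<Longrightarrow> k < r \<Longrightarrow> AE z in \<eta> j \<Otimes>\<^sub>M \<eta> k. fst z \<noteq> snd z"
    "(\<Sum>j<r. \<Sum>k<r. coupling j k * (s j * s k * log_form (\<eta> j) (\<eta> k))) \<le> min_energy + \<epsilon>"
proof -
  obtain C0 d0 where C0: "0 < C0" and d0: "0 < d0" "d0 \<le> 1"
    and sm: "\<And>d \<eta>. \<lbrakk>0 < d; d \<le> d0; adm \<eta>\<rbrakk> \<Longrightarrow> \<exists>\<eta>'. adm \<eta>' \<and> (\<forall>i<r. dominated C0 (\<eta>' i))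
       \<and> angelesco_energy r \<eta>' \<le> ereal (tuple_energy d L r \<eta> + \<epsilon> / 2)"
    using smoothing[of "\<epsilon> / 2"] \<epsilon> by (metis half_gt_zero)
  obtain \<eta>' where adm': "adm \<eta>'" and dom: "\<And>i. i < r \<Longrightarrow> dominated C0 (\<eta>' i)"
    and en: "angelesco_energy r \<eta>' \<le> ereal (tuple_energy d0 L r \<omega> + \<epsilon> / 2)"
    using sm[OF d0(1) order_refl adm_omega] by blast
  note D = admD[OF adm']
  have "(\<Sum>j<r. \<Sum>k<r. coupling j k * log_form (\<eta>' j) (\<eta>' k)) \<le> tuple_energy d0 L r \<omega> + \<epsilon> / 2"
    using en energy_eq_log_form[OF adm' less_imp_le[OF C0] dom] by simp
  \<comment> \<open>The strict inequality leaves room for the error of the cutoff.\<close>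
  then have le: "(\<Sum>j<r. \<Sum>k<r. coupling j k * log_form (\<eta>' j) (\<eta>' k)) < min_energy + \<epsilon>"
    using tuple_energy_omega_le[OF d0] \<epsilon> by linarith
  define u where "u = (\<lambda>(n::nat) i x. if ennreal (1 / real (Suc n)) \<le> f i x then 1 else 0 :: real)"
  have um: "u n i \<in> borel_measurable borel" if "i < r" for n i
    unfolding u_def using f[OF that] by measurable
  have u01: "0 \<le> u n i x" "u n i x \<le> 1" for n i x by (auto simp: u_def)
  \<comment> \<open>The exceptional set is Lebesgue null, hence null for the dominated measure
    \<open>\<eta>' i\<close>.\<close>
  have posAE: "AE x in \<eta>' i. f i x > 0" if i: "i < r" for i
  proof -
    have fm [measurable]: "f i \<in> borel_measurable borel" by (rule f[OF i])
    let ?N = "{x. x \<in> {a i..b i} \<and> \<not> f i x > 0}"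
    have N: "?N \<in> sets borel" by measurable
    have "emeasure lborel ?N = 0"
      using pos[OF i] N by (subst (asm) AE_iff_measurable[OF _ refl]) (auto simp: not_less)
    then have "emeasure (\<eta>' i) ?N = 0"
      using dom[OF i] N unfolding dominated_def by (metis le_zero_eq mult_zero_right)
    then have "AE x in \<eta>' i. x \<notin> ?N"
      using N fin_borelD[OF D(1)[OF i]] by (intro AE_I[where N="?N"]) auto
    with D(2)[OF i] show ?thesis by eventually_elim (auto simp: zero_less_iff_neq_zero)
  qed
  have ulim: "(\<lambda>n. u n i x) \<longlonglongrightarrow> 1" if fp: "f i x > 0" for i x
  proof -
    obtain N where N: "ennreal (1 / real (Suc N)) \<le> f i x"
    proof (cases "f i x = \<infinity>")
      case False
      then obtain y where y: "f i x = ennreal y" "0 < y" using fp by (cases "f i x") auto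
      obtain N where "1 / real (Suc N) < y" using nat_approx_posE[OF y(2)] .
      then show ?thesis using that[of N] y by (auto intro: ennreal_leI)
    qed (use that[of 0] in auto)
    have "u n i x = 1" if "N \<le> n" for n
    proof -
      have "ennreal (1 / real (Suc n)) \<le> ennreal (1 / real (Suc N))" using that by (intro ennreal_leI frac_le) auto
      from order_trans[OF this N] show ?thesis unfolding u_def by (simp only: if_True)
    qed
    then show ?thesis by (intro tendsto_eventually) (auto simp: eventually_sequentially)
  qed
  define z where "z = (\<lambda>n i. \<integral>x. u n i x \<partial>\<eta>' i)"
  have zlim: "(\<lambda>n. z n i) \<longlonglongrightarrow> s i" if i: "i < r" for i
  proof -
    have "(\<lambda>n. z n i) \<longlonglongrightarrow> (\<integral>x. 1 \<partial>\<eta>' i)"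
      unfolding z_def
    proof (rule integral_dominated_convergence[where w="\<lambda>_. 1"])
      show "AE x in \<eta>' i. (\<lambda>n. u n i x) \<longlonglongrightarrow> 1" by (rule eventually_mono[OF posAE[OF i]]) (rule ulim)
      show "integrable (\<eta>' i) (\<lambda>_. 1 :: real)" by (rule integrable_bdd_borel[OF D(1)[OF i] bdd_borel_const])
      show "u n i \<in> borel_measurable (\<eta>' i)" for n
        using um[OF i] measurable_cong_sets[OF fin_borelD(1)[OF D(1)[OF i]] refl] by blast
    qed (use u01 in auto)
    then show ?thesis by (simp only: integral_const_mass[OF D(1)[OF i]] D(3)[OF i] mult_1_left)
  qed
  \<comment> \<open>Energies of the measures cut off but not yet normalized.\<close>
  define J where "J = (\<lambda>n j k. \<integral>w. u n j (fst w) * u n k (snd w) * - ln \<bar>fst w - snd w\<bar> \<partial>(\<eta>' j \<Otimes>\<^sub>M \<eta>' k))"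
  have Jd: "integrable (\<eta>' j \<Otimes>\<^sub>M \<eta>' k) (\<lambda>z. - ln \<bar>fst z - snd z\<bar>)" if "j < r" "k < r" for j k
    by (rule log_form_dominated(1)[OF less_imp_le[OF L_gt_1] D(1)[OF that(1)] D(1)[OF that(2)] dom[OF that(2)] less_imp_le[OF C0] D(4)[OF that(1)] D(4)[OF that(2)] dist_le_L])
  have Jlim: "(\<lambda>n. J n j k) \<longlonglongrightarrow> log_form (\<eta>' j) (\<eta>' k)" if jk: "j < r" "k < r" for j k
    unfolding J_def log_form_def
  proof (rule integral_dominated_convergence[where w="\<lambda>w. \<bar>- ln \<bar>fst w - snd w\<bar>\<bar>"])
    have [measurable_cong]: "sets (\<eta>' j) = sets borel" "sets (\<eta>' k) = sets borel" using jk D(1) by (auto dest: fin_borelD)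
    have [measurable]: "u n j \<in> borel_measurable borel" "u n k \<in> borel_measurable borel" "f j \<in> borel_measurable borel" "f k \<in> borel_measurable borel" for n
      using um jk f by auto
    interpret A: finite_measure "\<eta>' j" using D(1)[OF jk(1)] by (rule fin_borelD)
    interpret B: finite_measure "\<eta>' k" using D(1)[OF jk(2)] by (rule fin_borelD)
    interpret Q: pair_sigma_finite "\<eta>' j" "\<eta>' k" by unfold_locales
    show "integrable (\<eta>' j \<Otimes>\<^sub>M \<eta>' k) (\<lambda>w. \<bar>- ln \<bar>fst w - snd w\<bar>\<bar>)" by (rule integrable_abs[OF Jd[OF jk]])
    have "AE w in \<eta>' j \<Otimes>\<^sub>M \<eta>' k. f j (fst w) > 0 \<and> f k (snd w) > 0"
    proof (rule Q.AE_pair_measure)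
      show "AE x in \<eta>' j. AE y in \<eta>' k. f j (fst (x, y)) > 0 \<and> f k (snd (x, y)) > 0"
        by (rule eventually_mono[OF posAE[OF jk(1)]], rule eventually_mono[OF posAE[OF jk(2)]]) auto
    qed measurable
    then show "AE w in \<eta>' j \<Otimes>\<^sub>M \<eta>' k. (\<lambda>n. u n j (fst w) * u n k (snd w) * - ln \<bar>fst w - snd w\<bar>) \<longlonglongrightarrow> - ln \<bar>fst w - snd w\<bar>"
    proof (rule eventually_mono)
      fix w assume "f j (fst w) > 0 \<and> f k (snd w) > 0"
      then have "(\<lambda>n. u n j (fst w) * u n k (snd w) * - ln \<bar>fst w - snd w\<bar>) \<longlonglongrightarrow> 1 * 1 * - ln \<bar>fst w - snd w\<bar>"
        by (intro tendsto_mult ulim tendsto_const) auto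
      then show "(\<lambda>n. u n j (fst w) * u n k (snd w) * - ln \<bar>fst w - snd w\<bar>) \<longlonglongrightarrow> - ln \<bar>fst w - snd w\<bar>" by simp
    qed
    show "AE w in \<eta>' j \<Otimes>\<^sub>M \<eta>' k. norm (u n j (fst w) * u n k (snd w) * - ln \<bar>fst w - snd w\<bar>) \<le> \<bar>- ln \<bar>fst w - snd w\<bar>\<bar>" for n
    proof (rule AE_I2)
      fix w
      have "\<bar>u n j (fst w) * u n k (snd w)\<bar> \<le> 1 * 1" unfolding abs_mult using u01 by (intro mult_mono) auto
      then show "norm (u n j (fst w) * u n k (snd w) * - ln \<bar>fst w - snd w\<bar>) \<le> \<bar>- ln \<bar>fst w - snd w\<bar>\<bar>"
        unfolding real_norm_def abs_mult[of "u n j (fst w) * u n k (snd w)"] by (intro mult_left_le_one_le) auto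
    qed
    show "(\<lambda>w. - ln \<bar>fst w - snd w\<bar>) \<in> borel_measurable (\<eta>' j \<Otimes>\<^sub>M \<eta>' k)" by measurable
    show "(\<lambda>w. u n j (fst w) * u n k (snd w) * - ln \<bar>fst w - snd w\<bar>) \<in> borel_measurable (\<eta>' j \<Otimes>\<^sub>M \<eta>' k)" for n
      by measurable
  qed
  have "(\<lambda>n. \<Sum>j<r. \<Sum>k<r. coupling j k * (s j * s k * (J n j k / (z n j * z n k)))) \<longlonglongrightarrow>
      (\<Sum>j<r. \<Sum>k<r. coupling j k * (s j * s k * (log_form (\<eta>' j) (\<eta>' k) / (s j * s k))))"
  proof (intro tendsto_sum tendsto_mult tendsto_const tendsto_divide Jlim zlim)
    fix j k assume "j \<in> {..<r}" "k \<in> {..<r}"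
    then show "s j * s k \<noteq> 0" using spos[of j] spos[of k] by auto
  qed auto
  also have "(\<Sum>j<r. \<Sum>k<r. coupling j k * (s j * s k * (log_form (\<eta>' j) (\<eta>' k) / (s j * s k)))) = (\<Sum>j<r. \<Sum>k<r. coupling j k * log_form (\<eta>' j) (\<eta>' k))"
  proof (intro sum.cong refl)
    fix j k assume "j \<in> {..<r}" "k \<in> {..<r}"
    then have "s j * s k \<noteq> 0" using spos[of j] spos[of k] by auto
    then show "coupling j k * (s j * s k * (log_form (\<eta>' j) (\<eta>' k) / (s j * s k))) = coupling j k * log_form (\<eta>' j) (\<eta>' k)" by simp
  qed
  finally have ev1: "\<forall>\<^sub>F n in sequentially. (\<Sum>j<r. \<Sum>k<r. coupling j k * (s j * s k * (J n j k / (z n j * z n k)))) < min_energy + \<epsilon>"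
    using le by (rule order_tendstoD)
  have ev2: "\<forall>\<^sub>F n in sequentially. \<forall>i\<in>{..<r}. 0 < z n i"
    using order_tendstoD(1)[OF zlim] spos by (intro eventually_ball_finite) auto
  obtain n where n: "(\<Sum>j<r. \<Sum>k<r. coupling j k * (s j * s k * (J n j k / (z n j * z n k)))) < min_energy + \<epsilon>" "\<And>i. i < r \<Longrightarrow> 0 < z n i"
    using eventually_happens[OF eventually_conj[OF ev1 ev2]] by auto
  define \<eta> where "\<eta> = (\<lambda>i. density (\<eta>' i) (\<lambda>x. ennreal (u n i x / z n i)))"
  \<comment> \<open>A common upper bound for the normalizing factors, so that one constant serves
    all components.\<close>
  define Z where "Z = (\<Sum>i<r. 1 / z n i)"
  have Z: "1 / z n i \<le> Z" if "i < r" for i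
    unfolding Z_def using n(2) that by (intro member_le_sum) (auto intro: less_imp_le)
  have Zp: "0 < Z" using Z[OF r_pos] n(2)[OF r_pos] by (meson less_le_trans zero_less_divide_1_iff)
  have sets\<eta>: "sets (\<eta> i) = sets borel" if "i < r" for i using fin_borelD(1)[OF D(1)[OF that]] by (simp add: \<eta>_def)
  have emeas: "emeasure (\<eta> i) A = (\<integral>\<^sup>+x. ennreal (u n i x / z n i) * indicator A x \<partial>\<eta>' i)" if "i < r" "A \<in> sets borel" for i A
  proof -
    have "(\<lambda>x. ennreal (u n i x / z n i)) \<in> borel_measurable (\<eta>' i)"
      using um[OF that(1)] measurable_cong_sets[OF fin_borelD(1)[OF D(1)[OF that(1)]] refl, of "borel::ennreal measure"] by auto
    then show ?thesis unfolding \<eta>_def using that fin_borelD(1)[OF D(1)[OF that(1)]] by (intro emeasure_density) auto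
  qed
  have le_leb: "emeasure (\<eta> i) A \<le> ennreal C0 * (\<integral>\<^sup>+x. ennreal (u n i x / z n i) * indicator A x \<partial>lborel)" if "i < r" "A \<in> sets borel" for i A
    unfolding emeas[OF that] using fin_borelD(1)[OF D(1)[OF that(1)]] dom[OF that(1)] um[OF that(1)] that(2)
    by (intro nn_integral_dominated) auto
  have dom\<eta>: "dominated (C0 * Z) (\<eta> i)" if i: "i < r" for i
    unfolding dominated_def
  proof
    fix A :: "real set" assume A: "A \<in> sets borel"
    have "(\<integral>\<^sup>+x. ennreal (u n i x / z n i) * indicator A x \<partial>lborel) \<le> (\<integral>\<^sup>+x. ennreal Z * indicator A x \<partial>lborel)"
    proof (intro nn_integral_mono mult_right_mono ennreal_leI)
      fix x
      have "u n i x / z n i \<le> 1 / z n i" using u01 n(2)[OF i] by (intro divide_right_mono) auto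
      then show "u n i x / z n i \<le> Z" using Z[OF i] by linarith
    qed auto
    also have "\<dots> = ennreal Z * emeasure lborel A" using A by (simp add: nn_integral_cmult_indicator)
    finally have "emeasure (\<eta> i) A \<le> ennreal C0 * (ennreal Z * emeasure lborel A)"
      using le_leb[OF i A] by (meson mult_left_mono order_trans zero_le)
    then show "emeasure (\<eta> i) A \<le> ennreal (C0 * Z) * emeasure lborel A"
      using C0 Zp by (simp add: ennreal_mult mult.assoc)
  qed
  have mass1: "emeasure (\<eta> i) UNIV = 1" if i: "i < r" for i
  proof -
    have "integrable (\<eta>' i) (\<lambda>x. u n i x / z n i)"
      using integrable_fin_borel[OF D(1)[OF i] um[OF i], of n 1] u01 by auto
    then have "(\<integral>\<^sup>+x. ennreal (u n i x / z n i) \<partial>\<eta>' i) = ennreal (\<integral>x. u n i x / z n i \<partial>\<eta>' i)"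
      using u01 n(2)[OF i] by (intro nn_integral_eq_integral) (auto intro: divide_nonneg_pos)
    also have "(\<integral>x. u n i x / z n i \<partial>\<eta>' i) = 1" using n(2)[OF i] by (simp add: z_def)
    finally show ?thesis using emeas[OF i, of UNIV] by simp
  qed
  have fin\<eta>: "fin_borel (\<eta> i)" if i: "i < r" for i
    unfolding fin_borel_def using mass1[OF i] sets\<eta>[OF i] sets_eq_imp_space_eq[OF sets\<eta>[OF i]] by (auto intro!: finite_measureI)
  have ae\<eta>: "AE x in \<eta> i. x \<in> {lo..hi}" if i: "i < r" for i
  proof -
    have "(\<lambda>x. ennreal (u n i x / z n i)) \<in> borel_measurable (\<eta>' i)"
      using um[OF i] measurable_cong_sets[OF fin_borelD(1)[OF D(1)[OF i]] refl, of "borel::ennreal measure"] by auto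
    then show ?thesis unfolding \<eta>_def using D(4)[OF i] by (subst AE_density) (auto elim: eventually_mono)
  qed
  note Jd\<eta> = log_form_dominated[OF less_imp_le[OF L_gt_1] fin\<eta> fin\<eta> dom\<eta> _ ae\<eta> ae\<eta> dist_le_L]
  have CZ: "0 \<le> C0 * Z" using C0 Zp by simp
  have Jeq: "log_form (\<eta> j) (\<eta> k) = J n j k / (z n j * z n k)" if jk: "j < r" "k < r" for j k
  proof -
    have [measurable_cong]: "sets (\<eta>' j) = sets borel" "sets (\<eta>' k) = sets borel" using jk D(1) by (auto dest: fin_borelD)
    have [measurable]: "u n j \<in> borel_measurable borel" "u n k \<in> borel_measurable borel" using um jk by auto
    have "\<eta> j \<Otimes>\<^sub>M \<eta> k = density (\<eta>' j \<Otimes>\<^sub>M \<eta>' k) (\<lambda>(x, y). ennreal (u n j x / z n j) * ennreal (u n k y / z n k))"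
      unfolding \<eta>_def using fin_borelD(4)[OF D(1)[OF jk(2)]] fin_borelD(4)[OF fin\<eta>[OF jk(2)]]
      by (intro pair_measure_density) (auto simp: \<eta>_def)
    also have "\<dots> = density (\<eta>' j \<Otimes>\<^sub>M \<eta>' k) (\<lambda>w. ennreal (u n j (fst w) / z n j * (u n k (snd w) / z n k)))"
    proof -
      have "ennreal (u n j x / z n j) * ennreal (u n k y / z n k) = ennreal (u n j x / z n j * (u n k y / z n k))" for x y
        using u01 n(2)[OF jk(1)] n(2)[OF jk(2)] by (intro ennreal_mult[symmetric] divide_nonneg_pos) auto
      then show ?thesis by (simp only: case_prod_unfold)
    qed
    finally have "log_form (\<eta> j) (\<eta> k) = (\<integral>w. (u n j (fst w) / z n j * (u n k (snd w) / z n k)) *\<^sub>R (- ln \<bar>fst w - snd w\<bar>) \<partial>(\<eta>' j \<Otimes>\<^sub>M \<eta>' k))"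
      unfolding log_form_def using u01 n(2)[OF jk(1)] n(2)[OF jk(2)]
      by (simp only:) (intro integral_density; auto intro!: mult_nonneg_nonneg divide_nonneg_pos)
    also have "\<dots> = (\<integral>w. (u n j (fst w) * u n k (snd w) * - ln \<bar>fst w - snd w\<bar>) / (z n j * z n k) \<partial>(\<eta>' j \<Otimes>\<^sub>M \<eta>' k))"
      by (intro Bochner_Integration.integral_cong refl) simp
    finally show ?thesis by (simp only: J_def integral_divide_zero)
  qed
  show ?thesis
  \<comment> \<open>\<open>C0\<close> bounds the density of the smoothed tuple,
    \<open>real (Suc n)\<close> comes from the cutoff and \<open>Z\<close> from the
    normalization.\<close>
  proof (rule that[of "C0 * (real (Suc n) * Z)" \<eta>])
    show "0 < C0 * (real (Suc n) * Z)" using C0 Zp by simp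
    show "fin_borel (\<eta> i)" if "i < r" for i by (rule fin\<eta>[OF that])
    show "mass (\<eta> i) = 1" if "i < r" for i using mass1[OF that] mass_eq_emeasure[OF fin\<eta>[OF that]] by simp
    show "integrable (\<eta> j \<Otimes>\<^sub>M \<eta> k) (\<lambda>z. - ln \<bar>fst z - snd z\<bar>)" "AE z in \<eta> j \<Otimes>\<^sub>M \<eta> k. fst z \<noteq> snd z" if "j < r" "k < r" for j k
      using Jd\<eta>(1,2)[OF that that(2) CZ that] by auto
    show "(\<Sum>j<r. \<Sum>k<r. coupling j k * (s j * s k * log_form (\<eta> j) (\<eta> k))) \<le> min_energy + \<epsilon>"
    proof -
      have "(\<Sum>j<r. \<Sum>k<r. coupling j k * (s j * s k * log_form (\<eta> j) (\<eta> k))) = (\<Sum>j<r. \<Sum>k<r. coupling j k * (s j * s k * (J n j k / (z n j * z n k))))"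
        by (intro sum.cong refl) (simp add: Jeq)
      then show ?thesis using n(1) by linarith
    qed
    show "emeasure (\<eta> i) A \<le> ennreal (C0 * (real (Suc n) * Z)) * emeasure (\<mu> i) A" if i: "i < r" and A: "A \<in> sets borel" for i A
    proof -
      have "(\<integral>\<^sup>+x. ennreal (u n i x / z n i) * indicator A x \<partial>lborel) \<le> (\<integral>\<^sup>+x. ennreal (real (Suc n) * Z) * (f i x * indicator A x) \<partial>lborel)"
      proof (rule nn_integral_mono)
        fix x
        have "ennreal (u n i x / z n i) \<le> ennreal (real (Suc n) * Z) * f i x"
        proof (cases "ennreal (1 / real (Suc n)) \<le> f i x")
          case True
          have "ennreal (u n i x / z n i) \<le> ennreal ((real (Suc n) * Z) * (1 / real (Suc n)))"
            using True Z[OF i] by (intro ennreal_leI) (simp add: u_def)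
          also have "\<dots> = ennreal (real (Suc n) * Z) * ennreal (1 / real (Suc n))"
            using Zp by (intro ennreal_mult) auto
          also have "\<dots> \<le> ennreal (real (Suc n) * Z) * f i x" using True by (intro mult_left_mono) auto
          finally show ?thesis .
        qed (simp add: u_def)
        then show "ennreal (u n i x / z n i) * indicator A x \<le> ennreal (real (Suc n) * Z) * (f i x * indicator A x)"
          by (simp add: indicator_def)
      qed
      also have "\<dots> = ennreal (real (Suc n) * Z) * (\<integral>\<^sup>+x\<in>A. f i x \<partial>lborel)"
        using f[OF i] A by (intro nn_integral_cmult) auto
      also have "\<dots> \<le> ennreal (real (Suc n) * Z) * emeasure (\<mu> i) A" by (intro mult_left_mono ge i A) auto
      finally have "emeasure (\<eta> i) A \<le> ennreal C0 * (ennreal (real (Suc n) * Z) * emeasure (\<mu> i) A)"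
        using le_leb[OF i A] by (meson mult_left_mono order_trans zero_le)
      then show ?thesis using C0 Zp by (simp add: ennreal_mult mult.assoc)
    qed
  qed
qed

end

subsection \<open>Product measures\<close>

text \<open>Each coordinate costs one factor \<open>C\<close>; the resulting exponential in the
  number of points is negligible at the quadratic scale of the energy.\<close>

lemma nn_integral_PiM_le_scaled:
  assumes M: "product_sigma_finite M" and N: "product_sigma_finite N" and I: "finite I"
    and s: "\<And>i. sets (N i) = sets (M i)"
    and le: "\<And>i A. i \<in> I \<Longrightarrow> A \<in> sets (M i) \<Longrightarrow> emeasure (N i) A \<le> ennreal C * emeasure (M i) A"
    and f: "f \<in> borel_measurable (PiM I M)"
  shows "(\<integral>\<^sup>+x. f x \<partial>PiM I N) \<le> ennreal C ^ card I * (\<integral>\<^sup>+x. f x \<partial>PiM I M)"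
  using I le f
proof (induction I arbitrary: f)
  case empty
  interpret M: product_sigma_finite M by fact
  interpret N: product_sigma_finite N by fact
  show ?case by (simp add: M.nn_integral_empty N.nn_integral_empty)
next
  case (insert i I)
  interpret M: product_sigma_finite M by fact
  interpret N: product_sigma_finite N by fact
  have sP: "sets (PiM J N) = sets (PiM J M)" for J using s by (intro sets_PiM_cong) auto
  have fN: "f \<in> borel_measurable (PiM (insert i I) N)"
    using insert.prems(2) measurable_cong_sets[OF sP refl] by blast
  have "(\<lambda>(x, y). f (x(i := y))) \<in> borel_measurable (PiM I M \<Otimes>\<^sub>M M i)"
    using measurable_compose[OF measurable_add_dim insert.prems(2)] by (simp only: case_prod_unfold)
  then have inner: "(\<lambda>x. \<integral>\<^sup>+y. f (x(i := y)) \<partial>M i) \<in> borel_measurable (PiM I M)"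
    by (rule sigma_finite_measure.borel_measurable_nn_integral[OF M.sigma_finite_measures])
  have "(\<integral>\<^sup>+x. f x \<partial>PiM (insert i I) N) = (\<integral>\<^sup>+x. (\<integral>\<^sup>+y. f (x(i := y)) \<partial>N i) \<partial>PiM I N)"
    by (rule N.product_nn_integral_insert[OF insert.hyps(1,2) fN])
  also have "\<dots> \<le> (\<integral>\<^sup>+x. ennreal C * (\<integral>\<^sup>+y. f (x(i := y)) \<partial>M i) \<partial>PiM I N)"
  proof (rule nn_integral_mono)
    fix x assume "x \<in> space (PiM I N)"
    then have "x \<in> space (PiM I M)" using sets_eq_imp_space_eq[OF sP] by simp
    then have "(\<lambda>y. f (x(i := y))) \<in> borel_measurable (M i)"
      using insert.prems(2) insert.hyps(2) by (intro measurable_compose[OF measurable_component_update]) auto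
    then show "(\<integral>\<^sup>+y. f (x(i := y)) \<partial>N i) \<le> ennreal C * (\<integral>\<^sup>+y. f (x(i := y)) \<partial>M i)"
      by (intro nn_integral_le_scaled s insert.prems(1)) auto
  qed
  also have "\<dots> \<le> ennreal C ^ card I * (\<integral>\<^sup>+x. ennreal C * (\<integral>\<^sup>+y. f (x(i := y)) \<partial>M i) \<partial>PiM I M)"
  proof (rule insert.IH)
    show "(\<lambda>x. ennreal C * (\<integral>\<^sup>+y. f (x(i := y)) \<partial>M i)) \<in> borel_measurable (PiM I M)"
      using inner by measurable
  qed (use insert.prems(1) in auto)
  also have "(\<integral>\<^sup>+x. ennreal C * (\<integral>\<^sup>+y. f (x(i := y)) \<partial>M i) \<partial>PiM I M) = ennreal C * (\<integral>\<^sup>+x. f x \<partial>PiM (insert i I) M)"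
    unfolding M.product_nn_integral_insert[OF insert.hyps(1,2) insert.prems(2)] by (rule nn_integral_cmult[OF inner])
  finally show ?case using insert.hyps by (simp add: mult_ac)
qed

text \<open>Pair marginals reduce the mean interaction of independent points to the integrals
  \<open>log_form\<close>.\<close>

lemma distr_PiM_pair:
  assumes M: "product_sigma_finite M" and P: "\<And>i. prob_space (M i)" and I: "finite I" and i: "i \<in> I" "j \<in> I" "i \<noteq> j"
  shows "distr (PiM I M) (M i \<Otimes>\<^sub>M M j) (\<lambda>x. (x i, x j)) = M i \<Otimes>\<^sub>M M j"
proof (rule pair_measure_eqI[symmetric])
  interpret M: product_sigma_finite M by fact
  show "sigma_finite_measure (M i)" "sigma_finite_measure (M j)" by (rule M.sigma_finite_measures)+
  fix A B assume AB: "A \<in> sets (M i)" "B \<in> sets (M j)"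
  let ?F = "\<lambda>k. if k = i then A else if k = j then B else space (M k)"
  have "(\<lambda>x. (x i, x j)) -` (A \<times> B) \<inter> space (PiM I M) = Pi\<^sub>E I ?F"
  proof (intro Set.set_eqI iffI)
    fix x assume "x \<in> (\<lambda>x. (x i, x j)) -` (A \<times> B) \<inter> space (PiM I M)"
    then show "x \<in> Pi\<^sub>E I ?F" by (auto simp: space_PiM PiE_iff)
  next
    fix x assume x: "x \<in> Pi\<^sub>E I ?F"
    then have xij: "x i \<in> A" "x j \<in> B" using PiE_mem[OF x i(1)] PiE_mem[OF x i(2)] i(3) by auto
    have "x k \<in> space (M k)" if "k \<in> I" for k
      using x that AB[THEN sets.sets_into_space] by (cases "k = i"; cases "k = j") (auto simp: PiE_iff dest!: bspec)
    with xij x show "x \<in> (\<lambda>x. (x i, x j)) -` (A \<times> B) \<inter> space (PiM I M)" by (auto simp: space_PiM PiE_iff)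
  qed
  moreover have "(\<lambda>x. (x i, x j)) \<in> measurable (PiM I M) (M i \<Otimes>\<^sub>M M j)"
    using i by (intro measurable_Pair measurable_component_singleton)
  ultimately have "emeasure (distr (PiM I M) (M i \<Otimes>\<^sub>M M j) (\<lambda>x. (x i, x j))) (A \<times> B) = emeasure (PiM I M) (Pi\<^sub>E I ?F)"
    using AB by (subst emeasure_distr) auto
  also have "\<dots> = (\<Prod>k\<in>I. emeasure (M k) (?F k))" using AB I by (intro M.emeasure_PiM) auto
  also have "\<dots> = (\<Prod>k\<in>{i, j}. emeasure (M k) (?F k))"
    using i I prob_space.emeasure_space_1[OF P] by (intro prod.mono_neutral_right) auto
  also have "\<dots> = emeasure (M i) A * emeasure (M j) B" using i by simp
  finally show "emeasure (M i) A * emeasure (M j) B = emeasure (distr (PiM I M) (M i \<Otimes>\<^sub>M M j) (\<lambda>x. (x i, x j))) (A \<times> B)" ..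
qed simp

text \<open>The minorant \<open>1 + c - H\<close> in Jensen's inequality may be negative;
  \<open>ennreal\<close> then replaces it by 0, which can only raise the integral.\<close>

lemma ennreal_integral_le_nn_integral:
  fixes h :: "'a \<Rightarrow> real"
  assumes "integrable M h"
  shows "ennreal (\<integral>x. h x \<partial>M) \<le> (\<integral>\<^sup>+x. ennreal (h x) \<partial>M)"
proof -
  have i: "integrable M (\<lambda>x. max 0 (h x))" using assms by (intro integrable_max integrable_zero)
  have "ennreal (\<integral>x. h x \<partial>M) \<le> ennreal (\<integral>x. max 0 (h x) \<partial>M)"
    using assms i by (intro ennreal_leI integral_mono) auto
  also have "\<dots> = (\<integral>\<^sup>+x. ennreal (max 0 (h x)) \<partial>M)"
    by (rule nn_integral_eq_integral[OF i, symmetric]) auto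
  also have "\<dots> = (\<integral>\<^sup>+x. ennreal (h x) \<partial>M)"
    by (intro nn_integral_cong) (auto simp: max_def ennreal_neg)
  finally show ?thesis .
qed

subsection \<open>The weight of a configuration\<close>

text \<open>Minus its logarithm is the logarithmic energy of the configuration with the diagonal
  left out; the exponents equal twice the \<open>coupling\<close>.\<close>

definition weight :: "nat \<Rightarrow> (nat \<Rightarrow> nat) \<Rightarrow> (nat \<Rightarrow> real) \<Rightarrow> real" where
  "weight n g x = (\<Prod>m<n. \<Prod>m'<m. \<bar>x m - x m'\<bar> ^ (if g m = g m' then 2 else 1))"

lemma weight_nonneg: "0 \<le> weight n g x" unfolding weight_def by (intro prod_nonneg ballI) auto

lemma sum_pairs_lt:
  fixes h :: "nat \<Rightarrow> nat \<Rightarrow> real"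
  assumes "\<And>m m'. h m m' = h m' m"
  shows "(\<Sum>m<n. \<Sum>m'<n. h m m') = (\<Sum>m<n. \<Sum>m'<m. 2 * h m m') + (\<Sum>m<n. h m m)"
proof (induction n)
  case (Suc n)
  have "(\<Sum>m<n. h m n) = (\<Sum>m<n. h n m)" using assms by (intro sum.cong) auto
  then show ?case using Suc by (simp add: sum.distrib sum_distrib_left[symmetric])
qed simp

lemma weight_measurable [measurable]:
  assumes "\<And>m. m < n \<Longrightarrow> sets (M m) = sets borel"
  shows "weight n g \<in> borel_measurable (PiM {..<n} M)"
  unfolding weight_def
proof (intro borel_measurable_prod borel_measurable_power borel_measurable_abs borel_measurable_diff)
  fix m m' assume m: "m \<in> {..<n}" "m' \<in> {..<m}"
  have "(\<lambda>x. x k) \<in> borel_measurable (PiM {..<n} M)" if k: "k < n" for k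
    unfolding measurable_cong_sets[OF refl assms[OF k], symmetric]
    by (rule measurable_component_singleton) (use k in auto)
  then show "(\<lambda>x. x m) \<in> borel_measurable (PiM {..<n} M)" "(\<lambda>x. x m') \<in> borel_measurable (PiM {..<n} M)"
    using m by auto
qed

text \<open>The truncated kernel lies below \<open>- ln\<close>, and at coinciding points the weight
  is 0. Completing the double sum by its diagonal accounts for
  \<open>real n * trunc_log d L 0\<close>.\<close>

lemma weight_le_exp:
  assumes d: "0 < d" and L: "\<And>m m'. m < n \<Longrightarrow> m' < n \<Longrightarrow> \<bar>x m - x m'\<bar> \<le> L"
  shows "weight n g x \<le> exp (- ((\<Sum>m<n. \<Sum>m'<n. coupling (g m) (g m') * trunc_log d L (x m - x m')) - real n * trunc_log d L 0))"
proof -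
  have "weight n g x \<le> (\<Prod>m<n. \<Prod>m'<m. exp (- (2 * (coupling (g m) (g m') * trunc_log d L (x m - x m')))))"
    unfolding weight_def
  proof (intro prod_mono conjI prod_nonneg ballI)
    fix m m' assume m: "m \<in> {..<n}" "m' \<in> {..<m}"
    show "\<bar>x m - x m'\<bar> ^ (if g m = g m' then 2 else 1) \<le> exp (- (2 * (coupling (g m) (g m') * trunc_log d L (x m - x m'))))"
    proof (cases "x m = x m'")
      case False
      have "\<bar>x m - x m'\<bar> = exp (ln \<bar>x m - x m'\<bar>)" using False by simp
      also have "\<dots> \<le> exp (- trunc_log d L (x m - x m'))"
        by (rule exp_le_cancel_iff[THEN iffD2]) (use trunc_log_le_ln[OF d L, of m m'] m False in auto)
      finally have le: "\<bar>x m - x m'\<bar> \<le> exp (- trunc_log d L (x m - x m'))" .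
      have "\<bar>x m - x m'\<bar> ^ 2 \<le> exp (- trunc_log d L (x m - x m')) ^ 2" by (rule power_mono[OF le]) simp
      then show ?thesis using le by (auto simp: coupling_def exp_of_nat_mult[of 2, simplified, symmetric] exp_double)
    qed auto
  qed auto
  also have "\<dots> = exp (- (\<Sum>m<n. \<Sum>m'<m. 2 * (coupling (g m) (g m') * trunc_log d L (x m - x m'))))"
    by (simp add: exp_sum sum_negf[symmetric])
  also have "(\<Sum>m<n. \<Sum>m'<m. 2 * (coupling (g m) (g m') * trunc_log d L (x m - x m')))
      = (\<Sum>m<n. \<Sum>m'<n. coupling (g m) (g m') * trunc_log d L (x m - x m')) - real n * trunc_log d L 0"
  proof -
    have "trunc_log d L (x m - x m') = trunc_log d L (x m' - x m)" for m m' using trunc_log_minus[of d L "x m - x m'"] by simp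
    then have "(\<Sum>m<n. \<Sum>m'<n. coupling (g m) (g m') * trunc_log d L (x m - x m'))
      = (\<Sum>m<n. \<Sum>m'<m. 2 * (coupling (g m) (g m') * trunc_log d L (x m - x m'))) + (\<Sum>m<n. coupling (g m) (g m) * trunc_log d L (x m - x m))"
      by (intro sum_pairs_lt) (simp add: coupling_commute)
    then show ?thesis by (simp add: coupling_def)
  qed
  finally show ?thesis .
qed

lemma weight_eq_exp:
  assumes "\<And>m m'. m < n \<Longrightarrow> m' < m \<Longrightarrow> x m \<noteq> x m'"
  shows "weight n g x = exp (- (\<Sum>m<n. \<Sum>m'<m. 2 * coupling (g m) (g m') * - ln \<bar>x m - x m'\<bar>))"
proof -
  have "\<bar>x m - x m'\<bar> ^ (if g m = g m' then 2 else 1) = exp (- (2 * coupling (g m) (g m') * - ln \<bar>x m - x m'\<bar>))"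
    if "m < n" "m' < m" for m m'
    using assms[OF that] by (auto simp: coupling_def exp_double)
  then have "weight n g x = (\<Prod>m<n. \<Prod>m'<m. exp (- (2 * coupling (g m) (g m') * - ln \<bar>x m - x m'\<bar>)))"
    unfolding weight_def by (intro prod.cong refl) auto
  then show ?thesis by (simp add: exp_sum sum_negf[symmetric])
qed

text \<open>Jensen's inequality for the exponential function, in the form \<open>1 + c - H \<le> exp (c - H)\<close>.\<close>

lemma weight_integral_ge:
  assumes g: "\<And>m. g m < r" and \<eta>: "\<And>i. i < r \<Longrightarrow> fin_borel (\<eta> i)" "\<And>i. i < r \<Longrightarrow> mass (\<eta> i) = 1"
    and int: "\<And>j k. j < r \<Longrightarrow> k < r \<Longrightarrow> integrable (\<eta> j \<Otimes>\<^sub>M \<eta> k) (\<lambda>z. - ln \<bar>fst z - snd z\<bar>)"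
    and ne: "\<And>j k. j < r \<Longrightarrow> k < r \<Longrightarrow> AE z in \<eta> j \<Otimes>\<^sub>M \<eta> k. fst z \<noteq> snd z"
  shows "ennreal (exp (- ((\<Sum>m<n. \<Sum>m'<n. coupling (g m) (g m') * log_form (\<eta> (g m)) (\<eta> (g m'))) - (\<Sum>m<n. log_form (\<eta> (g m)) (\<eta> (g m))))))
    \<le> (\<integral>\<^sup>+x. ennreal (weight n g x) \<partial>PiM {..<n} (\<lambda>m. \<eta> (g m)))"
proof -
  define M where "M = (\<lambda>m. \<eta> (g m))"
  have fb: "fin_borel (M m)" for m unfolding M_def by (rule \<eta>(1)[OF g])
  have prob: "prob_space (M m)" for m
    using mass_eq_emeasure[OF fb, of m] \<eta>(2)[OF g, of m] fin_borelD(2)[OF fb, of m] by (intro prob_spaceI) (simp add: M_def)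
  have psf: "product_sigma_finite M"
    by (rule product_sigma_finite.intro) (rule prob_space_imp_sigma_finite[OF prob])
  let ?P = "PiM {..<n} M"
  interpret P: prob_space ?P by (rule prob_space_PiM) (rule prob)
  have pair: "distr ?P (M m \<Otimes>\<^sub>M M m') (\<lambda>x. (x m, x m')) = M m \<Otimes>\<^sub>M M m'" if "m < n" "m' < m" for m m'
    by (rule distr_PiM_pair[OF psf prob]) (use that in auto)
  have pm: "(\<lambda>x. (x m, x m')) \<in> measurable ?P (M m \<Otimes>\<^sub>M M m')" if "m < n" "m' < m" for m m'
    using that by (intro measurable_Pair measurable_component_singleton) auto
  let ?l = "\<lambda>m m' x. - ln \<bar>x m - x m'\<bar>"
  have lm: "(\<lambda>z. - ln \<bar>fst z - snd z\<bar>) \<in> borel_measurable (M m \<Otimes>\<^sub>M M m')" for m m'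
    using int[OF g g, of m m'] by (auto simp: M_def)
  have li: "integrable ?P (?l m m')" and lI: "(\<integral>x. ?l m m' x \<partial>?P) = log_form (M m) (M m')" if "m < n" "m' < m" for m m'
  proof -
    have "integrable (M m \<Otimes>\<^sub>M M m') (\<lambda>z. - ln \<bar>fst z - snd z\<bar>)" unfolding M_def by (rule int[OF g g])
    then show "integrable ?P (?l m m')"
      using integrable_distr_eq[OF pm[OF that] lm[of m m']] unfolding pair[OF that] by simp
    show "(\<integral>x. ?l m m' x \<partial>?P) = log_form (M m) (M m')"
      using integral_distr[OF pm[OF that] lm[of m m']] unfolding pair[OF that] log_form_def by simp
  qed
  define H where "H = (\<lambda>x. \<Sum>m<n. \<Sum>m'<m. 2 * coupling (g m) (g m') * ?l m m' x)"
  define c where "c = (\<Sum>m<n. \<Sum>m'<m. 2 * coupling (g m) (g m') * log_form (M m) (M m'))"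
  have Hi: "integrable ?P H" unfolding H_def
    by (intro Bochner_Integration.integrable_sum integrable_mult_right li) auto
  have HI: "(\<integral>x. H x \<partial>?P) = c"
  proof -
    have "(\<integral>x. H x \<partial>?P) = (\<Sum>m<n. \<integral>x. (\<Sum>m'<m. 2 * coupling (g m) (g m') * ?l m m' x) \<partial>?P)"
      unfolding H_def by (intro Bochner_Integration.integral_sum Bochner_Integration.integrable_sum integrable_mult_right li) auto
    also have "\<dots> = (\<Sum>m<n. \<Sum>m'<m. \<integral>x. 2 * coupling (g m) (g m') * ?l m m' x \<partial>?P)"
      by (intro sum.cong refl Bochner_Integration.integral_sum integrable_mult_right li) auto
    also have "\<dots> = c" unfolding c_def
    proof (intro sum.cong refl)
      fix m m' assume "m \<in> {..<n}" "m' \<in> {..<m}"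
      then have "(\<integral>x. ?l m m' x \<partial>?P) = log_form (M m) (M m')" by (intro lI) auto
      then show "(\<integral>x. 2 * coupling (g m) (g m') * ?l m m' x \<partial>?P) = 2 * coupling (g m) (g m') * log_form (M m) (M m')"
        by (simp only: integral_mult_right_zero)
    qed
    finally show ?thesis .
  qed
  \<comment> \<open>Null diagonals of the pair marginals make the points distinct almost everywhere,
    as \<open>weight_eq_exp\<close> requires.\<close>
  have ae: "AE x in ?P. \<forall>m\<in>{..<n}. \<forall>m'\<in>{..<m}. x m \<noteq> x m'"
  proof (intro eventually_ball_finite ballI)
    fix m m' assume "m \<in> {..<n}" "m' \<in> {..<m}"
    then have m: "m < n" "m' < m" by auto
    have "AE z in distr ?P (M m \<Otimes>\<^sub>M M m') (\<lambda>x. (x m, x m')). fst z \<noteq> snd z"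
      unfolding pair[OF m] unfolding M_def by (rule ne[OF g g])
    from AE_distrD[OF pm[OF m] this] show "AE x in ?P. x m \<noteq> x m'" by simp
  qed auto
  have "ennreal (exp (- c)) = ennreal (\<integral>x. exp (- c) * (1 + c - H x) \<partial>?P)"
    using Hi HI by (simp add: P.prob_space)
  also have "\<dots> \<le> (\<integral>\<^sup>+x. ennreal (exp (- c) * (1 + c - H x)) \<partial>?P)"
    using Hi by (intro ennreal_integral_le_nn_integral integrable_mult_right Bochner_Integration.integrable_diff) auto
  also have "\<dots> \<le> (\<integral>\<^sup>+x. ennreal (weight n g x) \<partial>?P)"
  proof (rule nn_integral_mono_AE, rule eventually_mono[OF ae])
    fix x :: "nat \<Rightarrow> real" assume x: "\<forall>m\<in>{..<n}. \<forall>m'\<in>{..<m}. x m \<noteq> x m'"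
    have "exp (- c) * (1 + c - H x) \<le> exp (- c) * exp (c - H x)"
    proof (rule mult_left_mono)
      show "1 + c - H x \<le> exp (c - H x)" using exp_ge_add_one_self[of "c - H x"] by linarith
    qed simp
    also have "\<dots> = exp (- H x)" by (simp add: exp_add[symmetric])
    also have "\<dots> = weight n g x" unfolding H_def using x by (intro weight_eq_exp[symmetric]) auto
    finally show "ennreal (exp (- c) * (1 + c - H x)) \<le> ennreal (weight n g x)" by (rule ennreal_leI)
  qed
  also have "c = (\<Sum>m<n. \<Sum>m'<n. coupling (g m) (g m') * log_form (M m) (M m')) - (\<Sum>m<n. log_form (M m) (M m))"
  proof -
    have "(\<Sum>m<n. \<Sum>m'<n. coupling (g m) (g m') * log_form (M m) (M m'))
      = (\<Sum>m<n. \<Sum>m'<m. 2 * (coupling (g m) (g m') * log_form (M m) (M m'))) + (\<Sum>m<n. coupling (g m) (g m) * log_form (M m) (M m))"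
      by (rule sum_pairs_lt) (simp add: coupling_commute log_form_commute[OF fb fb])
    then show ?thesis by (simp add: c_def coupling_def mult.assoc)
  qed
  finally show ?thesis by (simp only: M_def)
qed

subsection \<open>Determinants along a path\<close>

text \<open>Step \<open>m\<close> of the path raises the index of the label \<open>g m\<close> from
  this value by one. Coordinate \<open>m\<close> accordingly receives the monomial of this
  degree.\<close>

definition label_rank :: "(nat \<Rightarrow> nat) \<Rightarrow> nat \<Rightarrow> nat" where
  "label_rank g m = card {m'. m' < m \<and> g m' = g m}"

text \<open>Within one label the ranks run through 0, 1, 2, ... without gaps, so a sum over its
  coordinates is a sum over exponents.\<close>

lemma sum_label_rank:
  fixes \<phi> :: "nat \<Rightarrow> real"
  shows "(\<Sum>k<n. if g k = j then \<phi> (label_rank g k) else 0) = (\<Sum>e<card {k. k < n \<and> g k = j}. \<phi> e)"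
proof (induction n)
  case (Suc n)
  show ?case
  proof (cases "g n = j")
    case True
    then have "{k. k < Suc n \<and> g k = j} = insert n {k. k < n \<and> g k = j}" by (auto simp: less_Suc_eq)
    moreover have "label_rank g n = card {k. k < n \<and> g k = j}" using True by (simp add: label_rank_def)
    ultimately show ?thesis using Suc True by simp
  next
    case False
    then have "{k. k < Suc n \<and> g k = j} = {k. k < n \<and> g k = j}" by (auto simp: less_Suc_eq)
    then show ?thesis using Suc False by simp
  qed
qed simp

lemma poly_eq_sum_labels:
  fixes R :: "real poly"
  assumes m: "m < n" and R: "degree R = label_rank g m"
  shows "poly R y = (\<Sum>k<n. if g k = g m then coeff R (label_rank g k) * y ^ label_rank g k else 0)"
proof -
  let ?c = "card {k. k < n \<and> g k = g m}"
  have "{k. k < m \<and> g k = g m} \<subset> {k. k < n \<and> g k = g m}" using m by auto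
  then have lt: "label_rank g m < ?c" unfolding label_rank_def by (intro psubset_card_mono) auto
  have "poly R y = (\<Sum>e\<le>label_rank g m. coeff R e * y ^ e)" by (simp add: poly_altdef R)
  also have "\<dots> = (\<Sum>e<?c. coeff R e * y ^ e)"
    using lt R by (intro sum.mono_neutral_left) (auto simp: coeff_eq_0)
  also have "\<dots> = (\<Sum>k<n. if g k = g m then coeff R (label_rank g k) * y ^ label_rank g k else 0)"
    by (rule sum_label_rank[symmetric])
  finally show ?thesis .
qed

text \<open>Within one label the rank increases with the position, so the change of basis from
  monomials to monic polynomials is triangular with unit diagonal. It is transposed in order to
  apply \<open>det_upper_triangular\<close>.\<close>

lemma det_monic_eq_monomial:
  fixes R :: "nat \<Rightarrow> real poly" and x :: "nat \<Rightarrow> real"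
  assumes R: "\<And>m. m < n \<Longrightarrow> degree (R m) = label_rank g m" "\<And>m. m < n \<Longrightarrow> lead_coeff (R m) = 1"
  shows "det (mat n n (\<lambda>(m, l). if g m = g l then poly (R m) (x l) else 0))
    = det (mat n n (\<lambda>(m, l). if g m = g l then x l ^ label_rank g m else 0))"
proof -
  let ?A = "mat n n (\<lambda>(m, l). if g m = g l then x l ^ label_rank g m else 0)"
  let ?U = "mat n n (\<lambda>(m, k). if g k = g m then coeff (R m) (label_rank g k) else 0)"
  have label_rank_less: "label_rank g m < label_rank g k" if "m < k" "g m = g k" for m k
    unfolding label_rank_def using that by (intro psubset_card_mono) auto
  have "det ?U = 1"
  proof -
    have "upper_triangular (transpose_mat ?U)"
      using R label_rank_less by (auto simp: upper_triangular_def coeff_eq_0)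
    moreover have "diag_mat (transpose_mat ?U) = map (\<lambda>_. 1) [0..<n]"
      using R by (auto simp: diag_mat_def)
    ultimately have "det (transpose_mat ?U) = prod_list (map (\<lambda>_. 1) [0..<n])"
      using det_upper_triangular[of "transpose_mat ?U" n] by simp
    then show ?thesis using det_transpose[of ?U n] by (simp add: map_replicate_const)
  qed
  moreover have "mat n n (\<lambda>(m, l). if g m = g l then poly (R m) (x l) else 0) = ?U * ?A"
  proof (rule eq_matI)
    fix m l assume ml: "m < dim_row (?U * ?A)" "l < dim_col (?U * ?A)"
    then have m: "m < n" "l < n" by auto
    have "(?U * ?A) $$ (m, l) = (\<Sum>k<n. (if g k = g m then coeff (R m) (label_rank g k) else 0) * (if g k = g l then x l ^ label_rank g k else 0))"
      using m by (auto simp: scalar_prod_def lessThan_atLeast0 intro!: sum.cong)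
    also have "\<dots> = (if g m = g l then poly (R m) (x l) else 0)"
    proof (cases "g m = g l")
      case True
      then show ?thesis using poly_eq_sum_labels[OF m(1) R(1)[OF m(1)], of "x l"] by (auto intro!: sum.cong)
    next
      case False
      then show ?thesis by (auto intro!: sum.neutral)
    qed
    finally show "mat n n (\<lambda>(m, l). if g m = g l then poly (R m) (x l) else 0) $$ (m, l) = (?U * ?A) $$ (m, l)"
      using m by simp
  qed auto
  ultimately show ?thesis using det_mult[of ?U n ?A] by simp
qed

text \<open>Newton basis: \<open>R m\<close> vanishes at all earlier points with the same label, so
  the matrix of its values is upper triangular and the determinant is read off the diagonal.\<close>

lemma det_labelled_vandermonde:
  fixes x :: "nat \<Rightarrow> real"
  shows "det (mat n n (\<lambda>(m, l). if g m = g l then x l ^ label_rank g m else 0))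
    = (\<Prod>l<n. \<Prod>m<l. if g m = g l then x l - x m else 1)"
proof -
  define R where "R = (\<lambda>m. \<Prod>m'\<in>{m'. m' < m \<and> g m' = g m}. [:- x m', 1:])"
  have R: "degree (R m) = label_rank g m" "lead_coeff (R m) = 1" for m
  proof -
    show "degree (R m) = label_rank g m" unfolding R_def label_rank_def
      by (subst degree_prod_eq_sum_degree) auto
    show "lead_coeff (R m) = 1" unfolding R_def by (simp add: lead_coeff_prod)
  qed
  have pR: "poly (R m) y = (\<Prod>m'\<in>{m'. m' < m \<and> g m' = g m}. y - x m')" for m y
    by (simp add: R_def poly_prod)
  let ?B = "mat n n (\<lambda>(m, l). if g m = g l then poly (R m) (x l) else 0)"
  have "upper_triangular ?B"
  proof -
    have "poly (R m) (x l) = 0" if "l < m" "g m = g l" for m l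
      unfolding pR using that by (intro prod_zero) auto
    then show ?thesis by (auto simp: upper_triangular_def)
  qed
  then have "det ?B = prod_list (diag_mat ?B)" by (rule det_upper_triangular[where n=n]) simp
  also have "\<dots> = (\<Prod>l<n. poly (R l) (x l))"
    by (simp add: diag_mat_def prod.list_conv_set_nth atLeast0LessThan)
  also have "\<dots> = (\<Prod>l<n. \<Prod>m<l. if g m = g l then x l - x m else 1)"
    unfolding pR
  proof (rule prod.cong[OF refl])
    fix l
    show "(\<Prod>m'\<in>{m'. m' < l \<and> g m' = g l}. x l - x m') = (\<Prod>m<l. if g m = g l then x l - x m else 1)"
      using prod.inter_filter[of "{..<l}" "\<lambda>m. x l - x m" "\<lambda>m. g m = g l"] by simp
  qed
  finally show ?thesis using det_monic_eq_monomial[of n R g x] R by simp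
qed

text \<open>With a single label the rank is the position, and the ordinary Vandermonde determinant
  results.\<close>

lemma det_vandermonde_monic:
  fixes R :: "nat \<Rightarrow> real poly" and x :: "nat \<Rightarrow> real"
  assumes "\<And>m. m < n \<Longrightarrow> degree (R m) = m" "\<And>m. m < n \<Longrightarrow> lead_coeff (R m) = 1"
  shows "det (mat n n (\<lambda>(m, l). poly (R m) (x l))) = (\<Prod>l<n. \<Prod>m<l. x l - x m)"
proof -
  have label_rank: "label_rank (\<lambda>_. 0) m = m" for m by (simp add: label_rank_def)
  show ?thesis
    using det_monic_eq_monomial[of n R "\<lambda>_. 0" x] det_labelled_vandermonde[of n "\<lambda>_. 0" x] assms label_rank by simp
qed

text \<open>Derivative of \<open>det (G + t F G)\<close> at \<open>t = 0\<close>, expanded along columns.\<close>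

lemma sum_det_replace_col:
  fixes G F :: "real mat"
  assumes G: "G \<in> carrier_mat n n" and F: "F \<in> carrier_mat n n"
  shows "(\<Sum>m<n. det (mat n n (\<lambda>(k, l). if l = m then (F * G) $$ (k, l) else G $$ (k, l)))) = (\<Sum>k<n. F $$ (k, k)) * det G"
proof -
  let ?R = "\<lambda>m. mat n n (\<lambda>(k, l). if l = m then (F * G) $$ (k, l) else G $$ (k, l))"
  have adj: "adj_mat G \<in> carrier_mat n n" "G * adj_mat G = det G \<cdot>\<^sub>m 1\<^sub>m n" using adj_mat[OF G] by auto
  have det: "det (?R m) = (\<Sum>k<n. (F * G) $$ (k, m) * adj_mat G $$ (m, k))" if m: "m < n" for m
  proof -
    have "det (?R m) = (\<Sum>k<n. ?R m $$ (k, m) * cofactor (?R m) k m)"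
      by (rule laplace_expansion_column[of _ n]) (use m in auto)
    also have "\<dots> = (\<Sum>k<n. (F * G) $$ (k, m) * adj_mat G $$ (m, k))"
    proof (intro sum.cong refl)
      fix k assume k: "k \<in> {..<n}"
      \<comment> \<open>Deleting column \<open>m\<close> removes the only altered column.\<close>
      have "mat_delete (?R m) k m = mat_delete G k m"
        using G k m by (intro eq_matI) (auto simp: mat_delete_def)
      then have "cofactor (?R m) k m = adj_mat G $$ (m, k)"
        using G k m by (simp add: adj_mat_def cofactor_def)
      then show "?R m $$ (k, m) * cofactor (?R m) k m = (F * G) $$ (k, m) * adj_mat G $$ (m, k)"
        using k m by simp
    qed
    finally show ?thesis .
  qed
  have "(\<Sum>m<n. det (?R m)) = (\<Sum>m<n. \<Sum>k<n. (F * G) $$ (k, m) * adj_mat G $$ (m, k))"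
    by (intro sum.cong refl det) simp
  also have "\<dots> = (\<Sum>k<n. \<Sum>m<n. (F * G) $$ (k, m) * adj_mat G $$ (m, k))" by (rule sum.swap)
  also have "\<dots> = (\<Sum>k<n. (F * G * adj_mat G) $$ (k, k))"
    using G F adj(1) by (intro sum.cong refl) (simp add: scalar_prod_def lessThan_atLeast0 del: assoc_mult_mat)
  also have "\<dots> = (\<Sum>k<n. det G * F $$ (k, k))"
  proof (intro sum.cong refl)
    fix k assume k: "k \<in> {..<n}"
    have "F * G * adj_mat G = F * (det G \<cdot>\<^sub>m 1\<^sub>m n)"
      using assoc_mult_mat[OF F G adj(1)] adj(2) by simp
    also have "\<dots> = det G \<cdot>\<^sub>m F" using F by (simp add: mult_smult_distrib[OF F one_carrier_mat])
    finally show "(F * G * adj_mat G) $$ (k, k) = det G * F $$ (k, k)" using F k by simp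
  qed
  also have "\<dots> = (\<Sum>k<n. F $$ (k, k)) * det G" by (simp add: sum_distrib_left mult.commute)
  finally show ?thesis .
qed

subsection \<open>The biorthogonal ensemble\<close>

text \<open>The permutation acts on the row index, so that each factor of a term depends on a single
  point.\<close>

lemma det_leibniz_transposed:
  "det (mat n n (\<lambda>(k, l). h k l)) = (\<Sum>\<sigma> | \<sigma> permutes {0..<n}. signof \<sigma> * (\<Prod>l<n. h (\<sigma> l) l))" for h :: "nat \<Rightarrow> nat \<Rightarrow> real"
proof -
  let ?A = "mat n n (\<lambda>(k, l). h k l)"
  have "det ?A = det (transpose_mat ?A)" by (rule det_transpose[symmetric, of _ n]) simp
  also have "\<dots> = (\<Sum>\<sigma> | \<sigma> permutes {0..<n}. signof \<sigma> * (\<Prod>l = 0..<n. transpose_mat ?A $$ (l, \<sigma> l)))"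
    by (rule det_def') simp
  also have "\<dots> = (\<Sum>\<sigma> | \<sigma> permutes {0..<n}. signof \<sigma> * (\<Prod>l<n. h (\<sigma> l) l))"
  proof (intro sum.cong refl arg_cong2[where f="(*)"])
    fix \<sigma> assume "\<sigma> \<in> {\<sigma>. \<sigma> permutes {0..<n}}"
    then have "\<sigma> l < n" if "l < n" for l using that permutes_in_image[of \<sigma> "{0..<n}" l] by auto
    then show "(\<Prod>l = 0..<n. transpose_mat ?A $$ (l, \<sigma> l)) = (\<Prod>l<n. h (\<sigma> l) l)"
      unfolding atLeast0LessThan by (intro prod.cong refl) auto
  qed
  finally show ?thesis .
qed

lemma finite_permutations_lt: "finite {\<sigma>. \<sigma> permutes {0..<n::nat}}"
  by (rule finite_permutations) simp

text \<open>Every Leibniz term factors over the coordinates, so the product measure integrates it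
  factor by factor. This is Andreief's identity with one determinant left as a product, hence
  without a factorial.\<close>

lemma integral_det_prod:
  fixes h :: "nat \<Rightarrow> real \<Rightarrow> real"
  assumes M: "product_sigma_finite M"
    and int: "\<And>k m. k < n \<Longrightarrow> m < n \<Longrightarrow> integrable (M m) (\<lambda>y. h k y * \<phi> m y)"
  shows "integrable (PiM {..<n} M) (\<lambda>x. det (mat n n (\<lambda>(k, l). h k (x l))) * (\<Prod>m<n. \<phi> m (x m)))"
    and "(\<integral>x. det (mat n n (\<lambda>(k, l). h k (x l))) * (\<Prod>m<n. \<phi> m (x m)) \<partial>PiM {..<n} M)
      = det (mat n n (\<lambda>(k, m). \<integral>y. h k y * \<phi> m y \<partial>M m))"
proof -
  interpret product_sigma_finite M by fact
  let ?S = "{\<sigma>. \<sigma> permutes {0..<n}}"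
  have e: "det (mat n n (\<lambda>(k, l). h k (x l))) * (\<Prod>m<n. \<phi> m (x m))
      = (\<Sum>\<sigma>\<in>?S. signof \<sigma> * (\<Prod>m<n. h (\<sigma> m) (x m) * \<phi> m (x m)))" for x
    by (simp add: det_leibniz_transposed sum_distrib_right prod.distrib mult.assoc)
  have lt: "\<sigma> m < n" if "\<sigma> \<in> ?S" "m < n" for \<sigma> m
    using that permutes_in_image[of \<sigma> "{0..<n}" m] by auto
  have i: "integrable (PiM {..<n} M) (\<lambda>x. \<Prod>m<n. h (\<sigma> m) (x m) * \<phi> m (x m))" if "\<sigma> \<in> ?S" for \<sigma>
    by (rule product_integrable_prod) (use int lt[OF that] in auto)
  show "integrable (PiM {..<n} M) (\<lambda>x. det (mat n n (\<lambda>(k, l). h k (x l))) * (\<Prod>m<n. \<phi> m (x m)))"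
    unfolding e by (intro Bochner_Integration.integrable_sum integrable_mult_right i)
  have "(\<integral>x. det (mat n n (\<lambda>(k, l). h k (x l))) * (\<Prod>m<n. \<phi> m (x m)) \<partial>PiM {..<n} M)
     = (\<Sum>\<sigma>\<in>?S. signof \<sigma> * (\<integral>x. (\<Prod>m<n. h (\<sigma> m) (x m) * \<phi> m (x m)) \<partial>PiM {..<n} M))"
    unfolding e by (subst Bochner_Integration.integral_sum) (auto intro!: integrable_mult_right i)
  also have "\<dots> = (\<Sum>\<sigma>\<in>?S. signof \<sigma> * (\<Prod>m<n. \<integral>y. h (\<sigma> m) y * \<phi> m y \<partial>M m))"
  proof (intro sum.cong refl arg_cong2[where f="(*)"])
    fix \<sigma> assume \<sigma>: "\<sigma> \<in> ?S"
    show "(\<integral>x. (\<Prod>m<n. h (\<sigma> m) (x m) * \<phi> m (x m)) \<partial>PiM {..<n} M) = (\<Prod>m<n. \<integral>y. h (\<sigma> m) y * \<phi> m y \<partial>M m)"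
      by (rule product_integral_prod) (use int lt[OF \<sigma>] in auto)
  qed
  also have "\<dots> = det (mat n n (\<lambda>(k, m). \<integral>y. h k y * \<phi> m y \<partial>M m))" by (rule det_leibniz_transposed[symmetric])
  finally show "(\<integral>x. det (mat n n (\<lambda>(k, l). h k (x l))) * (\<Prod>m<n. \<phi> m (x m)) \<partial>PiM {..<n} M)
      = det (mat n n (\<lambda>(k, m). \<integral>y. h k y * \<phi> m y \<partial>M m))" .
qed

text \<open>\<open>VD\<close> is, up to a constant sign, the weight of a configuration; summing the Leibniz expansion of its second
  factor over the label-preserving permutations reduces both integrals to the Gram determinant.\<close>

lemma ensemble_identity:
  fixes R :: "nat \<Rightarrow> real poly" and C :: "nat \<Rightarrow> nat \<Rightarrow> real" and f :: "real \<Rightarrow> real"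
  assumes \<mu>: "\<And>m. sigma_finite_measure (\<mu> (g m))"
    and int: "\<And>k m e. integrable (\<mu> (g m)) (\<lambda>y. poly (R k) y * y ^ e)"
    and intf: "\<And>k m e. integrable (\<mu> (g m)) (\<lambda>y. poly (R k) y * (y ^ e * f y))"
    and bio: "\<And>l k. l < n \<Longrightarrow> k < n \<Longrightarrow> (\<Sum>m<n. C l m * (\<integral>y. poly (R k) y * y ^ label_rank g m \<partial>\<mu> (g m))) = (if l = k then 1 else 0)"
  defines "P \<equiv> PiM {..<n} (\<lambda>m. \<mu> (g m))"
    and "VD \<equiv> \<lambda>x. det (mat n n (\<lambda>(k, l). poly (R k) (x l))) * det (mat n n (\<lambda>(m, l). if g m = g l then x l ^ label_rank g m else 0))"
  shows "(\<integral>x. VD x \<partial>P) \<noteq> 0"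
    and "(\<integral>x. (\<Sum>m<n. f (x m)) * VD x \<partial>P)
      = (\<Sum>k<n. \<Sum>m<n. C k m * (\<integral>y. poly (R k) y * (y ^ label_rank g m * f y) \<partial>\<mu> (g m))) * (\<integral>x. VD x \<partial>P)"
proof -
  have psf: "product_sigma_finite (\<lambda>m. \<mu> (g m))" by (rule product_sigma_finite.intro) (rule \<mu>)
  let ?V = "\<lambda>x. det (mat n n (\<lambda>(k, l). poly (R k) (x l)))"
  define Lf where "Lf = (\<lambda>m k. \<integral>y. poly (R k) y * (y ^ label_rank g m * f y) \<partial>\<mu> (g m))"
  \<comment> \<open>Gram matrix of the polynomials against the labelled monomials; biorthogonality
    says that the coefficient matrix \<open>Cm\<close> inverts its transpose.\<close>
  define G where "G = mat n n (\<lambda>(k, m). \<integral>y. poly (R k) y * y ^ label_rank g m \<partial>\<mu> (g m))"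
  define Cm where "Cm = mat n n (\<lambda>(l, m). C l m)"
  \<comment> \<open>Represents multiplication by \<open>f\<close>: the product \<open>F * G\<close>
    has the entries \<open>Lf\<close>, and the trace of \<open>F\<close> is the claimed
    mean.\<close>
  define F where "F = mat n n (\<lambda>(k, l). \<Sum>m<n. C l m * Lf m k)"
  have carr: "G \<in> carrier_mat n n" "Cm \<in> carrier_mat n n" "F \<in> carrier_mat n n" by (auto simp: G_def Cm_def F_def)
  have CG: "Cm * transpose_mat G = 1\<^sub>m n"
  proof (rule eq_matI)
    fix l k assume "l < dim_row (1\<^sub>m n :: real mat)" "k < dim_col (1\<^sub>m n :: real mat)"
    then have lk: "l < n" "k < n" by auto
    then have "(Cm * transpose_mat G) $$ (l, k) = (\<Sum>m<n. C l m * (\<integral>y. poly (R k) y * y ^ label_rank g m \<partial>\<mu> (g m)))"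
      by (simp add: Cm_def G_def scalar_prod_def lessThan_atLeast0)
    then show "(Cm * transpose_mat G) $$ (l, k) = 1\<^sub>m n $$ (l, k)" using bio[OF lk] lk by simp
  qed (auto simp: Cm_def G_def)
  then have GC: "transpose_mat G * Cm = 1\<^sub>m n"
    by (rule mat_mult_left_right_inverse[OF carr(2) transpose_carrier_mat[THEN iffD2, OF carr(1)]])
  have GC': "(\<Sum>l<n. G $$ (l, m) * C l m') = (if m = m' then 1 else 0)" if "m < n" "m' < n" for m m'
  proof -
    have "(transpose_mat G * Cm) $$ (m, m') = (\<Sum>l<n. G $$ (l, m) * C l m')"
      using that carr by (simp add: Cm_def scalar_prod_def lessThan_atLeast0)
    then show ?thesis using GC that by simp
  qed
  have detG: "det G \<noteq> 0"
  proof -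
    have "det Cm * det (transpose_mat G) = 1" using det_mult[of Cm n "transpose_mat G"] CG carr by simp
    then show ?thesis using det_transpose[OF carr(1)] by auto
  qed
  have FG: "(F * G) $$ (k, m) = Lf m k" if "k < n" "m < n" for k m
  proof -
    have "(F * G) $$ (k, m) = (\<Sum>l<n. (\<Sum>m'<n. C l m' * Lf m' k) * G $$ (l, m))"
      using that carr by (simp add: F_def scalar_prod_def lessThan_atLeast0)
    also have "\<dots> = (\<Sum>l<n. \<Sum>m'<n. (G $$ (l, m) * C l m') * Lf m' k)"
      by (simp add: sum_distrib_right sum_distrib_left mult_ac)
    also have "\<dots> = (\<Sum>m'<n. \<Sum>l<n. (G $$ (l, m) * C l m') * Lf m' k)" by (rule sum.swap)
    also have "\<dots> = (\<Sum>m'<n. (if m = m' then 1 else 0) * Lf m' k)"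
      using that by (simp add: sum_distrib_right[symmetric] GC')
    also have "\<dots> = (\<Sum>m'<n. if m = m' then Lf m' k else 0)" by (intro sum.cong refl) auto
    also have "\<dots> = Lf m k" using that by simp
    finally show ?thesis .
  qed
  \<comment> \<open>Permutations that change a label contribute nothing to the second determinant,
    because one of their factors vanishes.\<close>
  define \<Gamma> where "\<Gamma> = {\<pi>. \<pi> permutes {0..<n} \<and> (\<forall>l<n. g (\<pi> l) = g l)}"
  have fin\<Gamma>: "finite \<Gamma>" unfolding \<Gamma>_def by (rule finite_subset[OF _ finite_permutations_lt[of n]]) auto
  have id\<Gamma>: "id \<in> \<Gamma>" by (auto simp: \<Gamma>_def permutes_id)
  have lt: "\<pi> m < n" if "\<pi> \<in> \<Gamma>" "m < n" for \<pi> m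
    using that permutes_in_image[of \<pi> "{0..<n}" m] by (auto simp: \<Gamma>_def)
  define G\<pi> where "G\<pi> = (\<lambda>\<pi>. mat n n (\<lambda>(k, m). G $$ (k, \<pi> m)))"
  have G\<pi>c: "G\<pi> \<pi> \<in> carrier_mat n n" for \<pi> by (simp add: G\<pi>_def)
  have dims: "dim_row (G\<pi> \<pi>) = n" "dim_col (G\<pi> \<pi>) = n" for \<pi> by (simp_all add: G\<pi>_def)
  have Gint: "(\<integral>y. poly (R k) y * y ^ label_rank g (\<pi> m) \<partial>\<mu> (g m)) = G\<pi> \<pi> $$ (k, m)" if "\<pi> \<in> \<Gamma>" "k < n" "m < n" for \<pi> k m
  proof -
    have "g (\<pi> m) = g m" using that by (auto simp: \<Gamma>_def)
    then show ?thesis using that lt[OF that(1,3)] by (simp add: G\<pi>_def G_def)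
  qed
  have FG\<pi>: "(F * G\<pi> \<pi>) $$ (k, m) = (\<integral>y. poly (R k) y * (y ^ label_rank g (\<pi> m) * f y) \<partial>\<mu> (g m))" if "\<pi> \<in> \<Gamma>" "k < n" "m < n" for \<pi> k m
  proof -
    have "g (\<pi> m) = g m" using that by (auto simp: \<Gamma>_def)
    moreover have "(F * G\<pi> \<pi>) $$ (k, m) = (F * G) $$ (k, \<pi> m)"
      using that lt[OF that(1,3)] carr by (simp add: G\<pi>_def scalar_prod_def)
    ultimately show ?thesis using FG[OF that(2) lt[OF that(1,3)]] by (simp add: Lf_def)
  qed
  have D: "det (mat n n (\<lambda>(m, l). if g m = g l then x l ^ label_rank g m else 0)) = (\<Sum>\<pi>\<in>\<Gamma>. signof \<pi> * (\<Prod>l<n. x l ^ label_rank g (\<pi> l)))" for x :: "nat \<Rightarrow> real"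
  proof -
    have "det (mat n n (\<lambda>(m, l). if g m = g l then x l ^ label_rank g m else 0))
      = (\<Sum>\<pi> | \<pi> permutes {0..<n}. signof \<pi> * (\<Prod>l<n. if g (\<pi> l) = g l then x l ^ label_rank g (\<pi> l) else 0))"
      by (rule det_leibniz_transposed)
    also have "\<dots> = (\<Sum>\<pi>\<in>\<Gamma>. signof \<pi> * (\<Prod>l<n. if g (\<pi> l) = g l then x l ^ label_rank g (\<pi> l) else 0))"
    proof (rule sum.mono_neutral_right[OF finite_permutations_lt])
      show "\<forall>\<pi>\<in>{\<pi>. \<pi> permutes {0..<n}} - \<Gamma>. signof \<pi> * (\<Prod>l<n. if g (\<pi> l) = g l then x l ^ label_rank g (\<pi> l) else 0) = 0"
        by (auto simp: \<Gamma>_def)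
    qed (auto simp: \<Gamma>_def)
    also have "\<dots> = (\<Sum>\<pi>\<in>\<Gamma>. signof \<pi> * (\<Prod>l<n. x l ^ label_rank g (\<pi> l)))"
      by (intro sum.cong refl arg_cong2[where f="(*)"] prod.cong) (auto simp: \<Gamma>_def)
    finally show ?thesis .
  qed
  have i1: "integrable P (\<lambda>x. ?V x * (\<Prod>l<n. x l ^ label_rank g (\<pi> l)))"
    and I1: "(\<integral>x. ?V x * (\<Prod>l<n. x l ^ label_rank g (\<pi> l)) \<partial>P) = det (G\<pi> \<pi>)" if \<pi>: "\<pi> \<in> \<Gamma>" for \<pi>
  proof -
    note * = integral_det_prod[OF psf, of n "\<lambda>k. poly (R k)" "\<lambda>l y. y ^ label_rank g (\<pi> l)", OF int]
    show "integrable P (\<lambda>x. ?V x * (\<Prod>l<n. x l ^ label_rank g (\<pi> l)))" unfolding P_def by (rule *(1))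
    have "mat n n (\<lambda>(k, m). \<integral>y. poly (R k) y * y ^ label_rank g (\<pi> m) \<partial>\<mu> (g m)) = G\<pi> \<pi>"
      using \<pi> by (intro eq_matI) (auto simp: Gint dims)
    then show "(\<integral>x. ?V x * (\<Prod>l<n. x l ^ label_rank g (\<pi> l)) \<partial>P) = det (G\<pi> \<pi>)" unfolding P_def by (simp add: *(2))
  qed
  \<comment> \<open>The factor \<open>f (x m)\<close> alters only column \<open>m\<close> of the
    Gram matrix, which leads to the sum in \<open>sum_det_replace_col\<close>.\<close>
  have i2: "integrable P (\<lambda>x. f (x m) * (?V x * (\<Prod>l<n. x l ^ label_rank g (\<pi> l))))"
    and I2: "(\<integral>x. f (x m) * (?V x * (\<Prod>l<n. x l ^ label_rank g (\<pi> l))) \<partial>P)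
      = det (mat n n (\<lambda>(k, l). if l = m then (F * G\<pi> \<pi>) $$ (k, l) else G\<pi> \<pi> $$ (k, l)))" if \<pi>: "\<pi> \<in> \<Gamma>" and m: "m < n" for \<pi> m
  proof -
    let ?\<phi> = "\<lambda>l y. y ^ label_rank g (\<pi> l) * (if l = m then f y else 1)"
    have ii: "integrable (\<mu> (g l)) (\<lambda>y. poly (R k) y * ?\<phi> l y)" for k l
      using int intf by (cases "l = m") auto
    note * = integral_det_prod[OF psf, of n "\<lambda>k. poly (R k)" ?\<phi>, OF ii]
    have e: "f (x m) * (?V x * (\<Prod>l<n. x l ^ label_rank g (\<pi> l))) = ?V x * (\<Prod>l<n. ?\<phi> l (x l))" for x
    proof -
      have "(\<Prod>l<n. if l = m then f (x l) else 1) = f (x m)" using m by simp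
      then show ?thesis by (simp add: prod.distrib)
    qed
    show "integrable P (\<lambda>x. f (x m) * (?V x * (\<Prod>l<n. x l ^ label_rank g (\<pi> l))))" unfolding e P_def by (rule *(1))
    have "mat n n (\<lambda>(k, l). \<integral>y. poly (R k) y * ?\<phi> l y \<partial>\<mu> (g l)) = mat n n (\<lambda>(k, l). if l = m then (F * G\<pi> \<pi>) $$ (k, l) else G\<pi> \<pi> $$ (k, l))"
    proof (rule cong_mat[OF refl refl])
      fix k l assume kl: "k < n" "l < n"
      show "(case (k, l) of (k, l) \<Rightarrow> \<integral>y. poly (R k) y * ?\<phi> l y \<partial>\<mu> (g l)) = (case (k, l) of (k, l) \<Rightarrow> if l = m then (F * G\<pi> \<pi>) $$ (k, l) else G\<pi> \<pi> $$ (k, l))"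
        using FG\<pi>[OF \<pi> kl] Gint[OF \<pi> kl] by (cases "l = m") (simp_all only: prod.case if_True if_False mult_1_right simp_thms)
    qed
    then show "(\<integral>x. f (x m) * (?V x * (\<Prod>l<n. x l ^ label_rank g (\<pi> l))) \<partial>P)
      = det (mat n n (\<lambda>(k, l). if l = m then (F * G\<pi> \<pi>) $$ (k, l) else G\<pi> \<pi> $$ (k, l)))"
      unfolding e P_def by (simp only: *(2))
  qed
  \<comment> \<open>Permuting the columns produces the same sign as the Leibniz expansion, so every
    permutation contributes the same amount.\<close>
  have detG\<pi>: "signof \<pi> * det (G\<pi> \<pi>) = det G" if \<pi>: "\<pi> \<in> \<Gamma>" for \<pi>
  proof -
    have p: "\<pi> permutes {0..<n}" using \<pi> by (simp add: \<Gamma>_def)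
    have "det (mat n n (\<lambda>(i, j). transpose_mat G $$ (\<pi> i, j))) = signof \<pi> * det (transpose_mat G)"
      by (rule det_permute_rows[OF _ p]) (use carr in auto)
    moreover have "transpose_mat (G\<pi> \<pi>) = mat n n (\<lambda>(i, j). transpose_mat G $$ (\<pi> i, j))"
      using carr lt[OF \<pi>] by (intro eq_matI) (auto simp: G\<pi>_def)
    ultimately have "det (G\<pi> \<pi>) = signof \<pi> * det G"
      using det_transpose[OF G\<pi>c[of \<pi>]] det_transpose[OF carr(1)] by simp
    moreover have "signof \<pi> * signof \<pi> = (1::real)" by (simp add: sign_def)
    ultimately show ?thesis by (simp add: mult.assoc[symmetric])
  qed
  have VD: "VD x = (\<Sum>\<pi>\<in>\<Gamma>. signof \<pi> * (?V x * (\<Prod>l<n. x l ^ label_rank g (\<pi> l))))" for x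
    unfolding VD_def D by (simp add: sum_distrib_left mult_ac)
  have "(\<integral>x. VD x \<partial>P) = (\<Sum>\<pi>\<in>\<Gamma>. signof \<pi> * det (G\<pi> \<pi>))"
    unfolding VD by (subst Bochner_Integration.integral_sum) (auto intro!: integrable_mult_right i1 sum.cong simp: I1)
  then have IVD: "(\<integral>x. VD x \<partial>P) = real (card \<Gamma>) * det G" by (simp add: detG\<pi>)
  then show "(\<integral>x. VD x \<partial>P) \<noteq> 0" using detG fin\<Gamma> id\<Gamma> by (auto simp: card_gt_0_iff)
  have "(\<integral>x. (\<Sum>m<n. f (x m)) * VD x \<partial>P)
    = (\<integral>x. (\<Sum>\<pi>\<in>\<Gamma>. \<Sum>m<n. signof \<pi> * (f (x m) * (?V x * (\<Prod>l<n. x l ^ label_rank g (\<pi> l))))) \<partial>P)"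
    unfolding VD by (simp add: sum_distrib_left sum_distrib_right mult_ac)
  also have "\<dots> = (\<Sum>\<pi>\<in>\<Gamma>. \<Sum>m<n. signof \<pi> * (\<integral>x. f (x m) * (?V x * (\<Prod>l<n. x l ^ label_rank g (\<pi> l))) \<partial>P))"
  proof -
    have "(\<integral>x. (\<Sum>\<pi>\<in>\<Gamma>. \<Sum>m<n. signof \<pi> * (f (x m) * (?V x * (\<Prod>l<n. x l ^ label_rank g (\<pi> l))))) \<partial>P)
      = (\<Sum>\<pi>\<in>\<Gamma>. \<integral>x. (\<Sum>m<n. signof \<pi> * (f (x m) * (?V x * (\<Prod>l<n. x l ^ label_rank g (\<pi> l))))) \<partial>P)"
      by (intro Bochner_Integration.integral_sum Bochner_Integration.integrable_sum integrable_mult_right i2) auto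
    also have "\<dots> = (\<Sum>\<pi>\<in>\<Gamma>. \<Sum>m<n. \<integral>x. signof \<pi> * (f (x m) * (?V x * (\<Prod>l<n. x l ^ label_rank g (\<pi> l)))) \<partial>P)"
      by (intro sum.cong refl Bochner_Integration.integral_sum integrable_mult_right i2) auto
    finally show ?thesis by (simp only: integral_mult_right_zero)
  qed
  also have "\<dots> = (\<Sum>\<pi>\<in>\<Gamma>. signof \<pi> * (\<Sum>m<n. det (mat n n (\<lambda>(k, l). if l = m then (F * G\<pi> \<pi>) $$ (k, l) else G\<pi> \<pi> $$ (k, l)))))"
    unfolding sum_distrib_left by (intro sum.cong refl) (simp add: I2)
  also have "\<dots> = (\<Sum>\<pi>\<in>\<Gamma>. (\<Sum>k<n. F $$ (k, k)) * (signof \<pi> * det (G\<pi> \<pi>)))"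
    by (intro sum.cong refl) (simp only: sum_det_replace_col[OF G\<pi>c carr(3)] mult_ac)
  also have "\<dots> = (\<Sum>k<n. F $$ (k, k)) * (real (card \<Gamma>) * det G)" by (simp add: detG\<pi>)
  also have "(\<Sum>k<n. F $$ (k, k)) = (\<Sum>k<n. \<Sum>m<n. C k m * (\<integral>y. poly (R k) y * (y ^ label_rank g m * f y) \<partial>\<mu> (g m)))"
    by (intro sum.cong refl) (simp add: F_def Lf_def)
  finally show "(\<integral>x. (\<Sum>m<n. f (x m)) * VD x \<partial>P)
      = (\<Sum>k<n. \<Sum>m<n. C k m * (\<integral>y. poly (R k) y * (y ^ label_rank g m * f y) \<partial>\<mu> (g m))) * (\<integral>x. VD x \<partial>P)"
    unfolding IVD .
qed

subsection \<open>Concentration of the ensemble\<close>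

text \<open>\<open>g\<close> records the direction of each step of the path. Of the Lebesgue
  decomposition the density is retained, as a minorant of \<open>\<mu> i\<close> that is positive
  almost everywhere on the interval.\<close>

locale ensemble = minimizer +
  fixes \<mu> :: "nat \<Rightarrow> real measure" and g :: "nat \<Rightarrow> nat"
  assumes mu: "\<And>i. i < r \<Longrightarrow> fin_borel (\<mu> i)"
    and mu_AE: "\<And>i. i < r \<Longrightarrow> AE x in \<mu> i. x \<in> {a i..b i}"
    and g: "\<And>m. g m < r"
    and freq: "\<And>i. i < r \<Longrightarrow> (\<lambda>n. real (card {k. k < n \<and> g k = i}) / real n) \<longlonglongrightarrow> s i"
    and density: "\<And>i. i < r \<Longrightarrow> \<exists>f \<in> borel_measurable borel.
      (\<forall>A\<in>sets borel. (\<integral>\<^sup>+x\<in>A. f x \<partial>lborel) \<le> emeasure (\<mu> i) A) \<and> (AE x in lborel. x \<in> {a i..b i} \<longrightarrow> f x > (0::ennreal))"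
begin

text \<open>One coordinate per step of the path. Labels stay attached to coordinates, so this is a
  product measure and no symmetrization is involved.\<close>

definition "config_measure n = PiM {..<n} (\<lambda>m. \<mu> (g m))"

definition "label_count n i = real (card {k. k < n \<and> g k = i})"

lemma mug: "fin_borel (\<mu> (g m))" by (rule mu[OF g])

lemma psf: "product_sigma_finite (\<lambda>m. \<mu> (g m))"
  by (rule product_sigma_finite.intro) (rule fin_borelD(4)[OF mug])

lemma space_config_measure: "space (config_measure n) = Pi\<^sub>E {..<n} (\<lambda>_. UNIV)"
  unfolding config_measure_def space_PiM by (simp add: fin_borelD(2)[OF mug])

lemma emeasure_space_config_measure: "emeasure (config_measure n) (space (config_measure n)) = (\<Prod>m<n. ennreal (mass (\<mu> (g m))))"
proof -
  interpret product_sigma_finite "\<lambda>m. \<mu> (g m)" by (rule psf)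
  have "emeasure (config_measure n) (Pi\<^sub>E {..<n} (\<lambda>m. UNIV)) = (\<Prod>m<n. emeasure (\<mu> (g m)) UNIV)"
    unfolding config_measure_def by (rule emeasure_PiM) (auto simp: fin_borelD(1)[OF mug])
  then show ?thesis by (simp only: space_config_measure mass_eq_emeasure[OF mug])
qed

definition "mass_bound = 1 + (\<Sum>i<r. mass (\<mu> i))"

lemma mass_bound: "1 \<le> mass_bound" "mass (\<mu> (g m)) \<le> mass_bound"
proof -
  show "1 \<le> mass_bound" unfolding mass_bound_def by (simp add: sum_nonneg mass_nonneg)
  have "mass (\<mu> (g m)) \<le> (\<Sum>i<r. mass (\<mu> i))" using g[of m] by (intro member_le_sum) (auto simp: mass_nonneg)
  then show "mass (\<mu> (g m)) \<le> mass_bound" by (simp add: mass_bound_def)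
qed

lemma finite_config_measure: "finite_measure (config_measure n)" and measure_config_measure: "measure (config_measure n) (space (config_measure n)) \<le> mass_bound ^ n"
proof -
  have e: "emeasure (config_measure n) (space (config_measure n)) = ennreal (\<Prod>m<n. mass (\<mu> (g m)))"
    unfolding emeasure_space_config_measure by (rule prod_ennreal) (simp add: mass_nonneg)
  then show "finite_measure (config_measure n)" by (intro finite_measureI) simp
  have "measure (config_measure n) (space (config_measure n)) = (\<Prod>m<n. mass (\<mu> (g m)))"
    using e by (simp add: measure_def prod_nonneg mass_nonneg)
  also have "\<dots> \<le> (\<Prod>m<n. mass_bound)" using mass_bound mass_nonneg by (intro prod_mono) auto
  finally show "measure (config_measure n) (space (config_measure n)) \<le> mass_bound ^ n" by simp
qed

lemma AE_box: "AE x in config_measure n. \<forall>m\<in>{..<n}. x m \<in> {a (g m)..b (g m)}"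
proof (intro eventually_ball_finite ballI)
  fix m assume m: "m \<in> {..<n}"
  interpret product_sigma_finite "\<lambda>m. \<mu> (g m)" by (rule psf)
  let ?F = "\<lambda>k. if k = m then - {a (g m)..b (g m)} else UNIV"
  have "emeasure (\<mu> (g m)) (- {a (g m)..b (g m)}) = 0"
    using mu_AE[OF g[of m]] fin_borelD[OF mug[of m]] by (subst (asm) AE_iff_measurable[OF _ refl]) (auto simp: Compl_eq)
  then have "(\<Prod>k<n. emeasure (\<mu> (g k)) (?F k)) = 0" using m by (intro prod_zero bexI[of _ m]) auto
  moreover have "emeasure (config_measure n) (Pi\<^sub>E {..<n} ?F) = (\<Prod>k<n. emeasure (\<mu> (g k)) (?F k))"
    unfolding config_measure_def by (rule emeasure_PiM) (auto simp: fin_borelD(1)[OF mug])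
  ultimately have "emeasure (config_measure n) (Pi\<^sub>E {..<n} ?F) = 0" by simp
  moreover have "Pi\<^sub>E {..<n} ?F \<in> sets (config_measure n)"
    unfolding config_measure_def by (rule sets_PiM_I_finite) (auto simp: fin_borelD(1)[OF mug])
  moreover have "{x \<in> space (config_measure n). \<not> x m \<in> {a (g m)..b (g m)}} \<subseteq> Pi\<^sub>E {..<n} ?F"
    by (force simp: space_config_measure PiE_iff extensional_def)
  ultimately show "AE x in config_measure n. x m \<in> {a (g m)..b (g m)}" by (intro AE_I)
qed auto

lemma integrable_config_measure:
  fixes h :: "(nat \<Rightarrow> real) \<Rightarrow> real"
  assumes m: "h \<in> borel_measurable (config_measure n)"
    and B: "\<And>x. (\<And>m. m < n \<Longrightarrow> x m \<in> {a (g m)..b (g m)}) \<Longrightarrow> \<bar>h x\<bar> \<le> B"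
  shows "integrable (config_measure n) h"
proof (rule finite_measure.integrable_const_bound[OF finite_config_measure _ m])
  show "AE x in config_measure n. norm (h x) \<le> B" by (rule eventually_mono[OF AE_box]) (use B in auto)
qed

lemma measurable_coord: "m < n \<Longrightarrow> (\<lambda>x. x m) \<in> borel_measurable (config_measure n)"
  unfolding config_measure_def measurable_cong_sets[OF refl fin_borelD(1)[OF mug], of _ m, symmetric]
  by (rule measurable_component_singleton) auto

lemma measurable_weight: "weight n g \<in> borel_measurable (config_measure n)"
  unfolding config_measure_def by (rule weight_measurable) (rule fin_borelD(1)[OF mug])

lemma measurable_sum_coord:
  assumes "continuous_on UNIV f"
  shows "(\<lambda>x. \<Sum>m<n. f (x m) :: real) \<in> borel_measurable (config_measure n)"
proof (intro borel_measurable_sum)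
  fix m assume "m \<in> {..<n}"
  then show "(\<lambda>x. f (x m)) \<in> borel_measurable (config_measure n)"
    using measurable_compose[OF measurable_coord borel_measurable_continuous_onI[OF assms]] by auto
qed

lemma box_dist:
  assumes "\<And>m. m < n \<Longrightarrow> x m \<in> {a (g m)..b (g m)}" "m < n" "m' < n"
  shows "\<bar>x m - x m'\<bar> \<le> L"
  using assms(1)[OF assms(2)] assms(1)[OF assms(3)] by (intro dist_le_L in_hull[OF g])

lemma weight_bound:
  obtains B where "\<And>x. (\<And>m. m < n \<Longrightarrow> x m \<in> {a (g m)..b (g m)}) \<Longrightarrow> \<bar>weight n g x\<bar> \<le> B"
proof
  fix x assume x: "\<And>m. m < n \<Longrightarrow> x m \<in> {a (g m)..b (g m)}"
  have "weight n g x \<le> exp (- ((\<Sum>m<n. \<Sum>m'<n. coupling (g m) (g m') * trunc_log 1 L (x m - x m')) - real n * trunc_log 1 L 0))"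
    by (rule weight_le_exp) (use box_dist[OF x] in auto)
  also have "\<dots> \<le> exp ((\<Sum>m<n. \<Sum>m'<n. \<bar>ln L\<bar>) + real n * trunc_log 1 L 0)"
  proof -
    have "- (coupling (g m) (g m') * trunc_log 1 L (x m - x m')) \<le> \<bar>ln L\<bar>" for m m'
    proof -
      have "- trunc_log 1 L (x m - x m') \<le> ln L" using trunc_log_bounds(1)[of 1 L] L_gt_1 by (simp add: minus_le_iff)
      then have "coupling (g m) (g m') * - trunc_log 1 L (x m - x m') \<le> 1 * \<bar>ln L\<bar>"
        using coupling_bounds[of "g m" "g m'"] L_gt_1
        by (meson abs_ge_self abs_ge_zero less_imp_le mult_left_mono mult_mono mult_right_mono order_trans)
      then show ?thesis by simp
    qed
    then have "- (\<Sum>m<n. \<Sum>m'<n. coupling (g m) (g m') * trunc_log 1 L (x m - x m')) \<le> (\<Sum>m<n. \<Sum>m'<n. \<bar>ln L\<bar>)"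
      unfolding sum_negf[symmetric] by (intro sum_mono)
    then show ?thesis by simp
  qed
  finally show "\<bar>weight n g x\<bar> \<le> exp ((\<Sum>m<n. \<Sum>m'<n. \<bar>ln L\<bar>) + real n * trunc_log 1 L 0)" using weight_nonneg by simp
qed

lemma cont_bound:
  assumes "continuous_on UNIV (f :: real \<Rightarrow> real)"
  obtains B where "0 \<le> B" "\<And>x. x \<in> {lo..hi} \<Longrightarrow> \<bar>f x\<bar> \<le> B"
proof -
  have "compact (f ` {lo..hi})" by (intro compact_continuous_image continuous_on_subset[OF assms]) auto
  then have "bounded (f ` {lo..hi})" by (rule compact_imp_bounded)
  then obtain B where "\<forall>y\<in>f ` {lo..hi}. norm y \<le> B" unfolding bounded_iff by blast
  then have B: "\<And>x. x \<in> {lo..hi} \<Longrightarrow> \<bar>f x\<bar> \<le> B" by auto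
  moreover have "0 \<le> B" using B[of lo] lo_less_hi by auto
  ultimately show ?thesis using that by blast
qed

section \<open>The partition function and its lower bound\<close>

definition "partition_fn n = (\<integral>x. weight n g x \<partial>config_measure n)"

lemma integrable_weight: "integrable (config_measure n) (weight n g)"
proof -
  obtain B where B: "\<And>x. (\<And>m. m < n \<Longrightarrow> x m \<in> {a (g m)..b (g m)}) \<Longrightarrow> \<bar>weight n g x\<bar> \<le> B"
    using weight_bound[of n] by blast
  show ?thesis by (rule integrable_config_measure[OF measurable_weight]) (rule B)
qed

lemma integrable_sum_weight:
  assumes f: "continuous_on UNIV f"
  shows "integrable (config_measure n) (\<lambda>x. (\<Sum>m<n. f (x m)) * weight n g x)"
proof -
  obtain B where B: "\<And>x. (\<And>m. m < n \<Longrightarrow> x m \<in> {a (g m)..b (g m)}) \<Longrightarrow> \<bar>weight n g x\<bar> \<le> B"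
    using weight_bound[of n] by blast
  obtain B' where B': "0 \<le> B'" "\<And>x. x \<in> {lo..hi} \<Longrightarrow> \<bar>f x\<bar> \<le> B'" using cont_bound[OF f] by blast
  show ?thesis
  proof (rule integrable_config_measure)
    show "(\<lambda>x. (\<Sum>m<n. f (x m)) * weight n g x) \<in> borel_measurable (config_measure n)"
      by (rule borel_measurable_times[OF measurable_sum_coord[OF f] measurable_weight])
    fix x assume x: "\<And>m. m < n \<Longrightarrow> x m \<in> {a (g m)..b (g m)}"
    have "\<bar>\<Sum>m<n. f (x m)\<bar> \<le> (\<Sum>m<n. B')"
      using B'(2) in_hull[OF g] x by (intro sum_abs[THEN order_trans] sum_mono) auto
    then show "\<bar>(\<Sum>m<n. f (x m)) * weight n g x\<bar> \<le> (\<Sum>m<n. B') * B"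
      unfolding abs_mult using B[OF x] B'(1) by (intro mult_mono) (auto intro: sum_nonneg)
  qed
qed

text \<open>Jensen's bound for independent points with laws \<open>\<eta> (g m)\<close>, transferred
  to \<open>config_measure\<close> at the price \<open>C ^ n\<close>. Its exponent depends on the
  configuration of labels through their counts, so it converges after division by the square of
  \<open>n\<close>.\<close>

lemma partition_fn_lower:
  assumes \<epsilon>: "0 < \<epsilon>"
  obtains C q q0 where "0 < C" "q \<longlonglongrightarrow> q0" "q0 \<le> min_energy + \<epsilon>" "\<And>n. 0 < n \<Longrightarrow> exp (- ((real n)\<^sup>2 * q n)) \<le> C ^ n * partition_fn n"
proof -
  obtain f where f: "\<And>i. i < r \<Longrightarrow> f i \<in> borel_measurable borel"
      "\<And>i A. i < r \<Longrightarrow> A \<in> sets borel \<Longrightarrow> (\<integral>\<^sup>+x\<in>A. f i x \<partial>lborel) \<le> emeasure (\<mu> i) A"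
      "\<And>i. i < r \<Longrightarrow> AE x in lborel. x \<in> {a i..b i} \<longrightarrow> f i x > (0::ennreal)"
  proof -
    have "\<forall>i. \<exists>f. i < r \<longrightarrow> f \<in> borel_measurable borel \<and>
      (\<forall>A\<in>sets borel. (\<integral>\<^sup>+x\<in>A. f x \<partial>lborel) \<le> emeasure (\<mu> i) A) \<and> (AE x in lborel. x \<in> {a i..b i} \<longrightarrow> f x > (0::ennreal))"
      using density by blast
    then obtain f where "\<forall>i. i < r \<longrightarrow> f i \<in> borel_measurable borel \<and>
      (\<forall>A\<in>sets borel. (\<integral>\<^sup>+x\<in>A. f i x \<partial>lborel) \<le> emeasure (\<mu> i) A) \<and> (AE x in lborel. x \<in> {a i..b i} \<longrightarrow> f i x > (0::ennreal))"
      by (rule choice[THEN exE])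
    then show ?thesis using that[of f] by blast
  qed
  obtain C \<eta> where C: "0 < C" and \<eta>: "\<And>i. i < r \<Longrightarrow> fin_borel (\<eta> i)" "\<And>i. i < r \<Longrightarrow> mass (\<eta> i) = 1"
    and le: "\<And>i A. i < r \<Longrightarrow> A \<in> sets borel \<Longrightarrow> emeasure (\<eta> i) A \<le> ennreal C * emeasure (\<mu> i) A"
    and int: "\<And>j k. j < r \<Longrightarrow> k < r \<Longrightarrow> integrable (\<eta> j \<Otimes>\<^sub>M \<eta> k) (\<lambda>z. - ln \<bar>fst z - snd z\<bar>)"
    and ne: "\<And>j k. j < r \<Longrightarrow> k < r \<Longrightarrow> AE z in \<eta> j \<Otimes>\<^sub>M \<eta> k. fst z \<noteq> snd z"
    and en: "(\<Sum>j<r. \<Sum>k<r. coupling j k * (s j * s k * log_form (\<eta> j) (\<eta> k))) \<le> min_energy + \<epsilon>"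
    by (rule dominated_approximation[OF fin_borelD(1)[OF mu] f \<epsilon>]) auto
  let ?J = "\<lambda>j k. log_form (\<eta> j) (\<eta> k)"
  \<comment> \<open>The Jensen exponent divided by \<open>(real n)\<^sup>2\<close>, grouped by
    labels. The second sum removes the diagonal and is of order \<open>1 / real n\<close>.\<close>
  define q where "q = (\<lambda>n. (\<Sum>j<r. \<Sum>k<r. coupling j k * (label_count n j / real n * (label_count n k / real n) * ?J j k)) - (\<Sum>j<r. label_count n j / real n * (1 / real n) * ?J j j))"
  show ?thesis
  proof (rule that[of C q, OF C _ en])
    have "q \<longlonglongrightarrow> (\<Sum>j<r. \<Sum>k<r. coupling j k * (s j * s k * ?J j k)) - (\<Sum>j<r. s j * 0 * ?J j j)"
      unfolding q_def label_count_def
      by (intro tendsto_diff tendsto_sum tendsto_mult tendsto_const freq lim_1_over_n) auto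
    then show "q \<longlonglongrightarrow> (\<Sum>j<r. \<Sum>k<r. coupling j k * (s j * s k * ?J j k))" by simp
    fix n :: nat assume n: "0 < n"
    have cntsum: "(\<Sum>m<n. if g m = j then 1 else 0) = label_count n j" for j
      by (simp add: label_count_def sum.If_cases lessThan_def Collect_conj_eq)
    have q1: "(\<Sum>m<n. \<Sum>m'<n. coupling (g m) (g m') * ?J (g m) (g m')) = (\<Sum>j<r. \<Sum>k<r. coupling j k * ?J j k * (label_count n j * label_count n k))"
    proof -
      have "(\<Sum>m<n. \<Sum>m'<n. coupling (g m) (g m') * ?J (g m) (g m')) = (\<Sum>j<r. \<Sum>k<r. coupling j k * ?J j k * (\<Sum>m<n. \<Sum>m'<n. (if g m = j then 1 else 0) * ((if g m' = k then 1 else 0) * 1)))"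
        using sum_regroup[of n g r "\<lambda>j k. coupling j k * ?J j k" "\<lambda>_. 1" "\<lambda>_. 1" "\<lambda>_ _. 1"] g by simp
      also have "\<dots> = (\<Sum>j<r. \<Sum>k<r. coupling j k * ?J j k * (label_count n j * label_count n k))"
        by (simp only: mult_1_right sum_distrib_left[symmetric] sum_distrib_right[symmetric] cntsum)
      finally show ?thesis .
    qed
    have q2: "(\<Sum>m<n. ?J (g m) (g m)) = (\<Sum>j<r. label_count n j * ?J j j)"
    proof -
      have "(\<Sum>m<n. ?J (g m) (g m)) = (\<Sum>m<n. \<Sum>j<r. (if g m = j then 1 else 0) * ?J j j)"
      proof (intro sum.cong refl)
        fix m
        have "(\<Sum>j<r. (if g m = j then 1 else 0) * ?J j j) = (\<Sum>j<r. if g m = j then ?J j j else 0)" by (intro sum.cong refl) auto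
        then show "?J (g m) (g m) = (\<Sum>j<r. (if g m = j then 1 else 0) * ?J j j)" using g[of m] by simp
      qed
      also have "\<dots> = (\<Sum>j<r. \<Sum>m<n. (if g m = j then 1 else 0) * ?J j j)" by (rule sum.swap)
      finally show ?thesis by (simp only: sum_distrib_right[symmetric] cntsum)
    qed
    have qn: "(real n)\<^sup>2 * q n = (\<Sum>m<n. \<Sum>m'<n. coupling (g m) (g m') * ?J (g m) (g m')) - (\<Sum>m<n. ?J (g m) (g m))"
      unfolding q1 q2 q_def using n by (simp add: right_diff_distrib sum_distrib_left power2_eq_square field_simps)
    let ?N = "\<lambda>m. \<eta> (g m)"
    have psfN: "product_sigma_finite ?N" by (rule product_sigma_finite.intro) (rule fin_borelD(4)[OF \<eta>(1)[OF g]])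
    have "ennreal (exp (- ((real n)\<^sup>2 * q n))) \<le> (\<integral>\<^sup>+x. ennreal (weight n g x) \<partial>PiM {..<n} ?N)"
      unfolding qn by (rule weight_integral_ge[OF g \<eta> int ne])
    also have "\<dots> \<le> ennreal C ^ card {..<n} * (\<integral>\<^sup>+x. ennreal (weight n g x) \<partial>config_measure n)"
      unfolding config_measure_def
    proof (rule nn_integral_PiM_le_scaled[OF psf psfN])
      show "sets (\<eta> (g i)) = sets (\<mu> (g i))" for i using fin_borelD(1)[OF \<eta>(1)[OF g]] fin_borelD(1)[OF mug] by simp
      show "emeasure (\<eta> (g i)) A \<le> ennreal C * emeasure (\<mu> (g i)) A" if "A \<in> sets (\<mu> (g i))" for i A
        using that fin_borelD(1)[OF mug] by (intro le g) auto
      show "(\<lambda>x. ennreal (weight n g x)) \<in> borel_measurable (PiM {..<n} (\<lambda>m. \<mu> (g m)))"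
        using measurable_weight[of n] by (simp add: config_measure_def)
    qed auto
    also have "(\<integral>\<^sup>+x. ennreal (weight n g x) \<partial>config_measure n) = ennreal (partition_fn n)"
      unfolding partition_fn_def by (rule nn_integral_eq_integral[OF integrable_weight]) (simp add: weight_nonneg)
    also have "ennreal C ^ card {..<n} * ennreal (partition_fn n) = ennreal (C ^ n * partition_fn n)"
      using C by (simp add: ennreal_power ennreal_mult partition_fn_def integral_nonneg_AE weight_nonneg)
    finally show "exp (- ((real n)\<^sup>2 * q n)) \<le> C ^ n * partition_fn n"
      using C by (subst (asm) ennreal_le_iff) (auto simp: partition_fn_def weight_nonneg)
  qed
qed

lemma partition_fn_pos: "0 < n \<Longrightarrow> 0 < partition_fn n"
proof -
  assume n: "0 < n"
  have "(0::real) < 1" by simp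
  from partition_fn_lower[OF this] obtain C q q0 where "0 < C" "q \<longlonglongrightarrow> q0" "q0 \<le> min_energy + 1" "\<And>n. 0 < n \<Longrightarrow> exp (- ((real n)\<^sup>2 * q n)) \<le> C ^ n * partition_fn n"
    by blast
  then have "exp (- ((real n)\<^sup>2 * q n)) \<le> C ^ n * partition_fn n" using n by blast
  then have "0 < C ^ n * partition_fn n" by (rule less_le_trans[OF exp_gt_zero])
  moreover have "0 < C ^ n" using \<open>0 < C\<close> by simp
  ultimately show "0 < partition_fn n" by (rule zero_less_mult_pos)
qed

section \<open>Label frequencies and exponential moments\<close>

definition "\<theta> n = (\<Sum>j<r. \<bar>s j * real n / label_count n j - 1\<bar>)"

lemma theta_lim: "\<theta> \<longlonglongrightarrow> 0"
proof -
  have "(\<lambda>n. \<Sum>j<r. \<bar>s j / (label_count n j / real n) - 1\<bar>) \<longlonglongrightarrow> (\<Sum>j<r. \<bar>s j / s j - 1\<bar>)"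
    unfolding label_count_def using spos by (intro tendsto_sum tendsto_rabs tendsto_diff tendsto_divide tendsto_const freq) force+
  also have "(\<Sum>j<r. \<bar>s j / s j - 1\<bar>) = 0" using spos by (intro sum.neutral) force
  finally show ?thesis unfolding \<theta>_def by simp
qed

lemma label_count_pos: "\<forall>\<^sub>F n in sequentially. \<forall>j\<in>{..<r}. 0 < label_count n j"
proof (intro eventually_ball_finite ballI)
  fix j assume "j \<in> {..<r}"
  then have "\<forall>\<^sub>F n in sequentially. 0 < label_count n j / real n"
    unfolding label_count_def using freq spos by (intro order_tendstoD(1)) auto
  then show "\<forall>\<^sub>F n in sequentially. 0 < label_count n j"
    by (rule eventually_mono) (auto simp: zero_less_divide_iff)
qed auto

text \<open>\<open>c\<close> is the mean of the exponent \<open>Y\<close> under the ensemble, so by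
  convexity \<open>exp c\<close> is at most the mean of \<open>exp Y\<close>. Pointwise, the weight
  times \<open>exp Y\<close> is at most \<open>exp E\<close>, by \<open>weight_le_exp\<close> and
  \<open>config_lower_bound\<close>.\<close>

lemma exponential_moment_bound:
  fixes S \<tau> :: real
  assumes d: "0 < d" "d \<le> 1" and ge: "\<And>\<eta>. adm \<eta> \<Longrightarrow> min_energy - \<epsilon> \<le> tuple_energy d L r \<eta>"
    and label_count: "\<And>j. j < r \<Longrightarrow> 0 < label_count n j" and \<theta>1: "\<theta> n \<le> 1"
    and f: "\<And>x. (f has_real_derivative f' x) (at x)" and f': "continuous_on UNIV f'"
    and B: "\<And>x. x \<in> {lo..hi} \<Longrightarrow> \<bar>f x\<bar> \<le> B" and \<kappa>: "\<And>x. \<bar>trunc_log d L x\<bar> \<le> \<kappa>"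
    and S: "(\<integral>x. (\<Sum>m<n. f (x m)) * weight n g x \<partial>config_measure n) = S * partition_fn n"
  defines "c \<equiv> \<tau> * (real n * S - (real n)\<^sup>2 * (\<integral>x. f x \<partial>msum r \<omega>))"
  shows "exp c * partition_fn n \<le> exp (real n * \<kappa> - (real n)\<^sup>2 * (min_energy - 2 * \<epsilon> - \<tau>\<^sup>2 * slope_const f' - \<theta> n * (3 * \<kappa> + \<bar>\<tau>\<bar> * B))) * mass_bound ^ n"
proof -
  define Y where "Y = (\<lambda>x. \<tau> * (real n * (\<Sum>m<n. f (x m)) - (real n)\<^sup>2 * (\<integral>x. f x \<partial>msum r \<omega>)))"
  define E where "E = real n * \<kappa> - (real n)\<^sup>2 * (min_energy - 2 * \<epsilon> - \<tau>\<^sup>2 * slope_const f' - \<theta> n * (3 * \<kappa> + \<bar>\<tau>\<bar> * B))"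
  have fc: "continuous_on UNIV f" using f by (meson DERIV_isCont continuous_at_imp_continuous_on)
  have pt: "weight n g x * exp (Y x) \<le> exp E" if x: "\<And>m. m < n \<Longrightarrow> x m \<in> {a (g m)..b (g m)}" for x
  proof -
    have "\<bar>s j * real n / real (card {m. m < n \<and> g m = j}) - 1\<bar> \<le> \<theta> n" if "j < r" for j
      unfolding \<theta>_def label_count_def using that by (intro member_le_sum[of j "{..<r}" "\<lambda>j. \<bar>s j * real n / real (card {m. m < n \<and> g m = j}) - 1\<bar>"]) auto
    moreover have "0 < card {m. m < n \<and> g m = j}" if "j < r" for j using label_count[OF that] by (simp add: label_count_def)
    ultimately have "(real n)\<^sup>2 * (min_energy - 2 * \<epsilon> - \<tau>\<^sup>2 * slope_const f' - \<theta> n * (3 * \<kappa> + \<bar>\<tau>\<bar> * B))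
      \<le> (\<Sum>m<n. \<Sum>m'<n. coupling (g m) (g m') * trunc_log d L (x m - x m')) - Y x"
      unfolding Y_def by (intro config_lower_bound d ge g x f f' B \<kappa> \<theta>1) auto
    moreover have "real n * trunc_log d L 0 \<le> real n * \<kappa>" using \<kappa>[of 0] by (intro mult_left_mono) auto
    ultimately have "- ((\<Sum>m<n. \<Sum>m'<n. coupling (g m) (g m') * trunc_log d L (x m - x m')) - real n * trunc_log d L 0) + Y x \<le> E"
      unfolding E_def by linarith
    moreover have "weight n g x \<le> exp (- ((\<Sum>m<n. \<Sum>m'<n. coupling (g m) (g m') * trunc_log d L (x m - x m')) - real n * trunc_log d L 0))"
      by (rule weight_le_exp[OF d(1)]) (rule box_dist[OF x])
    then have "weight n g x * exp (Y x) \<le> exp (- ((\<Sum>m<n. \<Sum>m'<n. coupling (g m) (g m') * trunc_log d L (x m - x m')) - real n * trunc_log d L 0)) * exp (Y x)"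
      by (rule mult_right_mono) simp
    ultimately show ?thesis by (simp add: exp_add[symmetric] order_trans)
  qed
  note iW = integrable_weight[of n] and iS = integrable_sum_weight[OF fc, of n]
  have "(\<integral>x. weight n g x * Y x \<partial>config_measure n) = (\<integral>x. \<tau> * real n * ((\<Sum>m<n. f (x m)) * weight n g x) - \<tau> * ((real n)\<^sup>2 * (\<integral>x. f x \<partial>msum r \<omega>)) * weight n g x \<partial>config_measure n)"
    by (intro Bochner_Integration.integral_cong refl) (simp add: Y_def algebra_simps)
  also have "\<dots> = \<tau> * real n * (S * partition_fn n) - \<tau> * ((real n)\<^sup>2 * (\<integral>x. f x \<partial>msum r \<omega>)) * partition_fn n"
    using iW iS by (subst Bochner_Integration.integral_diff) (simp_all only: integrable_mult_right integral_mult_right_zero S partition_fn_def)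
  also have "\<dots> = c * partition_fn n" by (simp add: c_def algebra_simps)
  finally have IY: "(\<integral>x. weight n g x * Y x \<partial>config_measure n) = c * partition_fn n" .
  have iY: "integrable (config_measure n) (\<lambda>x. weight n g x * Y x)"
  proof -
    have "integrable (config_measure n) (\<lambda>x. \<tau> * real n * ((\<Sum>m<n. f (x m)) * weight n g x) - \<tau> * ((real n)\<^sup>2 * (\<integral>x. f x \<partial>msum r \<omega>)) * weight n g x)"
      by (intro Bochner_Integration.integrable_diff integrable_mult_right iW iS)
    then show ?thesis by (rule Bochner_Integration.integrable_cong[THEN iffD1, rotated 2]) (auto simp: Y_def algebra_simps)
  qed
  have i1: "integrable (config_measure n) (\<lambda>x. exp c * ((1 - c) * weight n g x + weight n g x * Y x))"
    by (intro integrable_mult_right Bochner_Integration.integrable_add iW iY)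
  have "exp c * partition_fn n = exp c * ((1 - c) * partition_fn n + c * partition_fn n)" by (simp add: algebra_simps)
  also have "\<dots> = (\<integral>x. exp c * ((1 - c) * weight n g x + weight n g x * Y x) \<partial>config_measure n)"
    using iW iY by (simp add: IY partition_fn_def)
  also have "\<dots> \<le> (\<integral>x. exp E \<partial>config_measure n)"
  proof (rule integral_mono_AE[OF i1 finite_measure.integrable_const[OF finite_config_measure]])
    show "AE x in config_measure n. exp c * ((1 - c) * weight n g x + weight n g x * Y x) \<le> exp E"
    proof (rule eventually_mono[OF AE_box])
      fix x assume x: "\<forall>m\<in>{..<n}. x m \<in> {a (g m)..b (g m)}"
      \<comment> \<open>Tangent of the exponential at the mean; integrated against the weight, its
        linear term vanishes.\<close>
      have "1 + (Y x - c) \<le> exp (Y x - c)" by (rule exp_ge_add_one_self)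
      then have "exp c * (1 + (Y x - c)) \<le> exp c * exp (Y x - c)" by (intro mult_left_mono) auto
      also have "\<dots> = exp (Y x)" by (simp add: exp_add[symmetric])
      finally have "weight n g x * (exp c * (1 + (Y x - c))) \<le> weight n g x * exp (Y x)" by (rule mult_left_mono) (rule weight_nonneg)
      also have "\<dots> \<le> exp E" using x by (intro pt) auto
      finally show "exp c * ((1 - c) * weight n g x + weight n g x * Y x) \<le> exp E" by (simp add: algebra_simps)
    qed
  qed
  also have "\<dots> = exp E * measure (config_measure n) (space (config_measure n))" by simp
  also have "\<dots> \<le> exp E * mass_bound ^ n" by (intro mult_left_mono measure_config_measure) auto
  finally show ?thesis by (simp only: E_def)
qed

text \<open>Dividing the exponential moment bound by the lower bound for the partition function
  leaves \<open>\<tau> * (S n / real n - F)\<close> at most \<open>G n\<close>, whose limit is less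
  than \<open>\<tau> * \<delta>\<close>.\<close>

lemma mean_upper_limit:
  assumes f: "\<And>x. (f has_real_derivative f' x) (at x)" and f': "continuous_on UNIV f'"
    and S: "\<And>n. (\<integral>x. (\<Sum>m<n. f (x m)) * weight n g x \<partial>config_measure n) = S n * partition_fn n" and \<delta>: "0 < \<delta>"
  shows "\<forall>\<^sub>F n in sequentially. S n / real n < (\<integral>x. f x \<partial>msum r \<omega>) + \<delta>"
proof -
  define F where "F = (\<integral>x. f x \<partial>msum r \<omega>)"
  have Cf0: "0 \<le> slope_const f'" unfolding slope_const_def using L_gt_1 by (intro mult_nonneg_nonneg integral_nonneg_AE AE_I2) auto
  \<comment> \<open>Linear gain against quadratic loss: this size makes the loss
    \<open>\<tau>\<^sup>2 * slope_const f'\<close> at most \<open>\<tau> * \<delta> / 4\<close>. The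
    added 1 covers a vanishing slope.\<close>
  define \<tau> where "\<tau> = \<delta> / (4 * (slope_const f' + 1))"
  have \<tau>: "0 < \<tau>" "\<tau> * slope_const f' \<le> \<delta> / 4"
    using \<delta> Cf0 by (auto simp: \<tau>_def field_simps)
  \<comment> \<open>The energy error is \<open>3 * \<epsilon>\<close>, two from coercivity and one
    from the partition function, that is \<open>\<tau> * \<delta> / 4\<close>. Together with the
    quadratic loss it uses half of \<open>\<tau> * \<delta>\<close>.\<close>
  define \<epsilon> where "\<epsilon> = \<tau> * \<delta> / 12"
  have \<epsilon>: "0 < \<epsilon>" using \<tau> \<delta> by (simp add: \<epsilon>_def)
  obtain d where d: "0 < d" "d \<le> 1" and ge: "\<And>\<eta>. adm \<eta> \<Longrightarrow> min_energy - \<epsilon> \<le> tuple_energy d L r \<eta>" using tuple_energy_ge[OF \<epsilon>] by blast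
  have "bdd_borel (trunc_log d L)" by (rule bdd_borel_trunc_log) (use d L_gt_1 in auto)
  then obtain \<kappa> where \<kappa>: "0 < \<kappa>" "\<And>x. \<bar>trunc_log d L x\<bar> \<le> \<kappa>" using bdd_borelE by blast
  have fc: "continuous_on UNIV f" using f by (meson DERIV_isCont continuous_at_imp_continuous_on)
  obtain B where B: "0 \<le> B" "\<And>x. x \<in> {lo..hi} \<Longrightarrow> \<bar>f x\<bar> \<le> B" using cont_bound[OF fc] by blast
  obtain C q q0 where C: "0 < C" and q: "q \<longlonglongrightarrow> q0" "q0 \<le> min_energy + \<epsilon>"
    and low: "\<And>n. 0 < n \<Longrightarrow> exp (- ((real n)\<^sup>2 * q n)) \<le> C ^ n * partition_fn n"
    using partition_fn_lower[OF \<epsilon>] by blast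
  define G where "G = (\<lambda>n. (\<kappa> + ln mass_bound + ln C) * (1 / real n) - (min_energy - 2 * \<epsilon> - \<tau>\<^sup>2 * slope_const f' - \<theta> n * (3 * \<kappa> + \<bar>\<tau>\<bar> * B)) + q n)"
  have "G \<longlonglongrightarrow> (\<kappa> + ln mass_bound + ln C) * 0 - (min_energy - 2 * \<epsilon> - \<tau>\<^sup>2 * slope_const f' - 0 * (3 * \<kappa> + \<bar>\<tau>\<bar> * B)) + q0"
    unfolding G_def by (intro tendsto_intros lim_1_over_n theta_lim q)
  moreover have "(\<kappa> + ln mass_bound + ln C) * 0 - (min_energy - 2 * \<epsilon> - \<tau>\<^sup>2 * slope_const f' - 0 * (3 * \<kappa> + \<bar>\<tau>\<bar> * B)) + q0 < \<tau> * \<delta>"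
  proof -
    have "\<tau>\<^sup>2 * slope_const f' \<le> \<tau> * (\<delta> / 4)" unfolding power2_eq_square mult.assoc using \<tau> by (intro mult_left_mono) auto
    moreover have "12 * \<epsilon> = \<tau> * \<delta>" "0 < \<tau> * \<delta>" using \<tau> \<delta> by (auto simp: \<epsilon>_def)
    ultimately show ?thesis using q(2) by (simp add: field_simps)
  qed
  ultimately have ev1: "\<forall>\<^sub>F n in sequentially. G n < \<tau> * \<delta>" by (rule order_tendstoD(2))
  have ev2: "\<forall>\<^sub>F n in sequentially. \<theta> n < 1" using theta_lim by (rule order_tendstoD(2)) simp
  have ev3: "\<forall>\<^sub>F n in sequentially. 0 < (n::nat)" by (rule eventually_gt_at_top)
  show ?thesis using ev1 ev2 ev3 label_count_pos
  proof eventually_elim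
    case (elim n)
    define c where "c = \<tau> * (real n * S n - (real n)\<^sup>2 * F)"
    define E where "E = real n * \<kappa> - (real n)\<^sup>2 * (min_energy - 2 * \<epsilon> - \<tau>\<^sup>2 * slope_const f' - \<theta> n * (3 * \<kappa> + \<bar>\<tau>\<bar> * B))"
    have up: "exp c * partition_fn n \<le> exp E * mass_bound ^ n"
      unfolding c_def E_def F_def
      by (rule exponential_moment_bound[OF d _ _ _ f f' B(2) \<kappa>(2) S]) (use ge elim in auto)
    have Mx0: "0 < mass_bound" using mass_bound(1) by linarith
    have "exp c * exp (- ((real n)\<^sup>2 * q n)) \<le> exp c * (C ^ n * partition_fn n)"
      using low[of n] elim by (intro mult_left_mono) auto
    also have "\<dots> = C ^ n * (exp c * partition_fn n)" by simp
    also have "\<dots> \<le> C ^ n * (exp E * mass_bound ^ n)" using C up by (intro mult_left_mono) auto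
    also have "\<dots> = exp (real n * ln C + (E + real n * ln mass_bound))"
      using C Mx0 by (simp add: exp_add exp_of_nat_mult)
    finally have "c - (real n)\<^sup>2 * q n \<le> real n * ln C + (E + real n * ln mass_bound)"
      by (simp add: exp_add[symmetric])
    then have "c \<le> (real n)\<^sup>2 * G n"
      unfolding G_def E_def using elim by (simp add: algebra_simps power2_eq_square)
    also have "\<dots> < (real n)\<^sup>2 * (\<tau> * \<delta>)" using elim by (intro mult_strict_left_mono) auto
    finally have "\<tau> * (real n * S n) < \<tau> * ((real n)\<^sup>2 * (F + \<delta>))" by (simp add: c_def algebra_simps)
    then have "real n * S n < (real n)\<^sup>2 * (F + \<delta>)" using \<tau> by simp
    then have "real n * S n < real n * (real n * (F + \<delta>))" by (simp add: power2_eq_square mult.assoc)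
    then have "S n < real n * (F + \<delta>)" using elim by simp
    then show "S n / real n < (\<integral>x. f x \<partial>msum r \<omega>) + \<delta>" using elim by (simp add: F_def field_simps)
  qed
qed

section \<open>The determinantal density as a constant sign times the weight\<close>

lemma integrable_cont:
  assumes i: "i < r" and h: "continuous_on UNIV (h :: real \<Rightarrow> real)"
  shows "integrable (\<mu> i) h"
proof -
  obtain B where "0 \<le> B" "\<And>x. x \<in> {lo..hi} \<Longrightarrow> \<bar>h x\<bar> \<le> B" using cont_bound[OF h] by blast
  then have "AE x in \<mu> i. norm (h x) \<le> B"
    using in_hull[OF i] by (intro eventually_mono[OF mu_AE[OF i]]) auto
  moreover have "h \<in> borel_measurable (\<mu> i)"
    unfolding measurable_cong_sets[OF fin_borelD(1)[OF mu[OF i]] refl] using h by (rule borel_measurable_continuous_onI)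
  ultimately show ?thesis by (rule finite_measure.integrable_const_bound[OF fin_borelD(3)[OF mu[OF i]]])
qed

text \<open>Sign of the factors with different labels. Disjoint intervals are ordered by their left
  endpoints, so the sign depends on the labels alone and not on the positions inside the
  intervals.\<close>

definition "sgn_conf n = (\<Prod>l<n. \<Prod>m<l. if g m = g l \<or> a (g m) < a (g l) then 1 else - 1 :: real)"

lemma sgn_conf_nonzero: "sgn_conf n \<noteq> 0"
  by (auto simp: sgn_conf_def)

lemma vandermonde_eq_weight:
  assumes x: "\<And>m. m < n \<Longrightarrow> x m \<in> {a (g m)..b (g m)}"
  shows "(\<Prod>l<n. \<Prod>m<l. x l - x m) * (\<Prod>l<n. \<Prod>m<l. if g m = g l then x l - x m else 1) = sgn_conf n * weight n g x"
proof -
  have "(x l - x m) * (if g m = g l then x l - x m else 1)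
    = (if g m = g l \<or> a (g m) < a (g l) then 1 else - 1) * \<bar>x l - x m\<bar> ^ (if g l = g m then 2 else 1)"
    if lm: "l < n" "m < l" for l m
  proof (cases "g m = g l")
    case True
    then show ?thesis by (simp add: power2_eq_square)
  next
    case False
    have xl: "x l \<in> {a (g l)..b (g l)}" and xm: "x m \<in> {a (g m)..b (g m)}" using x lm by auto
    have ab': "a (g l) < b (g l)" "a (g m) < b (g m)" using ab g by auto
    have dj: "{a (g m)..b (g m)} \<inter> {a (g l)..b (g l)} = {}" by (rule disj[OF g g False])
    show ?thesis
    proof (cases "a (g m) < a (g l)")
      case True
      have "b (g m) < a (g l)"
      proof (rule ccontr)
        assume "\<not> b (g m) < a (g l)"
        then have "a (g l) \<in> {a (g m)..b (g m)} \<inter> {a (g l)..b (g l)}" using True ab' by auto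
        then show False using dj by blast
      qed
      then have "x m < x l" using xl xm by auto
      then show ?thesis using True False by simp
    next
      case nlt: False
      have "b (g l) < a (g m)"
      proof (rule ccontr)
        assume "\<not> b (g l) < a (g m)"
        then have "a (g m) \<in> {a (g m)..b (g m)} \<inter> {a (g l)..b (g l)}" using nlt ab' by auto
        then show False using dj by blast
      qed
      then have "x l < x m" using xl xm by auto
      then show ?thesis using nlt False by simp
    qed
  qed
  then have "(\<Prod>l<n. \<Prod>m<l. (x l - x m) * (if g m = g l then x l - x m else 1))
    = (\<Prod>l<n. \<Prod>m<l. (if g m = g l \<or> a (g m) < a (g l) then 1 else - 1) * \<bar>x l - x m\<bar> ^ (if g l = g m then 2 else 1))"
    by (intro prod.cong refl) auto
  then show ?thesis by (simp only: prod.distrib sgn_conf_def weight_def)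
qed

text \<open>The constant sign multiplies both integrals in \<open>ensemble_identity\<close> and
  cancels.\<close>

lemma ensemble_mean:
  fixes R :: "nat \<Rightarrow> real poly" and C :: "nat \<Rightarrow> nat \<Rightarrow> real"
  assumes R: "\<And>k. degree (R k) = k" "\<And>k. lead_coeff (R k) = 1"
    and bio: "\<And>l k. l < n \<Longrightarrow> k < n \<Longrightarrow> (\<Sum>m<n. C l m * (\<integral>y. poly (R k) y * y ^ label_rank g m \<partial>\<mu> (g m))) = (if l = k then 1 else 0)"
    and f: "continuous_on UNIV f"
  shows "(\<integral>x. (\<Sum>m<n. f (x m)) * weight n g x \<partial>config_measure n)
      = (\<Sum>k<n. \<Sum>m<n. C k m * (\<integral>y. poly (R k) y * (y ^ label_rank g m * f y) \<partial>\<mu> (g m))) * partition_fn n"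
proof -
  let ?VD = "\<lambda>x. det (mat n n (\<lambda>(k, l). poly (R k) (x l))) * det (mat n n (\<lambda>(m, l). if g m = g l then x l ^ label_rank g m else 0))"
  have VD: "?VD x = (\<Prod>l<n. \<Prod>m<l. x l - x m) * (\<Prod>l<n. \<Prod>m<l. if g m = g l then x l - x m else 1)" for x
    using det_vandermonde_monic[of n R x] det_labelled_vandermonde[of n g x] R by simp
  have AE: "AE x in config_measure n. ?VD x = sgn_conf n * weight n g x"
    unfolding VD by (rule eventually_mono[OF AE_box]) (rule vandermonde_eq_weight, auto)
  have VDm: "?VD \<in> borel_measurable (config_measure n)"
    unfolding VD by (intro borel_measurable_times borel_measurable_prod borel_measurable_diff measurable_If borel_measurable_const measurable_coord) auto
  have ident: "(\<integral>x. (\<Sum>m<n. f (x m)) * ?VD x \<partial>config_measure n)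
      = (\<Sum>k<n. \<Sum>m<n. C k m * (\<integral>y. poly (R k) y * (y ^ label_rank g m * f y) \<partial>\<mu> (g m))) * (\<integral>x. ?VD x \<partial>config_measure n)"
    unfolding config_measure_def
  proof (rule ensemble_identity(2))
    show "sigma_finite_measure (\<mu> (g m))" for m by (rule fin_borelD(4)[OF mug])
    show "integrable (\<mu> (g m)) (\<lambda>y. poly (R k) y * y ^ e)" for k m e
      by (intro integrable_cont[OF g] continuous_intros)
    show "integrable (\<mu> (g m)) (\<lambda>y. poly (R k) y * (y ^ e * f y))" for k m e
      by (intro integrable_cont[OF g] continuous_intros f)
  qed (rule bio)
  have "(\<integral>x. ?VD x \<partial>config_measure n) = (\<integral>x. sgn_conf n * weight n g x \<partial>config_measure n)"
    by (rule integral_cong_AE[OF VDm _ AE]) (intro borel_measurable_times borel_measurable_const measurable_weight)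
  then have 1: "(\<integral>x. ?VD x \<partial>config_measure n) = sgn_conf n * partition_fn n" by (simp only: integral_mult_right_zero partition_fn_def)
  have "(\<integral>x. (\<Sum>m<n. f (x m)) * ?VD x \<partial>config_measure n) = (\<integral>x. sgn_conf n * ((\<Sum>m<n. f (x m)) * weight n g x) \<partial>config_measure n)"
  proof (rule integral_cong_AE)
    show "(\<lambda>x. (\<Sum>m<n. f (x m)) * ?VD x) \<in> borel_measurable (config_measure n)"
      by (rule borel_measurable_times[OF measurable_sum_coord[OF f] VDm])
    show "(\<lambda>x. sgn_conf n * ((\<Sum>m<n. f (x m)) * weight n g x)) \<in> borel_measurable (config_measure n)"
      by (intro borel_measurable_times borel_measurable_const measurable_weight measurable_sum_coord[OF f])
    show "AE x in config_measure n. (\<Sum>m<n. f (x m)) * ?VD x = sgn_conf n * ((\<Sum>m<n. f (x m)) * weight n g x)"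
      by (rule eventually_mono[OF AE]) (simp only: mult.left_commute)
  qed
  then have "sgn_conf n * (\<integral>x. (\<Sum>m<n. f (x m)) * weight n g x \<partial>config_measure n)
    = sgn_conf n * ((\<Sum>k<n. \<Sum>m<n. C k m * (\<integral>y. poly (R k) y * (y ^ label_rank g m * f y) \<partial>\<mu> (g m))) * partition_fn n)"
    using ident 1 by (simp only: integral_mult_right_zero mult.left_commute)
  then show ?thesis using sgn_conf_nonzero by simp
qed

section \<open>Convergence of linear statistics\<close>

definition "mean f n = (\<integral>x. (\<Sum>m<n. f (x m)) * weight n g x \<partial>config_measure n) / partition_fn n" for f :: "real \<Rightarrow> real"

lemma mean_eq: "(\<integral>x. (\<Sum>m<n. f (x m)) * weight n g x \<partial>config_measure n) = mean f n * partition_fn n"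
proof (cases "n = 0")
  case False
  then have "partition_fn n \<noteq> 0" using partition_fn_pos[of n] by simp
  then show ?thesis by (simp add: mean_def)
qed (simp add: mean_def)

lemma mean_diff_le:
  assumes f: "continuous_on UNIV f" and h: "continuous_on UNIV h" and le: "\<And>x. x \<in> {lo..hi} \<Longrightarrow> \<bar>f x - h x\<bar> \<le> \<delta>"
    and n: "0 < n"
  shows "\<bar>mean f n - mean h n\<bar> \<le> real n * \<delta>"
proof -
  have Z: "0 < partition_fn n" by (rule partition_fn_pos[OF n])
  have "(mean f n - mean h n) * partition_fn n = (\<integral>x. (\<Sum>m<n. f (x m)) * weight n g x - (\<Sum>m<n. h (x m)) * weight n g x \<partial>config_measure n)"
    unfolding left_diff_distrib mean_eq[symmetric]
    by (rule Bochner_Integration.integral_diff[OF integrable_sum_weight[OF f] integrable_sum_weight[OF h], symmetric])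
  also have "\<bar>\<dots>\<bar> \<le> (\<integral>x. \<bar>(\<Sum>m<n. f (x m)) * weight n g x - (\<Sum>m<n. h (x m)) * weight n g x\<bar> \<partial>config_measure n)" by (rule integral_abs_bound)
  also have "\<dots> \<le> (\<integral>x. (real n * \<delta>) * weight n g x \<partial>config_measure n)"
  proof (rule integral_mono_AE)
    show "integrable (config_measure n) (\<lambda>x. \<bar>(\<Sum>m<n. f (x m)) * weight n g x - (\<Sum>m<n. h (x m)) * weight n g x\<bar>)"
      by (intro integrable_abs Bochner_Integration.integrable_diff integrable_sum_weight f h)
    show "integrable (config_measure n) (\<lambda>x. (real n * \<delta>) * weight n g x)" by (rule integrable_mult_right) (rule integrable_weight)
    show "AE x in config_measure n. \<bar>(\<Sum>m<n. f (x m)) * weight n g x - (\<Sum>m<n. h (x m)) * weight n g x\<bar> \<le> (real n * \<delta>) * weight n g x"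
    proof (rule eventually_mono[OF AE_box])
      fix x assume x: "\<forall>m\<in>{..<n}. x m \<in> {a (g m)..b (g m)}"
      have "\<bar>\<Sum>m<n. f (x m) - h (x m)\<bar> \<le> (\<Sum>m<n. \<delta>)"
        using x le in_hull[OF g] by (intro sum_abs[THEN order_trans] sum_mono) auto
      then have "\<bar>(\<Sum>m<n. f (x m)) - (\<Sum>m<n. h (x m))\<bar> * weight n g x \<le> (real n * \<delta>) * weight n g x"
        by (intro mult_right_mono weight_nonneg) (simp add: sum_subtractf)
      then show "\<bar>(\<Sum>m<n. f (x m)) * weight n g x - (\<Sum>m<n. h (x m)) * weight n g x\<bar> \<le> (real n * \<delta>) * weight n g x"
        using weight_nonneg[of n g x] by (simp add: left_diff_distrib[symmetric] abs_mult)
    qed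
  qed
  also have "\<dots> = (real n * \<delta>) * partition_fn n" by (simp only: integral_mult_right_zero partition_fn_def)
  finally have "\<bar>mean f n - mean h n\<bar> * partition_fn n \<le> (real n * \<delta>) * partition_fn n" using Z by (simp add: abs_mult)
  then show ?thesis using Z by simp
qed

text \<open>The upper bound for \<open>- f\<close> is the lower bound for \<open>f\<close>.\<close>

lemma mean_limit_C1:
  assumes f: "\<And>x. (f has_real_derivative f' x) (at x)" and f': "continuous_on UNIV f'"
  shows "(\<lambda>n. mean f n / real n) \<longlonglongrightarrow> (\<integral>x. f x \<partial>msum r \<omega>)"
proof (rule order_tendstoI)
  fix y assume "(\<integral>x. f x \<partial>msum r \<omega>) < y"
  then show "\<forall>\<^sub>F n in sequentially. mean f n / real n < y"
    using mean_upper_limit[OF f f' mean_eq, of "y - (\<integral>x. f x \<partial>msum r \<omega>)"] by simp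
next
  fix y assume y: "y < (\<integral>x. f x \<partial>msum r \<omega>)"
  have m: "mean (\<lambda>x. - f x) n = - mean f n" for n by (simp add: mean_def sum_negf)
  have "\<forall>\<^sub>F n in sequentially. mean (\<lambda>x. - f x) n / real n < (\<integral>x. - f x \<partial>msum r \<omega>) + ((\<integral>x. f x \<partial>msum r \<omega>) - y)"
    by (rule mean_upper_limit[of "\<lambda>x. - f x" "\<lambda>x. - f' x", OF _ _ mean_eq])
      (use y f in \<open>auto intro!: derivative_intros continuous_intros f'\<close>)
  then show "\<forall>\<^sub>F n in sequentially. y < mean f n / real n" by (simp add: m)
qed

text \<open>The upper bound needs a derivative, so \<open>f\<close> is replaced by a polynomial
  close to it on the hull. Both sides change by at most the uniform distance there, because the
  weight is nonnegative and the minimizer has total mass 1.\<close>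

lemma mean_limit:
  assumes f: "continuous_on UNIV f"
  shows "(\<lambda>n. mean f n / real n) \<longlonglongrightarrow> (\<integral>x. f x \<partial>msum r \<omega>)"
proof (rule LIMSEQ_I)
  fix \<delta> :: real assume \<delta>: "0 < \<delta>"
  then have \<delta>3: "0 < \<delta> / 3" by simp
  let ?I = "\<lambda>h. \<integral>x. h x \<partial>msum r \<omega>"
  obtain h where h: "real_polynomial_function h" and hf: "\<And>x. x \<in> {lo..hi} \<Longrightarrow> \<bar>f x - h x\<bar> < \<delta> / 3"
    by (rule Stone_Weierstrass_real_polynomial_function[OF compact_Icc continuous_on_subset[OF f subset_UNIV] \<delta>3]) blast
  obtain h' where h': "real_polynomial_function h'" "\<And>x. (h has_real_derivative h' x) (at x)"
    using has_real_derivative_polynomial_function[OF h] by blast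
  have hc: "continuous_on UNIV h" "continuous_on UNIV h'"
    using h h' by (auto intro!: continuous_at_imp_continuous_on continuous_polymonial_function simp: real_polynomial_function_eq)
  note om = msum_adm[OF adm_omega]
  have int: "integrable (msum r \<omega>) k" if "continuous_on UNIV k" for k :: "real \<Rightarrow> real"
  proof -
    obtain B where "0 \<le> B" "\<And>x. x \<in> {lo..hi} \<Longrightarrow> \<bar>k x\<bar> \<le> B" using cont_bound[OF \<open>continuous_on UNIV k\<close>] by blast
    then have "AE x in msum r \<omega>. norm (k x) \<le> B" by (intro eventually_mono[OF om(4)]) auto
    moreover have "k \<in> borel_measurable (msum r \<omega>)" using that borel_measurable_continuous_onI by simp
    ultimately show ?thesis by (rule finite_measure.integrable_const_bound[OF fin_borelD(3)[OF om(1)]])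
  qed
  have I: "\<bar>?I f - ?I h\<bar> \<le> \<delta> / 3"
  proof -
    have "\<bar>?I f - ?I h\<bar> = \<bar>\<integral>x. f x - h x \<partial>msum r \<omega>\<bar>" using int f hc by simp
    also have "\<dots> \<le> (\<integral>x. \<bar>f x - h x\<bar> \<partial>msum r \<omega>)" by (rule integral_abs_bound)
    also have "\<dots> \<le> (\<integral>x. \<delta> / 3 \<partial>msum r \<omega>)"
    proof (rule integral_mono_AE)
      show "integrable (msum r \<omega>) (\<lambda>x. \<bar>f x - h x\<bar>)" using int f hc by (intro integrable_abs Bochner_Integration.integrable_diff)
      show "integrable (msum r \<omega>) (\<lambda>x. \<delta> / 3)" by (rule integrable_bdd_borel[OF om(1) bdd_borel_const])
      show "AE x in msum r \<omega>. \<bar>f x - h x\<bar> \<le> \<delta> / 3" by (rule eventually_mono[OF om(4)]) (use hf in \<open>auto intro: less_imp_le\<close>)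
    qed
    also have "\<dots> = \<delta> / 3" by (simp only: integral_const_mass[OF om(1)] om(2) mult_1_right)
    finally show ?thesis .
  qed
  have "(\<lambda>n. mean h n / real n) \<longlonglongrightarrow> ?I h" by (rule mean_limit_C1[OF h'(2) hc(2)])
  from LIMSEQ_D[OF this \<delta>3] obtain N where N: "\<And>n. n \<ge> N \<Longrightarrow> norm (mean h n / real n - ?I h) < \<delta> / 3" by blast
  show "\<exists>N. \<forall>n\<ge>N. norm (mean f n / real n - ?I f) < \<delta>"
  proof (intro exI allI impI)
    fix n assume n: "max N 1 \<le> n"
    have "\<bar>mean f n - mean h n\<bar> \<le> real n * (\<delta> / 3)"
      by (rule mean_diff_le[OF f hc(1)]) (use hf n in \<open>auto intro: less_imp_le\<close>)
    then have "\<bar>mean f n / real n - mean h n / real n\<bar> \<le> \<delta> / 3"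
      using n by (simp add: diff_divide_distrib[symmetric] divide_le_eq mult.commute)
    then show "norm (mean f n / real n - ?I f) < \<delta>"
      using N[of n] n I unfolding real_norm_def by linarith
  qed
qed

end

section \<open>Type I and type II polynomials along the path\<close>

lemma sum_over_labels:
  fixes \<phi> :: "nat \<Rightarrow> nat \<Rightarrow> real"
  assumes "\<And>m. g m < r"
  shows "(\<Sum>m<n. \<phi> (g m) (label_rank g m)) = (\<Sum>i<r. \<Sum>e<card {k. k < n \<and> g k = i}. \<phi> i e)"
proof -
  have "(\<Sum>m<n. \<phi> (g m) (label_rank g m)) = (\<Sum>m<n. \<Sum>i<r. if g m = i then \<phi> i (label_rank g m) else 0)"
    using assms by (intro sum.cong refl) simp
  also have "\<dots> = (\<Sum>i<r. \<Sum>m<n. if g m = i then \<phi> i (label_rank g m) else 0)" by (rule sum.swap)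
  also have "\<dots> = (\<Sum>i<r. \<Sum>e<card {k. k < n \<and> g k = i}. \<phi> i e)" by (intro sum.cong refl sum_label_rank)
  finally show ?thesis .
qed

lemma poly_eq_sum_lessThan:
  fixes B :: "real poly"
  assumes "B = 0 \<or> degree B < N"
  shows "poly B y = (\<Sum>e<N. coeff B e * y ^ e)"
proof (cases "B = 0")
  case False
  then have "degree B < N" using assms by simp
  then show ?thesis
    unfolding poly_altdef by (intro sum.mono_neutral_left) (auto simp: coeff_eq_0)
qed simp

text \<open>\<open>g l\<close> is the direction of step \<open>l\<close>; multi-indices become
  counts of past directions, the form shared with \<open>label_rank\<close>.\<close>

lemma is_path_steps:
  assumes "is_path r p"
  obtains g where "\<And>l. g l < r" "\<And>l i. p l i = card {k. k < l \<and> g k = i}"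
proof -
  have p0: "p 0 = (\<lambda>_. 0)" and "\<forall>l. \<exists>i. i < r \<and> p (Suc l) = (p l)(i := p l i + 1)"
    using assms by (auto simp: is_path_def)
  then obtain g where g: "\<And>l. g l < r" "\<And>l. p (Suc l) = (p l)(g l := p l (g l) + 1)" by metis
  have "p l i = card {k. k < l \<and> g k = i}" for l i
  proof (induction l)
    case (Suc l)
    show ?case
    proof (cases "g l = i")
      case True
      then have "{k. k < Suc l \<and> g k = i} = insert l {k. k < l \<and> g k = i}" by (auto simp: less_Suc_eq)
      then show ?thesis using Suc g(2)[of l] True by simp
    next
      case False
      then have "{k. k < Suc l \<and> g k = i} = {k. k < l \<and> g k = i}" by (auto simp: less_Suc_eq)
      then show ?thesis using Suc g(2)[of l] False by simp
    qed
  qed (simp add: p0)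
  then show ?thesis using that g(1) by blast
qed

context ensemble
begin

text \<open>The first \<open>n\<close> coordinates enumerate, each once, the pairs of a label and an
  exponent below the corresponding multi-index entry. The sum over them is therefore the expansion
  of the polynomials \<open>B i\<close> in monomials.\<close>

lemma integral_labelled_poly:
  assumes B: "\<And>i. i < r \<Longrightarrow> B i = 0 \<or> degree (B i) < card {k. k < n \<and> g k = i}" and h: "continuous_on UNIV h"
  shows "(\<Sum>m<n. coeff (B (g m)) (label_rank g m) * (\<integral>y. y ^ label_rank g m * h y \<partial>\<mu> (g m))) = (\<Sum>i<r. \<integral>y. poly (B i) y * h y \<partial>\<mu> i)"
proof -
  have "(\<Sum>m<n. coeff (B (g m)) (label_rank g m) * (\<integral>y. y ^ label_rank g m * h y \<partial>\<mu> (g m)))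
    = (\<Sum>i<r. \<Sum>e<card {k. k < n \<and> g k = i}. coeff (B i) e * (\<integral>y. y ^ e * h y \<partial>\<mu> i))"
    by (rule sum_over_labels[OF g])
  also have "\<dots> = (\<Sum>i<r. \<integral>y. poly (B i) y * h y \<partial>\<mu> i)"
  proof (intro sum.cong refl)
    fix i assume "i \<in> {..<r}"
    then have i: "i < r" by simp
    have "(\<integral>y. poly (B i) y * h y \<partial>\<mu> i) = (\<integral>y. (\<Sum>e<card {k. k < n \<and> g k = i}. coeff (B i) e * (y ^ e * h y)) \<partial>\<mu> i)"
      by (intro Bochner_Integration.integral_cong refl)
        (simp add: poly_eq_sum_lessThan[OF B[OF i]] sum_distrib_right mult.assoc)
    also have "\<dots> = (\<Sum>e<card {k. k < n \<and> g k = i}. coeff (B i) e * (\<integral>y. y ^ e * h y \<partial>\<mu> i))"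
      using h by (subst Bochner_Integration.integral_sum) (auto intro!: integrable_mult_right integrable_cont[OF i] continuous_intros)
    finally show "(\<Sum>e<card {k. k < n \<and> g k = i}. coeff (B i) e * (\<integral>y. y ^ e * h y \<partial>\<mu> i)) = (\<integral>y. poly (B i) y * h y \<partial>\<mu> i)" ..
  qed
  finally show ?thesis .
qed

text \<open>Each \<open>\<mu> i\<close> is absolutely continuous with respect to the sum, so its
  Radon-Nikodym derivative turns integrals over the sum back into integrals over
  \<open>\<mu> i\<close>.\<close>

lemma integral_cd_kernel:
  assumes f: "continuous_on UNIV f"
  shows "(\<integral>x. f x * cd_kernel r \<mu> p P A n x x \<partial>msum r \<mu>)
    = (\<Sum>j<n. \<Sum>i<r. \<integral>y. poly (A (p (Suc j)) i) y * (poly (P (p j)) y * f y) \<partial>\<mu> i)"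
proof -
  let ?h = "\<lambda>j i y. poly (A (p (Suc j)) i) y * (poly (P (p j)) y * f y)"
  let ?w = "\<lambda>i x. enn2real (RN_deriv (msum r \<mu>) (\<mu> i) x)"
  have fb: "fin_borel (msum r \<mu>)" by (intro fin_borel_msum mu)
  interpret sigma_finite_measure "msum r \<mu>" by (rule fin_borelD(4)[OF fb])
  have ac: "absolutely_continuous (msum r \<mu>) (\<mu> i)" "sets (\<mu> i) = sets (msum r \<mu>)" "sigma_finite_measure (\<mu> i)" if i: "i < r" for i
  proof -
    show s: "sets (\<mu> i) = sets (msum r \<mu>)" using fin_borelD(1)[OF mu[OF i]] by simp
    show "sigma_finite_measure (\<mu> i)" by (rule fin_borelD(4)[OF mu[OF i]])
    show "absolutely_continuous (msum r \<mu>) (\<mu> i)"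
      unfolding absolutely_continuous_def
    proof
      fix N assume N: "N \<in> null_sets (msum r \<mu>)"
      then have "N \<in> sets borel" "(\<Sum>k<r. emeasure (\<mu> k) N) = 0"
        using fin_borelD(1)[OF mu] by (auto simp: null_sets_def emeasure_msum)
      then show "N \<in> null_sets (\<mu> i)" using i s by (auto simp: null_sets_def)
    qed
  qed
  have hc: "continuous_on UNIV (?h j i)" for j i using f by (intro continuous_intros)
  have hm: "?h j i \<in> borel_measurable (msum r \<mu>)" for j i
    using borel_measurable_continuous_onI[OF hc] by simp
  have i1: "integrable (msum r \<mu>) (\<lambda>x. ?w i x * ?h j i x)" if "i < r" for i j
    using RN_deriv_integrable[OF ac(3)[OF that] ac(1,2)[OF that] hm] integrable_cont[OF that hc] by simp
  have "(\<integral>x. f x * cd_kernel r \<mu> p P A n x x \<partial>msum r \<mu>) = (\<integral>x. (\<Sum>j<n. \<Sum>i<r. ?w i x * ?h j i x) \<partial>msum r \<mu>)"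
    by (intro Bochner_Integration.integral_cong refl) (simp add: cd_kernel_def sum_distrib_left mult_ac)
  also have "\<dots> = (\<Sum>j<n. \<integral>x. (\<Sum>i<r. ?w i x * ?h j i x) \<partial>msum r \<mu>)"
    by (intro Bochner_Integration.integral_sum Bochner_Integration.integrable_sum i1) auto
  also have "\<dots> = (\<Sum>j<n. \<Sum>i<r. \<integral>x. ?w i x * ?h j i x \<partial>msum r \<mu>)"
    by (intro sum.cong refl Bochner_Integration.integral_sum i1) auto
  also have "\<dots> = (\<Sum>j<n. \<Sum>i<r. \<integral>y. ?h j i y \<partial>\<mu> i)"
  proof (intro sum.cong refl)
    fix j i assume "i \<in> {..<r}"
    then show "(\<integral>x. ?w i x * ?h j i x \<partial>msum r \<mu>) = (\<integral>y. ?h j i y \<partial>\<mu> i)"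
      using RN_deriv_integral[OF ac(3) ac(1,2) hm, of i j i] by simp
  qed
  finally show ?thesis .
qed

lemma cd_kernel_limit:
  assumes p: "\<And>l i. p l i = card {k. k < l \<and> g k = i}"
    and typeII: "\<And>n. n \<in> multi_idx r \<Longrightarrow> typeII r \<mu> n (P n)"
    and typeI: "\<And>n. n \<in> multi_idx r \<Longrightarrow> mlen r n \<ge> 1 \<Longrightarrow> typeI r \<mu> n (A n)"
    and f: "continuous_on UNIV f"
  shows "(\<lambda>n. (1 / real n) * (\<integral>x. f x * cd_kernel r \<mu> p P A n x x \<partial>msum r \<mu>)) \<longlonglongrightarrow> (\<integral>x. f x \<partial>msum r \<omega>)"
proof -
  define R where "R = (\<lambda>k. P (p k))"
  define Q where "Q = (\<lambda>l. A (p (Suc l)))"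
  have idx: "p l \<in> multi_idx r" for l
  proof -
    have "{k. k < l \<and> g k = i} = {}" if "r \<le> i" for i using g that by (metis (mono_tags, lifting) empty_Collect_eq leD)
    then show ?thesis by (simp add: multi_idx_def p)
  qed
  have len: "mlen r (p l) = l" for l
  proof -
    have "(\<Sum>m<l. (1::real)) = (\<Sum>i<r. \<Sum>e<card {k. k < l \<and> g k = i}. 1)"
      by (rule sum_over_labels[OF g, where \<phi>="\<lambda>_ _. 1"])
    then have "real l = real (mlen r (p l))" by (simp add: mlen_def p)
    then show ?thesis by simp
  qed
  have II: "lead_coeff (R k) = 1" "degree (R k) = k" "\<And>j e. j < r \<Longrightarrow> e < p k j \<Longrightarrow> (\<integral>x. x ^ e * poly (R k) x \<partial>\<mu> j) = 0" for k
    using typeII[OF idx[of k]] len[of k] by (auto simp: typeII_def R_def)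
  have I1: "Q l j = 0 \<or> degree (Q l j) < p (Suc l) j" if "j < r" for l j
    using typeI[OF idx[of "Suc l"]] len[of "Suc l"] that by (auto simp: typeI_def Q_def)
  \<comment> \<open>\<open>Q l\<close> belongs to the multi-index of length \<open>Suc l\<close>, so
    its total moments of order below \<open>l\<close> vanish and that of order \<open>l\<close> is
    1.\<close>
  have I2: "(\<Sum>j<r. \<integral>x. x ^ e * poly (Q l j) x \<partial>\<mu> j) = (if e = l then 1 else 0)" if "e \<le> l" for l e
    using typeI[OF idx[of "Suc l"]] len[of "Suc l"] that by (auto simp: typeI_def Q_def)
  have pmono: "p l i \<le> p n i" if "l \<le> n" for l n i
    unfolding p using that by (intro card_mono) auto
  have Qdeg: "Q l i = 0 \<or> degree (Q l i) < card {k. k < n \<and> g k = i}" if "l < n" "i < r" for l n i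
    using I1[OF that(2), of l] pmono[of "Suc l" n i] that(1) unfolding p[symmetric] by auto
  have polyc: "continuous_on UNIV (poly q)" for q :: "real poly" by (intro continuous_intros)
  \<comment> \<open>The coefficient of \<open>Q l\<close> at the monomial attached to coordinate
    \<open>m\<close>.\<close>
  define C where "C = (\<lambda>l m. coeff (Q l (g m)) (label_rank g m))"
  have bio: "(\<Sum>m<n. C l m * (\<integral>y. poly (R k) y * y ^ label_rank g m \<partial>\<mu> (g m))) = (if l = k then 1 else 0)"
    if lk: "l < n" "k < n" for n l k
  proof -
    have "(\<Sum>m<n. C l m * (\<integral>y. poly (R k) y * y ^ label_rank g m \<partial>\<mu> (g m))) = (\<Sum>i<r. \<integral>y. poly (Q l i) y * poly (R k) y \<partial>\<mu> i)"
      unfolding C_def using integral_labelled_poly[of "Q l" n "poly (R k)", OF Qdeg[OF lk(1)] polyc] by (simp add: mult.commute)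
    also have "\<dots> = (if l = k then 1 else 0)"
    proof (cases "k \<le> l")
      case True
      \<comment> \<open>Type I conditions: \<open>R k\<close> is expanded in powers up to
        \<open>k\<close>, and only the power \<open>l\<close> survives; it occurs exactly when
        \<open>k = l\<close>, with leading coefficient 1.\<close>
      have "(\<Sum>i<r. \<integral>y. poly (Q l i) y * poly (R k) y \<partial>\<mu> i) = (\<Sum>i<r. \<Sum>e\<le>k. coeff (R k) e * (\<integral>y. y ^ e * poly (Q l i) y \<partial>\<mu> i))"
      proof (intro sum.cong refl)
        fix i assume "i \<in> {..<r}"
        then have i: "i < r" by simp
        have "(\<integral>y. poly (Q l i) y * poly (R k) y \<partial>\<mu> i) = (\<integral>y. (\<Sum>e\<le>k. coeff (R k) e * (y ^ e * poly (Q l i) y)) \<partial>\<mu> i)"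
          by (intro Bochner_Integration.integral_cong refl) (simp add: poly_altdef[of "R k"] II(2) sum_distrib_left mult_ac)
        also have "\<dots> = (\<Sum>e\<le>k. coeff (R k) e * (\<integral>y. y ^ e * poly (Q l i) y \<partial>\<mu> i))"
          by (subst Bochner_Integration.integral_sum) (auto intro!: integrable_mult_right integrable_cont[OF i] continuous_intros)
        finally show "(\<integral>y. poly (Q l i) y * poly (R k) y \<partial>\<mu> i) = (\<Sum>e\<le>k. coeff (R k) e * (\<integral>y. y ^ e * poly (Q l i) y \<partial>\<mu> i))" .
      qed
      also have "\<dots> = (\<Sum>e\<le>k. coeff (R k) e * (\<Sum>i<r. \<integral>y. y ^ e * poly (Q l i) y \<partial>\<mu> i))"
        by (subst sum.swap) (simp add: sum_distrib_left)
      also have "\<dots> = (\<Sum>e\<le>k. if e = l then coeff (R k) e else 0)"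
        using True by (intro sum.cong refl) (simp add: I2)
      also have "\<dots> = (if l = k then 1 else 0)" using True II(1)[of k] II(2)[of k] by auto
      finally show ?thesis .
    next
      case False
      \<comment> \<open>Type II conditions: for \<open>l < k\<close> a nonzero \<open>Q l i\<close>
        has degree below \<open>p (Suc l) i\<close>, which is at most \<open>p k i\<close>, so each
        component integral vanishes separately.\<close>
      have "(\<integral>y. poly (Q l i) y * poly (R k) y \<partial>\<mu> i) = 0" if i: "i < r" for i
      proof -
        have "(\<integral>y. poly (Q l i) y * poly (R k) y \<partial>\<mu> i) = (\<integral>y. (\<Sum>e<p (Suc l) i. coeff (Q l i) e * (y ^ e * poly (R k) y)) \<partial>\<mu> i)"
          by (intro Bochner_Integration.integral_cong refl) (simp add: poly_eq_sum_lessThan[OF I1[OF i]] sum_distrib_right mult.assoc)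
        also have "\<dots> = (\<Sum>e<p (Suc l) i. coeff (Q l i) e * (\<integral>y. y ^ e * poly (R k) y \<partial>\<mu> i))"
          by (subst Bochner_Integration.integral_sum) (auto intro!: integrable_mult_right integrable_cont[OF i] continuous_intros)
        also have "\<dots> = 0"
          using pmono[of "Suc l" k i] False by (intro sum.neutral) (auto simp: II(3)[OF i])
        finally show ?thesis .
      qed
      then show ?thesis using False by simp
    qed
    finally show ?thesis .
  qed
  have eq: "(\<integral>x. f x * cd_kernel r \<mu> p P A n x x \<partial>msum r \<mu>) = mean f n" if n: "0 < n" for n
  proof -
    have "(\<integral>x. f x * cd_kernel r \<mu> p P A n x x \<partial>msum r \<mu>) = (\<Sum>k<n. \<Sum>i<r. \<integral>y. poly (Q k i) y * (poly (R k) y * f y) \<partial>\<mu> i)"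
      unfolding integral_cd_kernel[OF f] Q_def R_def ..
    also have "\<dots> = (\<Sum>k<n. \<Sum>m<n. C k m * (\<integral>y. poly (R k) y * (y ^ label_rank g m * f y) \<partial>\<mu> (g m)))"
    proof (rule sum.cong[OF refl])
      fix k assume "k \<in> {..<n}"
      then have k: "k < n" by simp
      have "continuous_on UNIV (\<lambda>y. poly (R k) y * f y)" using f by (intro continuous_intros)
      from integral_labelled_poly[of "Q k" n, OF Qdeg[OF k] this]
      show "(\<Sum>i<r. \<integral>y. poly (Q k i) y * (poly (R k) y * f y) \<partial>\<mu> i) = (\<Sum>m<n. C k m * (\<integral>y. poly (R k) y * (y ^ label_rank g m * f y) \<partial>\<mu> (g m)))"
        by (simp add: C_def mult.left_commute)
    qed
    finally have "mean f n * partition_fn n = (\<integral>x. f x * cd_kernel r \<mu> p P A n x x \<partial>msum r \<mu>) * partition_fn n"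
      using ensemble_mean[OF II(2) II(1) bio f, of n] by (simp only: mean_eq)
    then show ?thesis using partition_fn_pos[OF n] by simp
  qed
  have "\<forall>\<^sub>F n in sequentially. mean f n / real n = (1 / real n) * (\<integral>x. f x * cd_kernel r \<mu> p P A n x x \<partial>msum r \<mu>)"
    by (rule eventually_mono[OF eventually_gt_at_top[of 0]]) (simp add: eq)
  then show ?thesis by (rule Lim_transform_eventually[OF mean_limit[OF f]])
qed

end

theorem theorem6:
  fixes r :: nat and \<mu>s :: "nat \<Rightarrow> real measure" and a b s :: "nat \<Rightarrow> real"
    and p :: "nat \<Rightarrow> nat \<Rightarrow> nat"
    and P :: "(nat \<Rightarrow> nat) \<Rightarrow> real poly" and A :: "(nat \<Rightarrow> nat) \<Rightarrow> nat \<Rightarrow> real poly"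
    and \<omega> :: "nat \<Rightarrow> real measure"
  assumes ang: "angelesco r \<mu>s a b"
    and typeII: "\<And>n. n \<in> multi_idx r \<Longrightarrow> typeII r \<mu>s n (P n)"
    and typeI: "\<And>n. n \<in> multi_idx r \<Longrightarrow> mlen r n \<ge> 1 \<Longrightarrow> typeI r \<mu>s n (A n)"
    and path: "is_path r p"
    and lim: "\<And>i. i < r \<Longrightarrow> (\<lambda>l. real (p l i) / real l) \<longlonglongrightarrow> s i"
    and spos: "\<And>i. i < r \<Longrightarrow> s i > 0"
    and ssum: "(\<Sum>i<r. s i) = 1"
    and omega: "energy_minimizer r a b s \<omega>"
  shows "\<forall>f :: real \<Rightarrow> real. continuous_on UNIV f \<and> bounded (range f) \<longrightarrow>
           (\<lambda>n. (1 / real n) * (\<integral>x. f x * cd_kernel r \<mu>s p P A n x x \<partial>(msum r \<mu>s)))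
             \<longlonglongrightarrow> (\<integral>x. f x \<partial>(msum r \<omega>))"
proof -
  obtain g where g: "\<And>l. g l < r" and p: "\<And>l i. p l i = card {k. k < l \<and> g k = i}"
    using is_path_steps[OF path] by blast
  interpret ensemble r a b s \<omega> \<mu>s g
  proof
    show "a i < b i" if "i < r" for i using ang that by (simp add: angelesco_def)
    show "{a i..b i} \<inter> {a j..b j} = {}" if "i < r" "j < r" "i \<noteq> j" for i j using ang that by (simp add: angelesco_def)
    show "0 < s i" if "i < r" for i by (rule spos[OF that])
    show "(\<Sum>i<r. s i) = 1" by (rule ssum)
    show "energy_minimizer r a b s \<omega>" by (rule omega)
    show "g m < r" for m by (rule g)
    show "(\<lambda>n. real (card {k. k < n \<and> g k = i}) / real n) \<longlonglongrightarrow> s i" if "i < r" for i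
      using lim[OF that] by (simp only: p)
    show fb: "fin_borel (\<mu>s i)" if "i < r" for i using ang that by (simp add: angelesco_def fin_borel_def)
    show "AE x in \<mu>s i. x \<in> {a i..b i}" if "i < r" for i
    proof (rule eventually_mono[OF AE_in_msupp[OF fin_borelD(1)[OF fb[OF that]]]])
      fix x assume "x \<in> msupp (\<mu>s i)"
      then have "x \<in> convex hull (msupp (\<mu>s i))" by (rule hull_inc)
      then show "x \<in> {a i..b i}" using ang that by (simp add: angelesco_def)
    qed
    show "\<exists>f\<in>borel_measurable borel. (\<forall>A\<in>sets borel. (\<integral>\<^sup>+x\<in>A. f x \<partial>lborel) \<le> emeasure (\<mu>s i) A)
        \<and> (AE x in lborel. x \<in> {a i..b i} \<longrightarrow> 0 < f x)" if i: "i < r" for i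
    proof -
      obtain f \<sigma> where "f \<in> borel_measurable borel" "AE x in lborel. x \<in> {a i..b i} \<longrightarrow> f x > (0::ennreal)"
        and "\<forall>A\<in>sets borel. emeasure (\<mu>s i) A = (\<integral>\<^sup>+x\<in>A. f x \<partial>lborel) + emeasure \<sigma> A"
        using ang i unfolding angelesco_def by blast
      then show ?thesis by (intro bexI[of _ f]) auto
    qed
  qed
  show ?thesis
    using cd_kernel_limit[OF p typeII typeI] by blast
qed

end
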